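(* The family of polynomials $\widetilde{\mathfrak S}_w\in\Lambda[x,y]$, $w\in S_\mathbb{Z}$, satisfies, and is uniquely determined by, the following properties: (1) $\widetilde{\mathfrak S}_w$ is homogeneous of degree $\ell(w)$; (2) $\widetilde{\mathfrak S}_{\mathrm{id}}=1$; (3) for every $w\in S_\mathbb{Z}$ and every integer $i$, $\partial_i^x(\widetilde{\mathfrak S}_w)=\widetilde{\mathfrak S}_{ws_i}$ if $\ell(ws_i)<\ell(w)$ and $\partial_i^x(\widetilde{\mathfrak S}_w)=0$ if $\ell(ws_i)>\ell(w)$; and $\partial_i^y(\widetilde{\mathfrak S}_w)=\widetilde{\mathfrak S}_{s_iw}$ if $\ell(s_iw)<\ell(w)$ and $\partial_i^y(\widetilde{\mathfrak S}_w)=0$ if $\ell(s_iw)>\ell(w)$.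
   Context: Let $\Lambda=\mathbb{Z}[c_1,c_2,\ldots]$ ($c_k$ of degree $k$) and $\Lambda[x,y]$ the polynomial ring over $\Lambda$ in indeterminates $x_i,y_i$, $i\in\mathbb{Z}$, each of degree $1$. Write $c=\sum_{k\ge0}c_kt^k$ ($c_0=1$); a ring map "sending $c$ to a series $a$" sends $c_k$ to the coefficient of $t^k$ in $a$. $S_\mathbb{Z}$ is the group of bijections of $\mathbb{Z}$ fixing all but finitely many integers; $S_+$ the subgroup fixing every integer $\le0$; $s_i$ is the transposition of $i$ and $i+1$; $\ell(w)=\#\{(i,j):i<j,\ w(i)>w(j)\}$. Difference operators: for $i\in\mathbb{Z}$, $s_i^x$ is the ring automorphism of $\Lambda[x,y]$ interchanging $x_i$ and $x_{i+1}$, fixing all other $x_j$ and all $y_j$, fixing every $c_k$ if $i\ne0$, and with $s_0^x(c)=c(t)\frac{1-x_0t}{1-x_1t}$; then $\partial_i^x(f)=(f-s_i^x(f))/(x_i-x_{i+1})$ (so $\partial_0^x(c_k)=\sum_{a+b=k-1}x_1^ac_b$). Symmetrically, $s_i^y$ interchanges $y_i,y_{i+1}$, fixes other $y_j$ and all $x_j$, fixes every $c_k$ if $i\neq0$, and $s_0^y(c)=c(t)\frac{1+y_1t}{1+y_0t}$; $\partial_i^y(f)=(f-s_i^y(f))/(y_i-y_{i+1})$. For $m\in\mathbb{Z}$, $\gamma^m(w)$ is $i+m\mapsto w(i)+m$, and $\gamma^m$ is the ring automorphism of $\Lambda[x,y]$ with $x_i\mapsto x_{i+m}$, $y_i\mapsto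 y_{i+m}$, $\gamma^m(c)=c\prod_{i=1}^m\frac{1+y_it}{1-x_it}$ ($m>0$), $\gamma^m(c)=c\prod_{i=m+1}^0\frac{1-x_it}{1+y_it}$ ($m<0$). For $w\in S_+$, $\mathfrak S_w(x;y)$ is the classical Lascoux–Schützenberger double Schubert polynomial (with $\mathfrak S_{w_0}=\prod_{i+j\le n}(x_i-y_j)$ for the longest $w_0\in S_n$). The enriched Schubert polynomial $\widetilde{\mathfrak S}_w$ is the unique element of $\Lambda[x,y]$ such that for every positive $m$ with $\gamma^m(w)\in S_+$, setting all $c_k=0$ in $\gamma^m(\widetilde{\mathfrak S}_w)$ gives $\mathfrak S_{\gamma^m(w)}(x;-y)$. *)

theory Defs
  imports
    "HOL-Library.Poly_Mapping"
    "HOL-Library.Countable"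
    "HOL-Combinatorics.Transposition"
    "HOL-Computational_Algebra.Formal_Power_Series"
begin

section \<open>The ring \<open>\<Lambda>[x,y]\<close>\<close>

text \<open>\<open>CVar k\<close> is the indeterminate \<open>c\<^sub>k\<^sub>+\<^sub>1\<close>, because \<open>c\<^sub>0 = 1\<close> is not an indeterminate.\<close>

datatype lvar = CVar nat | XVar int | YVar int

type_synonym lring = "(lvar \<Rightarrow>\<^sub>0 nat) \<Rightarrow>\<^sub>0 int"

definition indet :: "lvar \<Rightarrow> lring" where
  "indet v = Poly_Mapping.single (Poly_Mapping.single v 1) 1"

definition xx :: "int \<Rightarrow> lring" where
  "xx i = indet (XVar i)"

definition yy :: "int \<Rightarrow> lring" where
  "yy i = indet (YVar i)"

definition cc :: "nat \<Rightarrow> lring" where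
  "cc k = (case k of 0 \<Rightarrow> 1 | Suc j \<Rightarrow> indet (CVar j))"

definition c_series :: "lring fps" where
  "c_series = Abs_fps cc"

fun var_degree :: "lvar \<Rightarrow> nat" where
  "var_degree (CVar k) = Suc k"
| "var_degree (XVar i) = 1"
| "var_degree (YVar i) = 1"

definition homogeneous :: "nat \<Rightarrow> lring \<Rightarrow> bool" where
  "homogeneous d f \<longleftrightarrow>
     (\<forall>m \<in> Poly_Mapping.keys f.
        (\<Sum>v \<in> Poly_Mapping.keys m. Poly_Mapping.lookup m v * var_degree v) = d)"

text \<open>An arbitrary linear order on the indeterminates; its only purpose is to make the
  library's \<open>idom\<close> instance apply to \<^typ>\<open>lring\<close>.\<close>

instance lvar :: countable
  by countable_datatype

instantiation lvar :: linorder
begin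

definition less_eq_lvar :: "lvar \<Rightarrow> lvar \<Rightarrow> bool" where
  "less_eq_lvar u v \<longleftrightarrow> to_nat u \<le> to_nat v"

definition less_lvar :: "lvar \<Rightarrow> lvar \<Rightarrow> bool" where
  "less_lvar u v \<longleftrightarrow> to_nat u < to_nat v"

instance
  by standard (auto simp: less_eq_lvar_def less_lvar_def)

end

section \<open>Ring homomorphisms out of \<open>\<Lambda>[x,y]\<close>\<close>

definition eval_monom :: "(lvar \<Rightarrow> lring) \<Rightarrow> (lvar \<Rightarrow>\<^sub>0 nat) \<Rightarrow> lring" where
  "eval_monom \<sigma> m = (\<Prod>v \<in> Poly_Mapping.keys m. \<sigma> v ^ Poly_Mapping.lookup m v)"

definition subst :: "(lvar \<Rightarrow> lring) \<Rightarrow> lring \<Rightarrow> lring" where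
  "subst \<sigma> f =
     (\<Sum>m \<in> Poly_Mapping.keys f. of_int (Poly_Mapping.lookup f m) * eval_monom \<sigma> m)"

lemma eval_monom_superset:
  assumes "finite S" "Poly_Mapping.keys m \<subseteq> S"
  shows "eval_monom \<sigma> m = (\<Prod>v \<in> S. \<sigma> v ^ Poly_Mapping.lookup m v)"
  unfolding eval_monom_def using assms
  by (intro prod.mono_neutral_left) (auto simp: in_keys_iff)

lemma eval_monom_add: "eval_monom \<sigma> (m + n) = eval_monom \<sigma> m * eval_monom \<sigma> n"
proof -
  let ?S = "Poly_Mapping.keys m \<union> Poly_Mapping.keys n"
  have "Poly_Mapping.keys (m + n) \<subseteq> ?S" by (rule Poly_Mapping.keys_add)
  then show ?thesis
    by (simp add: eval_monom_superset[of ?S] lookup_add power_add prod.distrib)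
qed

lemma subst_superset:
  assumes "finite S" "Poly_Mapping.keys f \<subseteq> S"
  shows "subst \<sigma> f = (\<Sum>m \<in> S. of_int (Poly_Mapping.lookup f m) * eval_monom \<sigma> m)"
  unfolding subst_def using assms
  by (intro sum.mono_neutral_left) (auto simp: in_keys_iff)

lemma subst_add: "subst \<sigma> (f + g) = subst \<sigma> f + subst \<sigma> g"
proof -
  let ?S = "Poly_Mapping.keys f \<union> Poly_Mapping.keys g"
  have "Poly_Mapping.keys (f + g) \<subseteq> ?S" by (rule Poly_Mapping.keys_add)
  then show ?thesis
    by (simp add: subst_superset[of ?S] lookup_add distrib_right sum.distrib)
qed

lemma subst_zero: "subst \<sigma> 0 = 0"
  by (simp add: subst_def)

lemma subst_single: "subst \<sigma> (Poly_Mapping.single m a) = of_int a * eval_monom \<sigma> m"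
  by (simp add: subst_def)

lemma subst_one: "subst \<sigma> 1 = 1"
  using subst_single[of \<sigma> 0 1] by (simp add: eval_monom_def)

lemma subst_indet: "subst \<sigma> (indet v) = \<sigma> v"
  by (simp add: indet_def subst_single eval_monom_def)

lemma lring_sum_induct [case_names zero single sum]:
  assumes "P (0 :: lring)" "\<And>m a. P (Poly_Mapping.single m a)"
    "\<And>f g. P f \<Longrightarrow> P g \<Longrightarrow> P (f + g)"
  shows "P f"
proof (induction f rule: update_induct)
  case const
  show ?case by (rule assms(1))
next
  case (update f a b)
  have "Poly_Mapping.update a b f = f + Poly_Mapping.single a b"
    using update.hyps
    by (intro poly_mapping_eqI) (auto simp: lookup_update lookup_add lookup_single in_keys_iff)
  then show ?case using assms(2,3) update.IH by simp
qed

lemma subst_mult: "subst \<sigma> (f * g) = subst \<sigma> f * subst \<sigma> g"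
proof (induction f rule: lring_sum_induct)
  case zero
  show ?case by (simp add: subst_zero)
next
  case (single m a)
  show ?case
  proof (induction g rule: lring_sum_induct)
    case zero
    show ?case by (simp add: subst_zero)
  next
    case (single n b)
    show ?case by (simp add: mult_single subst_single eval_monom_add)
  next
    case (sum g h)
    then show ?case by (simp add: distrib_left subst_add)
  qed
next
  case (sum f h)
  then show ?case by (simp add: distrib_right subst_add)
qed

text \<open>\<open>lring_map a \<xi> \<eta>\<close> sends \<open>c\<close> to the series \<open>a\<close>, \<open>x\<^sub>i\<close> to \<open>\<xi> i\<close> and \<open>y\<^sub>i\<close> to \<open>\<eta> i\<close>.\<close>

definition lring_map ::
  "lring fps \<Rightarrow> (int \<Rightarrow> lring) \<Rightarrow> (int \<Rightarrow> lring) \<Rightarrow> lring \<Rightarrow> lring" where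
  "lring_map a \<xi> \<eta> =
     subst (\<lambda>v. case v of CVar k \<Rightarrow> fps_nth a (Suc k) | XVar i \<Rightarrow> \<xi> i | YVar i \<Rightarrow> \<eta> i)"

definition lin_series :: "lring \<Rightarrow> lring fps" where
  "lin_series a = 1 + fps_const a * fps_X"

definition inv_lin_series :: "lring \<Rightarrow> lring fps" where
  "inv_lin_series a = Abs_fps (\<lambda>n. (- a) ^ n)"

lemma inv_lin_series: "lin_series a * inv_lin_series a = 1"
proof (rule fps_ext)
  fix n
  show "fps_nth (lin_series a * inv_lin_series a) n = fps_nth 1 n"
    by (cases n) (simp_all add: lin_series_def inv_lin_series_def distrib_right mult.assoc)
qed

section \<open>Permutations\<close>

definition S_Z :: "(int \<Rightarrow> int) set" where
  "S_Z = {w. bij w \<and> finite {i. w i \<noteq> i}}"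

definition S_plus :: "(int \<Rightarrow> int) set" where
  "S_plus = {w \<in> S_Z. \<forall>i\<le>0. w i = i}"

definition adj_transp :: "int \<Rightarrow> int \<Rightarrow> int" where
  "adj_transp i = transpose i (i + 1)"

definition perm_length :: "(int \<Rightarrow> int) \<Rightarrow> nat" where
  "perm_length w = card {(i, j). i < j \<and> w i > w j}"

definition shift_perm :: "int \<Rightarrow> (int \<Rightarrow> int) \<Rightarrow> int \<Rightarrow> int" where
  "shift_perm m w = (\<lambda>i. w (i - m) + m)"

definition longest_perm :: "nat \<Rightarrow> int \<Rightarrow> int" where
  "longest_perm n = (\<lambda>i. if 1 \<le> i \<and> i \<le> int n then int n + 1 - i else i)"

section \<open>Difference operators and the shift automorphism\<close>

definition exact_quot :: "lring \<Rightarrow> lring \<Rightarrow> lring" where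
  "exact_quot f g = (THE h. h * g = f)"

lemma exact_quot_mult:
  assumes "g \<noteq> 0"
  shows "exact_quot (h * g) g = h"
  unfolding exact_quot_def using assms by (intro the_equality) auto

definition sx :: "int \<Rightarrow> lring \<Rightarrow> lring" where
  "sx i = lring_map
     (if i = 0 then c_series * lin_series (- xx 0) * inv_lin_series (- xx 1) else c_series)
     (\<lambda>j. xx (adj_transp i j)) yy"

definition sy :: "int \<Rightarrow> lring \<Rightarrow> lring" where
  "sy i = lring_map
     (if i = 0 then c_series * lin_series (yy 1) * inv_lin_series (yy 0) else c_series)
     xx (\<lambda>j. yy (adj_transp i j))"

definition partial_x :: "int \<Rightarrow> lring \<Rightarrow> lring" where
  "partial_x i f = exact_quot (f - sx i f) (xx i - xx (i + 1))"

definition partial_y :: "int \<Rightarrow> lring \<Rightarrow> lring" where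
  "partial_y i f = exact_quot (f - sy i f) (yy i - yy (i + 1))"

definition shift_ring :: "int \<Rightarrow> lring \<Rightarrow> lring" where
  "shift_ring m = lring_map
     (if m \<ge> 0 then c_series * (\<Prod>i\<in>{1..m}. lin_series (yy i) * inv_lin_series (- xx i))
      else c_series * (\<Prod>i\<in>{m+1..0}. lin_series (- xx i) * inv_lin_series (yy i)))
     (\<lambda>i. xx (i + m)) (\<lambda>i. yy (i + m))"

definition set_c_zero :: "lring \<Rightarrow> lring" where
  "set_c_zero = lring_map 1 xx yy"

section \<open>Schubert polynomials\<close>

text \<open>The Lascoux--Schuetzenberger definition: start from the product formula for the longest
  element of some \<open>S\<^sub>n\<close> and apply divided differences along descents. For \<open>i \<ge> 1\<close>,
  \<^const>\<open>partial_x\<close> is the ordinary divided difference operator, and no \<open>c\<^sub>k\<close> occurs.\<close>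

inductive is_double_schubert :: "(int \<Rightarrow> int) \<Rightarrow> lring \<Rightarrow> bool" where
  longest: "is_double_schubert (longest_perm n)
     (\<Prod>(i, j) \<in> {(i, j). 1 \<le> i \<and> 1 \<le> j \<and> i + j \<le> int n}. xx i - yy j)"
| descent: "is_double_schubert w f \<Longrightarrow> i \<ge> 1 \<Longrightarrow> w i > w (i + 1) \<Longrightarrow>
     is_double_schubert (w \<circ> adj_transp i) (partial_x i f)"

definition double_schubert :: "(int \<Rightarrow> int) \<Rightarrow> lring" where
  "double_schubert w = (THE f. is_double_schubert w f)"

definition negate_y :: "lring \<Rightarrow> lring" where
  "negate_y = lring_map c_series xx (\<lambda>i. - yy i)"

definition enriched_schubert :: "(int \<Rightarrow> int) \<Rightarrow> lring" where
  "enriched_schubert w =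
     (THE f. \<forall>m>0. shift_perm m w \<in> S_plus \<longrightarrow>
        set_c_zero (shift_ring m f) = negate_y (double_schubert (shift_perm m w)))"

definition schubert_properties :: "((int \<Rightarrow> int) \<Rightarrow> lring) \<Rightarrow> bool" where
  "schubert_properties F \<longleftrightarrow>
     (\<forall>w \<in> S_Z. homogeneous (perm_length w) (F w)) \<and>
     F id = 1 \<and>
     (\<forall>w \<in> S_Z. \<forall>i.
        (perm_length (w \<circ> adj_transp i) < perm_length w \<longrightarrow>
           partial_x i (F w) = F (w \<circ> adj_transp i)) \<and>
        (perm_length (w \<circ> adj_transp i) > perm_length w \<longrightarrow>
           partial_x i (F w) = 0) \<and>
        (perm_length (adj_transp i \<circ> w) < perm_length w \<longrightarrow>
           partial_y i (F w) = F (adj_transp i \<circ> w)) \<and>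
        (perm_length (adj_transp i \<circ> w) > perm_length w \<longrightarrow>
           partial_y i (F w) = 0))"

end

theory Submission
  imports Defs
    "Jordan_Normal_Form.Determinant"
    "HOL-Computational_Algebra.Fundamental_Theorem_Algebra"
    "HOL-Computational_Algebra.Polynomial_FPS"
begin

text \<open>For the reversal of an interval \<open>[a, b]\<close> the polynomial is a determinant in the coefficients of
  the series \<open>c \<Prod>\<^bsub>j \<le> q\<^esub> (1 + y\<^sub>j t) / \<Prod>\<^bsub>i \<le> p\<^esub> (1 - x\<^sub>i t)\<close>, normalised at \<open>p = q = 0\<close>. A divided
  difference changes at most one row of it, and comparing the effects of \<open>\<partial>\<^sup>x\<close> and \<open>\<partial>\<^sup>y\<close> gives
  \<open>\<partial>\<^sup>x\<^sub>i = \<partial>\<^sup>y\<^bsub>a+b-1-i\<^esub>\<close> on the determinant, the two results differing by a determinant with two equal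
  rows. By the braid relations, applying the \<open>\<partial>\<^sup>x\<close> along descents defines a family on the permutations
  of \<open>[a, b]\<close>, and the commutation of \<open>\<partial>\<^sup>x\<close> and \<open>\<partial>\<^sup>y\<close> propagates the \<open>y\<close>-rule from the top. The
  determinant of a subinterval is reached from that of the interval by divided differences, so these
  families glue to one on \<open>S\<^sub>\<int>\<close>. At \<open>c = 1\<close> the determinant of \<open>[1, n]\<close> becomes \<open>\<Prod> (x\<^sub>i + y\<^sub>j)\<close>, which
  identifies the specialisations with double Schubert polynomials.

  An element whose specialisations at \<open>c = 1\<close> of all large shifts vanish is zero: over the complex
  numbers the free variables \<open>y\<^sub>j\<close> realise any values of finitely many \<open>c\<^sub>k\<close>. For uniqueness, a
  difference of two families is invariant under all \<open>s\<^sup>x\<^sub>i\<close> and \<open>s\<^sup>y\<^sub>i\<close>; its specialisations are symmetric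
  in infinitely many variables, hence constant, hence zero by homogeneity.\<close>

section \<open>Evaluation homomorphisms\<close>

text \<open>Only the reflections at index 0 move the c_k. Reading \<open>c\<close> as a formal
  product of (1 + y_j t)/(1 - x_i t) over all i, j \<le> 0 removes this exception: every reflection
  exchanges two factors, and a shift renames indices, hidden ones included. A homomorphism is then
  determined by the images of the x_i, the y_j and one series \<open>c_flag p q\<close>, and
  \<open>p\<close>, \<open>q\<close> can be chosen so that the reflections at hand fix that series.
  Identities among reflections and shifts thus reduce to the variables, uniformly in the index. With
  \<open>c\<close> present the polynomial of a longest element is no longer a product of factors x_i
  + y_j. What replaces it is the flagged Jacobi-Trudi (Kempf-Laksov) determinant of the staircase
  partition (n, ..., 1), n = b - a. Two constructions, one from x-operators and one from
  y-operators, would leave their agreement open. The family is therefore built from x-operators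
  alone; the identity at the top yields the y-rule, and this rule is what removes the right end of
  an interval, as the x-operators remove the left one.\<close>

definition lring_eval :: "(lvar \<Rightarrow> 'a) \<Rightarrow> lring \<Rightarrow> 'a :: comm_ring_1" where
  "lring_eval p f = (\<Sum>m \<in> Poly_Mapping.keys f. of_int (Poly_Mapping.lookup f m) *
     (\<Prod>v \<in> Poly_Mapping.keys m. p v ^ Poly_Mapping.lookup m v))"

text \<open>The target of \<open>lring_eval\<close> is any commutative ring because complex points
  are needed later; through this equation the ring maps of the definitions inherit its homomorphism
  laws.\<close>

lemma subst_eq_lring_eval: "subst = lring_eval"
  by (simp add: fun_eq_iff subst_def lring_eval_def eval_monom_def)

lemma monom_prod_superset:
  fixes p :: "lvar \<Rightarrow> 'a :: comm_monoid_mult"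
  assumes "finite S" "Poly_Mapping.keys m \<subseteq> S"
  shows "(\<Prod>v \<in> Poly_Mapping.keys m. p v ^ Poly_Mapping.lookup m v) = (\<Prod>v \<in> S. p v ^ Poly_Mapping.lookup m v)"
  using assms by (intro prod.mono_neutral_left) (auto simp: in_keys_iff)

lemma monom_prod_add:
  fixes p :: "lvar \<Rightarrow> 'a :: comm_monoid_mult"
  shows "(\<Prod>v \<in> Poly_Mapping.keys (m + n). p v ^ Poly_Mapping.lookup (m + n) v) =
    (\<Prod>v \<in> Poly_Mapping.keys m. p v ^ Poly_Mapping.lookup m v) * (\<Prod>v \<in> Poly_Mapping.keys n. p v ^ Poly_Mapping.lookup n v)"
proof -
  let ?S = "Poly_Mapping.keys m \<union> Poly_Mapping.keys n"
  have "Poly_Mapping.keys (m + n) \<subseteq> ?S" by (rule Poly_Mapping.keys_add)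
  then show ?thesis
    by (subst (1 2 3) monom_prod_superset[of ?S]) (simp_all add: lookup_add power_add prod.distrib)
qed

lemma lring_eval_superset:
  assumes "finite S" "Poly_Mapping.keys f \<subseteq> S"
  shows "lring_eval p f = (\<Sum>m \<in> S. of_int (Poly_Mapping.lookup f m) *
    (\<Prod>v \<in> Poly_Mapping.keys m. p v ^ Poly_Mapping.lookup m v))"
  unfolding lring_eval_def using assms
  by (intro sum.mono_neutral_left) (auto simp: in_keys_iff)

lemma lring_eval_add: "lring_eval p (f + g) = lring_eval p f + lring_eval p g"
proof -
  let ?S = "Poly_Mapping.keys f \<union> Poly_Mapping.keys g"
  have "Poly_Mapping.keys (f + g) \<subseteq> ?S" by (rule Poly_Mapping.keys_add)
  then show ?thesis
    by (simp add: lring_eval_superset[of ?S] lookup_add distrib_right sum.distrib)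
qed

lemma lring_eval_zero: "lring_eval p 0 = 0"
  by (simp add: lring_eval_def)

lemma lring_eval_single: "lring_eval p (Poly_Mapping.single m a) = of_int a *
    (\<Prod>v \<in> Poly_Mapping.keys m. p v ^ Poly_Mapping.lookup m v)"
  by (simp add: lring_eval_def)

lemma lring_eval_one: "lring_eval p 1 = 1"
  using lring_eval_single[of p 0 1] by simp

lemma lring_eval_indet [simp]: "lring_eval p (indet v) = p v"
  by (simp add: indet_def lring_eval_single)

lemma lring_eval_mult: "lring_eval p (f * g) = lring_eval p f * lring_eval p g"
proof (induction f rule: lring_sum_induct)
  case (single m a)
  show ?case
  proof (induction g rule: lring_sum_induct)
    case (single n b)
    show ?case by (simp add: mult_single lring_eval_single monom_prod_add)
  qed (simp_all add: lring_eval_zero distrib_left lring_eval_add)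
qed (simp_all add: lring_eval_zero distrib_right lring_eval_add)

interpretation lring_eval: comm_ring_hom "lring_eval p" for p
  by unfold_locales (simp_all add: lring_eval_zero lring_eval_one lring_eval_add lring_eval_mult)

lemma single_eq_prod_indet:
  "(Poly_Mapping.single m a :: lring) = of_int a * (\<Prod>v \<in> Poly_Mapping.keys m. indet v ^ Poly_Mapping.lookup m v)"
proof -
  have pow: "indet v ^ k = Poly_Mapping.single (Poly_Mapping.single v k) 1" for v k
    by (induction k) (simp_all add: indet_def mult_single single_add[symmetric])
  have prod: "(\<Prod>v \<in> S. Poly_Mapping.single (g v) 1) = (Poly_Mapping.single (sum g S) 1 :: lring)"
    if "finite S" for S and g :: "lvar \<Rightarrow> lvar \<Rightarrow>\<^sub>0 nat"
    using that by (induction S rule: finite_induct) (simp_all add: mult_single)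
  have "m = (\<Sum>v \<in> Poly_Mapping.keys m. Poly_Mapping.single v (Poly_Mapping.lookup m v))"
    by (rule poly_mapping_eqI)
      (simp add: lookup_sum lookup_single when_def in_keys_iff)
  moreover have "of_int a = (Poly_Mapping.single 0 a :: lring)"
    by (induction a rule: int_induct[of _ 0]) (simp_all add: single_add single_diff)
  ultimately show ?thesis
    by (simp add: pow prod mult_single flip: single_one)
qed

text \<open>Products are induction steps, so a claim about ring maps or twisted derivations has to
  be checked on indeterminates only.\<close>

lemma lring_induct [case_names of_int indet add mult]:
  assumes "\<And>a. P (of_int a :: lring)" "\<And>v. P (indet v)"
    "\<And>f g. P f \<Longrightarrow> P g \<Longrightarrow> P (f + g)" "\<And>f g. P f \<Longrightarrow> P g \<Longrightarrow> P (f * g)"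
  shows "P f"
proof (induction f rule: lring_sum_induct)
  case zero
  show ?case using assms(1)[of 0] by simp
next
  case (single m a)
  have one: "P 1" using assms(1)[of 1] by simp
  have pow: "P (indet v ^ k)" for v k
    by (induction k) (use assms(2,4) one in auto)
  have "P (\<Prod>v \<in> S. indet v ^ Poly_Mapping.lookup m v)" if "finite S" for S
    using that by (induction S rule: finite_induct) (use assms(4) pow one in auto)
  then show ?case using assms(1,4) by (simp add: single_eq_prod_indet)
qed (rule assms(3))

lemma lring_hom_ext_indet:
  assumes "comm_ring_hom (h :: lring \<Rightarrow> 'a :: comm_ring_1)" "comm_ring_hom k"
    and "\<And>v. h (indet v) = k (indet v)"
  shows "h f = k f"
proof -
  interpret h: comm_ring_hom h by fact
  interpret k: comm_ring_hom k by fact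
  show ?thesis
    by (induction f rule: lring_induct) (simp_all add: assms(3) h.hom_add k.hom_add h.hom_mult k.hom_mult h.hom_of_int k.hom_of_int)
qed

lemma comm_ring_hom_compose:
  assumes "comm_ring_hom h" "comm_ring_hom k"
  shows "comm_ring_hom (\<lambda>x. h (k x))"
proof -
  interpret h: comm_ring_hom h by fact
  interpret k: comm_ring_hom k by fact
  show ?thesis
    by unfold_locales (simp_all add: hom_distribs)
qed

text \<open>That a map \<open>h\<close> sends \<open>c\<close> to a series \<open>a\<close> now
  reads \<open>series_map h c_series = a\<close>.\<close>

definition series_map :: "('a \<Rightarrow> 'b) \<Rightarrow> 'a fps \<Rightarrow> 'b fps" where
  "series_map h a = Abs_fps (\<lambda>n. h (fps_nth a n))"

lemma series_map_nth [simp]: "fps_nth (series_map h a) n = h (fps_nth a n)"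
  by (simp add: series_map_def)

lemma series_map_compose: "series_map h (series_map k a) = series_map (\<lambda>x. h (k x)) a"
  by (simp add: fps_eq_iff)

lemma (in comm_ring_hom) series_map_hom: "comm_ring_hom (series_map hom)"
  by unfold_locales (simp_all add: fps_eq_iff fps_mult_nth hom_add hom_sum hom_mult)

section \<open>The flagged series\<close>

lemma (in comm_ring_hom) series_map_mult: "series_map hom (a * b) = series_map hom a * series_map hom b"
  by (simp add: fps_eq_iff fps_mult_nth hom_sum hom_mult)

lemma lring_map_eq_lring_eval: "lring_map a \<xi> \<eta> = lring_eval
    (\<lambda>v. case v of CVar k \<Rightarrow> fps_nth a (Suc k) | XVar i \<Rightarrow> \<xi> i | YVar i \<Rightarrow> \<eta> i)"
  by (simp add: lring_map_def subst_eq_lring_eval)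

lemma lring_map_xx [simp]: "lring_map a \<xi> \<eta> (xx i) = \<xi> i"
  and lring_map_yy [simp]: "lring_map a \<xi> \<eta> (yy i) = \<eta> i"
  by (simp_all add: lring_map_eq_lring_eval xx_def yy_def)

lemma c_series_nth_0 [simp]: "fps_nth c_series 0 = 1"
  by (simp add: c_series_def cc_def)

lemma lin_series_nth_0 [simp]: "fps_nth (lin_series a) 0 = 1"
  by (simp add: lin_series_def)

lemma inv_lin_series_nth_0 [simp]: "fps_nth (inv_lin_series a) 0 = 1"
  by (simp add: inv_lin_series_def)

text \<open>The condition on \<open>a\<close> reflects c_0 = 1: the constant coefficient is not the
  image of an indeterminate.\<close>

lemma series_map_lring_map:
  assumes "fps_nth a 0 = 1"
  shows "series_map (lring_map a \<xi> \<eta>) c_series = a"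
  by (rule fps_ext)
    (use assms in \<open>auto simp: lring_map_eq_lring_eval c_series_def cc_def lring_eval_one split: nat.split\<close>)

lemma comm_ring_hom_lring_map: "comm_ring_hom (lring_map a \<xi> \<eta>)"
  unfolding lring_map_eq_lring_eval by (rule lring_eval.comm_ring_hom_axioms)

interpretation sx: comm_ring_hom "sx i" for i
  unfolding sx_def by (rule comm_ring_hom_lring_map)

interpretation sy: comm_ring_hom "sy i" for i
  unfolding sy_def by (rule comm_ring_hom_lring_map)

interpretation shift_ring: comm_ring_hom "shift_ring m" for m
  unfolding shift_ring_def by (rule comm_ring_hom_lring_map)

interpretation set_c_zero: comm_ring_hom set_c_zero
  unfolding set_c_zero_def by (rule comm_ring_hom_lring_map)

interpretation negate_y: comm_ring_hom negate_y
  unfolding negate_y_def by (rule comm_ring_hom_lring_map)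

lemma sx_xx [simp]: "sx i (xx j) = xx (adj_transp i j)" and sx_yy [simp]: "sx i (yy j) = yy j"
  and sy_xx [simp]: "sy i (xx j) = xx j" and sy_yy [simp]: "sy i (yy j) = yy (adj_transp i j)"
  by (simp_all add: sx_def sy_def)

lemma shift_ring_xx [simp]: "shift_ring m (xx i) = xx (i + m)"
  and shift_ring_yy [simp]: "shift_ring m (yy i) = yy (i + m)"
  and set_c_zero_xx [simp]: "set_c_zero (xx i) = xx i"
  and set_c_zero_yy [simp]: "set_c_zero (yy i) = yy i"
  and negate_y_xx [simp]: "negate_y (xx i) = xx i"
  and negate_y_yy [simp]: "negate_y (yy i) = - yy i"
  by (simp_all add: shift_ring_def set_c_zero_def negate_y_def)

lemma adj_transp_left [simp]: "adj_transp i i = i + 1"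
  and adj_transp_right [simp]: "adj_transp i (i + 1) = i"
  and adj_transp_other: "j \<noteq> i \<Longrightarrow> j \<noteq> i + 1 \<Longrightarrow> adj_transp i j = j"
  by (simp_all add: adj_transp_def transpose_def)

lemma adj_transp_eq: "adj_transp i j = (if j = i then i + 1 else if j = i + 1 then i else j)"
  by (simp add: adj_transp_def transpose_def)

lemma adj_transp_involutive [simp]: "adj_transp i (adj_transp i j) = j"
  by (simp add: adj_transp_eq)

lemma inv_lin_series': "inv_lin_series a * lin_series a = 1"
  using inv_lin_series[of a] by (simp add: mult.commute)

lemma lin_series_cancel:
  "u * lin_series a = v * lin_series a \<longleftrightarrow> u = v"
proof
  assume "u * lin_series a = v * lin_series a"
  then have "u * (lin_series a * inv_lin_series a) = v * (lin_series a * inv_lin_series a)"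
    by (simp flip: mult.assoc)
  then show "u = v" by (simp add: inv_lin_series)
qed simp

lemma eq_mult_inv_lin_series: "u = v * inv_lin_series a \<longleftrightarrow> u * lin_series a = v"
  using lin_series_cancel[of u a "v * inv_lin_series a"] by (simp add: mult.assoc inv_lin_series')

text \<open>For negative \<open>p\<close> the factors of index p + 1, ..., 0 are divided out, which
  makes the one-step recursion valid at every integer.\<close>

definition x_series :: "int \<Rightarrow> lring fps" where
  "x_series p = (if p \<ge> 0 then \<Prod>i\<in>{1..p}. inv_lin_series (- xx i)
     else \<Prod>i\<in>{p+1..0}. lin_series (- xx i))"

definition y_series :: "int \<Rightarrow> lring fps" where
  "y_series q = (if q \<ge> 0 then \<Prod>i\<in>{1..q}. lin_series (yy i)
     else \<Prod>i\<in>{q+1..0}. inv_lin_series (yy i))"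

lemma prod_int_atLeastAtMost_step:
  fixes f :: "int \<Rightarrow> 'a :: comm_monoid_mult"
  shows "p \<ge> 0 \<Longrightarrow> prod f {1..p+1} = prod f {1..p} * f (p + 1)"
    and "p < 0 \<Longrightarrow> prod f {p+1..0} = f (p + 1) * prod f {p+2..0}"
proof -
  assume "p \<ge> 0"
  then have "{1..p+1} = insert (p + 1) {1..p}" by auto
  then show "prod f {1..p+1} = prod f {1..p} * f (p + 1)" by (simp add: mult.commute)
next
  assume "p < 0"
  then have "{p+1..0} = insert (p + 1) {p+2..0}" by auto
  then show "prod f {p+1..0} = f (p + 1) * prod f {p+2..0}" by simp
qed

lemma x_series_step: "x_series (p + 1) * lin_series (- xx (p + 1)) = x_series p"
proof (cases "p \<ge> 0")
  case True
  then show ?thesis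
    by (simp add: x_series_def prod_int_atLeastAtMost_step(1) mult.assoc inv_lin_series')
next
  case False
  then show ?thesis
    by (cases "p = -1") (simp_all add: x_series_def prod_int_atLeastAtMost_step(2)[of p] mult.commute add.commute[of 2])
qed

lemma y_series_step: "y_series (q + 1) = y_series q * lin_series (yy (q + 1))"
proof (cases "q \<ge> 0")
  case True
  then show ?thesis
    by (simp add: y_series_def prod_int_atLeastAtMost_step(1))
next
  case False
  then have R: "y_series q = inv_lin_series (yy (q + 1)) * y_series (q + 1)"
    by (cases "q = -1") (simp_all add: y_series_def prod_int_atLeastAtMost_step(2)[of q] add.commute[of 2])
  have "y_series q * lin_series (yy (q + 1)) =
      y_series (q + 1) * (inv_lin_series (yy (q + 1)) * lin_series (yy (q + 1)))"
    unfolding R by (simp only: mult_ac)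
  then show ?thesis by (simp add: inv_lin_series')
qed

text \<open>\<open>c_flag p q\<close> is \<open>c\<close> with the variables \<open>x\<^sub>i\<close> (\<open>i \<le> p\<close>) and \<open>y\<^sub>i\<close> (\<open>i \<le> q\<close>) adjoined relative
  to those with \<open>i \<le> 0\<close>, which one imagines to be contained in \<open>c\<close> itself.\<close>

definition c_flag :: "int \<Rightarrow> int \<Rightarrow> lring fps" where
  "c_flag p q = c_series * x_series p * y_series q"

lemma c_flag_0 [simp]: "c_flag 0 0 = c_series"
  by (simp add: c_flag_def x_series_def y_series_def)

lemma c_flag_step_x: "c_flag (p + 1) q * lin_series (- xx (p + 1)) = c_flag p q"
  by (simp add: c_flag_def x_series_step[of p, symmetric] mult_ac)

lemma c_flag_step_y: "c_flag p (q + 1) = c_flag p q * lin_series (yy (q + 1))"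
  by (simp add: c_flag_def y_series_step mult_ac)

lemma c_flag_nth_0 [simp]: "fps_nth (c_flag p q) 0 = 1"
proof -
  have [simp]: "fps_nth (prod f A) 0 = 1" if "\<And>i. i \<in> A \<Longrightarrow> fps_nth (f i) 0 = 1"
    for f :: "int \<Rightarrow> lring fps" and A
    using that by (induction A rule: infinite_finite_induct) simp_all
  show ?thesis by (simp add: c_flag_def x_series_def y_series_def)
qed

text \<open>\<open>lin_series\<close> is a unit, so the recursion runs in both directions and one
  value determines the whole sequence. The action of a map on all \<open>c_flag p q\<close> is found
  by checking a guess against the recursion and one base value.\<close>

lemma series_rec_x_unique:
  fixes r :: int
  assumes "\<And>p. U (p + 1) * lin_series (a p) = U p" "\<And>p. V (p + 1) * lin_series (a p) = V p"
    and "U r = V r"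
  shows "U p = V p"
proof (induction p rule: int_induct[where k = r])
  case (step1 p)
  then show ?case using assms(1,2)[of p] lin_series_cancel by metis
next
  case (step2 p)
  then show ?case using assms(1,2)[of "p - 1"] by simp
qed (rule assms(3))

lemma series_rec_y_unique:
  fixes r :: int
  assumes "\<And>p. U (p + 1) = U p * lin_series (a p)" "\<And>p. V (p + 1) = V p * lin_series (a p)"
    and "U r = V r"
  shows "U p = V p"
proof (induction p rule: int_induct[where k = r])
  case (step1 p)
  then show ?case using assms(1,2)[of p] by simp
next
  case (step2 p)
  then show ?case using assms(1,2)[of "p - 1"] lin_series_cancel[of _ "a (p - 1)"] by simp
qed (rule assms(3))

lemma series_map_lin_series: 
  assumes "comm_ring_hom h"
  shows "series_map h (lin_series a) = lin_series (h a)"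
proof -
  interpret h: comm_ring_hom h by fact
  show ?thesis by (simp add: fps_eq_iff lin_series_def fps_X_def h.hom_add h.hom_mult)
qed

lemma series_map_c_flag_step:
  assumes "comm_ring_hom h"
  shows "series_map h (c_flag (p + 1) q) * lin_series (- h (xx (p + 1))) = series_map h (c_flag p q)"
    and "series_map h (c_flag p (q + 1)) = series_map h (c_flag p q) * lin_series (h (yy (q + 1)))"
proof -
  interpret h: comm_ring_hom h by fact
  show "series_map h (c_flag (p + 1) q) * lin_series (- h (xx (p + 1))) = series_map h (c_flag p q)"
    using arg_cong[OF c_flag_step_x[of p q], of "series_map h"]
    by (simp add: h.series_map_mult series_map_lin_series[OF assms] h.hom_uminus)
  show "series_map h (c_flag p (q + 1)) = series_map h (c_flag p q) * lin_series (h (yy (q + 1)))"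
    by (simp add: c_flag_step_y h.series_map_mult series_map_lin_series[OF assms])
qed

text \<open>The recursions lead from \<open>(p, q)\<close> back to \<open>(0, 0)\<close>, hence from
  one flagged series to \<open>c\<close> itself. The freedom in \<open>p\<close> and
  \<open>q\<close> is the point: a series can be chosen on which the maps to be compared are easy to
  evaluate.\<close>

lemma lring_hom_ext:
  fixes h k :: "lring \<Rightarrow> lring"
  assumes h: "comm_ring_hom h" and k: "comm_ring_hom k"
    and x: "\<And>i. h (xx i) = k (xx i)" and y: "\<And>i. h (yy i) = k (yy i)"
    and c: "series_map h (c_flag p q) = series_map k (c_flag p q)"
  shows "h f = k f"
proof (rule lring_hom_ext_indet[OF h k])
  have "series_map h (c_flag 0 q) = series_map k (c_flag 0 q)"
    using series_rec_x_unique[where U = "\<lambda>p. series_map h (c_flag p q)"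
        and V = "\<lambda>p. series_map k (c_flag p q)" and a = "\<lambda>p. - h (xx (p + 1))",
        OF series_map_c_flag_step(1)[OF h] _ c] series_map_c_flag_step(1)[OF k] by (simp add: x)
  then have "series_map h (c_flag 0 q') = series_map k (c_flag 0 q')" for q'
    using series_rec_y_unique[where U = "\<lambda>q. series_map h (c_flag 0 q)"
        and V = "\<lambda>q. series_map k (c_flag 0 q)" and a = "\<lambda>q. h (yy (q + 1))",
        OF series_map_c_flag_step(2)[OF h]] series_map_c_flag_step(2)[OF k] by (simp add: y)
  from this[of 0] have "series_map h c_series = series_map k c_series" by simp
  then have *: "h (cc n) = k (cc n)" for n
    by (simp add: fps_eq_iff c_series_def)
  show "h (indet v) = k (indet v)" for v
    using x y *[of "Suc j" for j] by (cases v) (simp_all add: xx_def yy_def cc_def)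
qed

text \<open>\<open>c_flag p q\<close> is symmetric in x_i and x_{i+1} unless exactly one of them is
  adjoined, that is, unless p = i; then x_{i+1} replaces x_i.\<close>

lemma sx_c_flag: "series_map (sx i) (c_flag p q) =
    (if p = i then c_flag (i - 1) q * inv_lin_series (- xx (i + 1)) else c_flag p q)"
proof -
  define V where "V q p = (if p = i then c_flag (i - 1) q * inv_lin_series (- xx (i + 1)) else c_flag p q)" for q p
  have rec: "V q (p + 1) * lin_series (- xx (adj_transp i (p + 1))) = V q p" for p q
  proof -
    consider "p + 1 = i" | "p = i" | "p \<noteq> i" "p + 1 \<noteq> i" by blast
    then show ?thesis
    proof cases
      case 1
      then have "p = i - 1" by simp
      then show ?thesis by (simp add: V_def mult.assoc inv_lin_series')
    next
      case 2
      have "c_flag (i + 1) q * lin_series (- xx i) * lin_series (- xx (i + 1)) = c_flag (i - 1) q"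
        using c_flag_step_x[of i q] c_flag_step_x[of "i - 1" q] by (simp add: mult_ac)
      with 2 show ?thesis by (simp add: V_def eq_mult_inv_lin_series)
    next
      case 3
      then show ?thesis by (simp add: V_def adj_transp_other c_flag_step_x)
    qed
  qed
  \<comment> \<open>The special case in the definition of \<open>sx\<close> is absorbed here: at i =
    0 the factor 1 - x_0 t turns \<open>c\<close> into \<open>c_flag (-1) 0\<close>.\<close>
  have "series_map (sx i) (c_flag 0 0) = V 0 0"
  proof (cases "i = 0")
    case True
    have "c_flag (-1) 0 = c_series * lin_series (- xx 0)"
      using c_flag_step_x[of "-1" 0] by simp
    with True show ?thesis by (simp add: V_def sx_def series_map_lring_map)
  next
    case False
    then show ?thesis by (simp add: V_def sx_def series_map_lring_map)
  qed
  moreover have "V (q + 1) 0 = V q 0 * lin_series (yy (q + 1))" for q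
    by (simp add: V_def c_flag_step_y mult_ac)
  ultimately have "series_map (sx i) (c_flag 0 q) = V q 0"
    by (rule series_rec_y_unique[where U = "\<lambda>q. series_map (sx i) (c_flag 0 q)" and V = "\<lambda>q. V q 0",
      OF series_map_c_flag_step(2)[OF sx.comm_ring_hom_axioms, unfolded sx_yy], rotated])
  from series_rec_x_unique[where U = "\<lambda>p. series_map (sx i) (c_flag p q)",
      OF series_map_c_flag_step(1)[OF sx.comm_ring_hom_axioms, unfolded sx_xx] rec this]
  have "series_map (sx i) (c_flag p q) = V q p" .
  then show ?thesis by (simp add: V_def)
qed

lemma sy_c_flag: "series_map (sy i) (c_flag p q) =
    (if q = i then c_flag p (i - 1) * lin_series (yy (i + 1)) else c_flag p q)"
proof -
  define V where "V p q = (if q = i then c_flag p (i - 1) * lin_series (yy (i + 1)) else c_flag p q)" for q p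
  have rec: "V p (q + 1) = V p q * lin_series (yy (adj_transp i (q + 1)))" for p q
  proof -
    consider "q + 1 = i" | "q = i" | "q \<noteq> i" "q + 1 \<noteq> i" by blast
    then show ?thesis
    proof cases
      case 1
      then have "q = i - 1" by simp
      then show ?thesis by (simp add: V_def)
    next
      case 2
      have "c_flag p (i + 1) = c_flag p (i - 1) * lin_series (yy (i + 1)) * lin_series (yy i)"
        using c_flag_step_y[of p i] c_flag_step_y[of p "i - 1"] by (simp add: mult_ac)
      with 2 show ?thesis by (simp add: V_def)
    next
      case 3
      then show ?thesis by (simp add: V_def adj_transp_other c_flag_step_y)
    qed
  qed
  have "series_map (sy i) (c_flag 0 0) = V 0 0"
  proof (cases "i = 0")
    case True
    have "c_flag 0 (-1) * lin_series (yy 0) = c_series"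
      using c_flag_step_y[of 0 "-1"] by simp
    then have "c_flag 0 (-1) = c_series * inv_lin_series (yy 0)"
      by (simp add: eq_mult_inv_lin_series)
    with True show ?thesis by (simp add: V_def sy_def series_map_lring_map mult_ac)
  next
    case False
    then show ?thesis by (simp add: V_def sy_def series_map_lring_map)
  qed
  moreover have "V (p + 1) 0 * lin_series (- xx (p + 1)) = V p 0" for p
    by (simp add: V_def c_flag_step_x[of p, symmetric] mult_ac)
  ultimately have "series_map (sy i) (c_flag p 0) = V p 0"
    by (rule series_rec_x_unique[where U = "\<lambda>p. series_map (sy i) (c_flag p 0)" and V = "\<lambda>p. V p 0",
      OF series_map_c_flag_step(1)[OF sy.comm_ring_hom_axioms, unfolded sy_xx], rotated])
  from series_rec_y_unique[where U = "\<lambda>q. series_map (sy i) (c_flag p q)",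
      OF series_map_c_flag_step(2)[OF sy.comm_ring_hom_axioms, unfolded sy_yy] rec this]
  have "series_map (sy i) (c_flag p q) = V p q" .
  then show ?thesis by (simp add: V_def)
qed

text \<open>By definition the shift sends \<open>c\<close> to \<open>c_flag m m\<close>; the
  recursions carry this base value to all \<open>(p, q)\<close>.\<close>

lemma shift_ring_c_flag:
  assumes "m \<ge> 0"
  shows "series_map (shift_ring m) (c_flag p q) = c_flag (p + m) (q + m)"
proof -
  note hom = shift_ring.comm_ring_hom_axioms[of m]
  have "c_series * (\<Prod>i = 1..m. lin_series (yy i) * inv_lin_series (- xx i)) = c_flag m m"
    using assms by (simp add: c_flag_def x_series_def y_series_def prod.distrib mult_ac)
  then have "series_map (shift_ring m) (c_flag 0 0) = c_flag m m"
    using assms c_flag_nth_0[of m m] by (simp add: shift_ring_def series_map_lring_map)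
  moreover have sy: "c_flag m (q + 1 + m) = c_flag m (q + m) * lin_series (yy (q + 1 + m))" for q
    using c_flag_step_y[of m "q + m"] by (simp add: add.commute add.left_commute)
  ultimately have y: "series_map (shift_ring m) (c_flag 0 q) = c_flag m (q + m)"
    using series_rec_y_unique[where U = "\<lambda>q. series_map (shift_ring m) (c_flag 0 q)"
       and V = "\<lambda>q. c_flag m (q + m)" and r = 0,
       OF series_map_c_flag_step(2)[OF hom, of 0, unfolded shift_ring_yy]] by simp
   have sx: "c_flag (p + 1 + m) q' * lin_series (- xx (p + 1 + m)) = c_flag (p + m) q'" for p q'
    using c_flag_step_x[of "p + m" q'] by (simp add: add.commute add.left_commute)
  show ?thesis
    by (rule series_rec_x_unique[where U = "\<lambda>p. series_map (shift_ring m) (c_flag p q)"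
       and V = "\<lambda>p. c_flag (p + m) (q + m)" and r = 0,
       OF series_map_c_flag_step(1)[OF hom, unfolded shift_ring_xx] sx]) (simp add: y)
qed

lemma set_c_zero_c_flag: "series_map set_c_zero (c_flag p q) = x_series p * y_series q"
proof -
  note hom = set_c_zero.comm_ring_hom_axioms
  have "series_map set_c_zero (c_flag 0 0) = 1"
    by (simp add: set_c_zero_def series_map_lring_map)
  then have "series_map set_c_zero (c_flag 0 0) = y_series 0"
    by (simp add: y_series_def)
  from series_rec_y_unique[where U = "\<lambda>q. series_map set_c_zero (c_flag 0 q)" and V = y_series,
      OF series_map_c_flag_step(2)[OF hom, unfolded set_c_zero_yy] y_series_step this]
  have y: "series_map set_c_zero (c_flag 0 q) = y_series q" .
  have x: "x_series (p + 1) * y_series q * lin_series (- xx (p + 1)) = x_series p * y_series q" for p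
    by (simp add: x_series_step[of p, symmetric] mult_ac)
  show ?thesis
    by (rule series_rec_x_unique[where U = "\<lambda>p. series_map set_c_zero (c_flag p q)"
       and V = "\<lambda>p. x_series p * y_series q" and r = 0,
       OF series_map_c_flag_step(1)[OF hom, unfolded set_c_zero_xx] x])
      (simp add: y, simp add: x_series_def)
qed

section \<open>Divided differences\<close>

lemma indet_eq_iff [simp]: "indet u = indet v \<longleftrightarrow> u = v"
proof
  assume eq: "indet u = indet v"
  have "lring_eval (\<lambda>w. if w = u then 1 else 0 :: int) (indet u) = lring_eval (\<lambda>w. if w = u then 1 else 0) (indet v)"
    by (simp only: eq)
  then show "u = v" by (simp split: if_splits)
qed simp

lemma xx_eq_iff [simp]: "xx i = xx j \<longleftrightarrow> i = j" and yy_eq_iff [simp]: "yy i = yy j \<longleftrightarrow> i = j"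
  by (simp_all add: xx_def yy_def)

text \<open>Covers \<open>sx\<close> and \<open>sy\<close> at once. The quotient by
  \<open>\<delta>\<close> is unique because the ring is an integral domain.\<close>

locale divided_difference = comm_ring_hom s for s :: "lring \<Rightarrow> lring" +
  fixes \<delta> :: lring
  assumes nonzero: "\<delta> \<noteq> 0"
    and s_delta: "s \<delta> = - \<delta>"
    and involutive: "s (s f) = f"
    and dvd: "\<delta> dvd f - s f"
begin

definition D :: "lring \<Rightarrow> lring" where
  "D f = exact_quot (f - s f) \<delta>"

lemma delta_mult_D: "\<delta> * D f = f - s f"
proof -
  obtain h where h: "f - s f = h * \<delta>" using dvd[of f] by (metis dvdE mult.commute)
  then have "D f = h" by (simp add: D_def exact_quot_mult[OF nonzero])
  with h show ?thesis by (simp add: mult.commute)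
qed

lemma D_eqI:
  assumes "\<delta> * h = f - s f"
  shows "D f = h"
proof -
  have "\<delta> * D f = \<delta> * h" by (simp add: assms delta_mult_D)
  then show ?thesis using nonzero by simp
qed

lemma D_add: "D (f + g) = D f + D g"
  by (rule D_eqI) (simp add: distrib_left delta_mult_D hom_add)

lemma D_minus: "D (- f) = - D f"
  by (rule D_eqI) (simp add: delta_mult_D hom_uminus)

lemma D_diff: "D (f - g) = D f - D g"
  using D_add[of f "- g"] D_minus[of g] by simp

lemma D_mult: "D (f * g) = D f * g + s f * D g"
proof (rule D_eqI)
  have "\<delta> * (D f * g + s f * D g) = (\<delta> * D f) * g + s f * (\<delta> * D g)"
    by (simp add: algebra_simps)
  then show "\<delta> * (D f * g + s f * D g) = f * g - s (f * g)"
    by (simp add: delta_mult_D algebra_simps hom_mult)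
qed

lemma D_eq_0_iff: "D f = 0 \<longleftrightarrow> s f = f"
  using delta_mult_D[of f] nonzero by auto

lemma D_invariant_mult: "s f = f \<Longrightarrow> D (f * g) = f * D g"
  using D_mult[of f g] D_eq_0_iff[of f] by simp

lemma s_D: "s (D f) = D f"
proof -
  have "- (\<delta> * s (D f)) = s f - f"
    using arg_cong[OF delta_mult_D[of f], of s] by (simp add: hom_mult hom_minus s_delta involutive)
  then have "\<delta> * s (D f) = f - s f" by (metis minus_diff_eq minus_minus)
  then have "\<delta> * s (D f) = \<delta> * D f" by (simp add: delta_mult_D)
  then show ?thesis using nonzero by simp
qed

lemma D_D: "D (D f) = 0"
  by (simp add: D_eq_0_iff s_D)

end

text \<open>Multiplying by \<open>\<delta>'\<close> reduces the claim to the intertwining of the two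
  reflections. It serves for the shift, for c = 1, for the sign change of the y_j and, with a
  reflection as \<open>h\<close>, for commuting operators.\<close>

lemma divided_difference_transport:
  assumes "divided_difference s \<delta>" "divided_difference s' \<delta>'" "comm_ring_hom h"
    and "\<And>f. h (s f) = s' (h f)" "h \<delta> = \<delta>'"
  shows "h (divided_difference.D s \<delta> f) = divided_difference.D s' \<delta>' (h f)"
proof -
  interpret d: divided_difference s \<delta> by fact
  interpret e: divided_difference s' \<delta>' by fact
  interpret h: comm_ring_hom h by fact
  show ?thesis
    using arg_cong[OF d.delta_mult_D[of f], of h] assms(4,5)
    by (intro e.D_eqI[symmetric]) (simp add: h.hom_mult h.hom_minus)
qed

lemma divided_difference_commute:
  assumes "divided_difference s \<delta>" "divided_difference s' \<delta>'"
    and comm: "\<And>f. s (s' f) = s' (s f)" and "s \<delta>' = \<delta>'" "s' \<delta> = \<delta>"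
  shows "divided_difference.D s \<delta> (divided_difference.D s' \<delta>' f) =
    divided_difference.D s' \<delta>' (divided_difference.D s \<delta> f)"
proof -
  interpret d: divided_difference s \<delta> by fact
  interpret e: divided_difference s' \<delta>' by fact
  \<comment> \<open>Transport along \<open>s\<close> itself: it commutes with \<open>s'\<close> and
    fixes \<open>\<delta>'\<close>, hence commutes with \<open>e.D\<close>.\<close>
  have "e.D (\<delta> * d.D f) = e.D f - s (e.D f)"
    using divided_difference_transport[OF assms(2,2) d.comm_ring_hom_axioms comm assms(4)]
    by (simp add: d.delta_mult_D e.D_diff)
  then have "\<delta> * e.D (d.D f) = e.D f - s (e.D f)"
    by (simp add: e.D_invariant_mult assms(5))
  then show ?thesis by (rule d.D_eqI)
qed

text \<open>Multiplied by \<delta> \<delta>' (\<delta> + \<delta>'), either side is the alternating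
  sum of \<open>f\<close> over the six words in s and s'; the two sums agree because the longest
  words do.\<close>

lemma divided_difference_braid:
  assumes "divided_difference s \<delta>" "divided_difference s' \<delta>'"
    and braid: "\<And>f. s (s' (s f)) = s' (s (s' f))"
    and s': "s \<delta>' = \<delta> + \<delta>'" and s: "s' \<delta> = \<delta> + \<delta>'" and nz: "\<delta> + \<delta>' \<noteq> 0"
  shows "divided_difference.D s \<delta> (divided_difference.D s' \<delta>' (divided_difference.D s \<delta> f)) =
    divided_difference.D s' \<delta>' (divided_difference.D s \<delta> (divided_difference.D s' \<delta>' f))"
proof -
  \<comment> \<open>The reflections are bound locally so that the identity can be used twice, with
    their roles exchanged.\<close>
  have key: "\<delta> * \<delta>' * (\<delta> + \<delta>') * divided_difference.D s \<delta> (divided_difference.D s' \<delta>' (divided_difference.D s \<delta> f)) =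
      f - s f - s' f + s (s' f) + s' (s f) - s (s' (s f))"
    if "divided_difference s \<delta>" "divided_difference s' \<delta>'" "s \<delta>' = \<delta> + \<delta>'" "s' \<delta> = \<delta> + \<delta>'"
    for s s' \<delta> \<delta>'
  proof -
    interpret d: divided_difference s \<delta> by fact
    interpret e: divided_difference s' \<delta>' by fact
    define g where "g = d.D f"
    define h where "h = e.D g"
    have g: "\<delta> * g = f - s f" by (simp add: g_def d.delta_mult_D)
    have h: "\<delta>' * h = g - s' g" by (simp add: h_def e.delta_mult_D)
    have sg: "s g = g" by (simp add: g_def d.s_D)
    have sh: "(\<delta> + \<delta>') * s h = g - s (s' g)"
      using arg_cong[OF h, of s] that by (simp add: d.hom_mult d.hom_minus sg)
    have s'g: "(\<delta> + \<delta>') * s' g = s' f - s' (s f)"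
      using arg_cong[OF g, of s'] that by (simp add: e.hom_mult e.hom_minus)
    have ss'g: "\<delta>' * s (s' g) = s (s' f) - s (s' (s f))"
      using arg_cong[OF s'g, of s] that by (simp add: d.hom_mult d.hom_minus d.hom_add d.s_delta)
    have "\<delta> * d.D h = h - s h" by (rule d.delta_mult_D)
    then have "\<delta> * \<delta>' * (\<delta> + \<delta>') * d.D h = (\<delta> + \<delta>') * (\<delta>' * h) - \<delta>' * ((\<delta> + \<delta>') * s h)"
      by (metis (no_types, opaque_lifting) mult.assoc mult.commute right_diff_distrib)
    also have "\<dots> = \<delta> * g - (\<delta> + \<delta>') * s' g + \<delta>' * s (s' g)"
      unfolding h sh by (simp add: algebra_simps)
    also have "\<dots> = f - s f - s' f + s (s' f) + s' (s f) - s (s' (s f))"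
      unfolding g s'g ss'g by simp
    finally show ?thesis by (simp add: g_def h_def)
  qed
  interpret d: divided_difference s \<delta> by fact
  interpret e: divided_difference s' \<delta>' by fact
  have "\<delta> * \<delta>' * (\<delta> + \<delta>') * d.D (e.D (d.D f)) = \<delta> * \<delta>' * (\<delta> + \<delta>') * e.D (d.D (e.D f))"
  proof -
    have "\<delta>' * \<delta> * (\<delta>' + \<delta>) * e.D (d.D (e.D f)) = f - s' f - s f + s' (s f) + s (s' f) - s' (s (s' f))"
      by (rule key[OF assms(2,1)]) (simp_all add: s s' add.commute)
    moreover have "\<delta>' * \<delta> * (\<delta>' + \<delta>) = \<delta> * \<delta>' * (\<delta> + \<delta>')" by (simp add: mult_ac add.commute)
    ultimately show ?thesis
      using key[OF assms(1,2) s' s] braid[of f] by simp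
  qed
  then show ?thesis using d.nonzero e.nonzero nz by simp
qed

subsection \<open>The operators on the flagged series\<close>

text \<open>Relative to \<open>c_flag (i + 1) q\<close>, which contains both denominators, the two
  series have the factors 1 - x_{i+1} t and 1 - x_i t. Their difference is (x_i - x_{i+1}) t, and
  the power of t is the drop in degree.\<close>

lemma c_flag_diff_x:
  "c_flag i q - series_map (sx i) (c_flag i q) = fps_const (xx i - xx (i + 1)) * (fps_X * c_flag (i + 1) q)"
proof -
  let ?G = "c_flag (i + 1) q"
  have 1: "c_flag i q = ?G * lin_series (- xx (i + 1))"
    using c_flag_step_x[of i q] by simp
  have "c_flag (i - 1) q = ?G * lin_series (- xx i) * lin_series (- xx (i + 1))"
    using c_flag_step_x[of "i - 1" q] 1 by (simp add: mult_ac)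
  then have "series_map (sx i) (c_flag i q) = ?G * lin_series (- xx i)"
    using eq_mult_inv_lin_series[of "?G * lin_series (- xx i)" "c_flag (i - 1) q" "- xx (i + 1)"]
    by (simp add: sx_c_flag)
  then have "c_flag i q - series_map (sx i) (c_flag i q) = ?G * (lin_series (- xx (i + 1)) - lin_series (- xx i))"
    using 1 by (simp add: algebra_simps)
  also have "lin_series (- xx (i + 1)) - lin_series (- xx i) = fps_const (xx i - xx (i + 1)) * fps_X"
    by (simp add: fps_eq_iff lin_series_def fps_X_def)
  finally show ?thesis by (simp add: mult_ac)
qed

lemma c_flag_diff_y:
  "c_flag p i - series_map (sy i) (c_flag p i) = fps_const (yy i - yy (i + 1)) * (fps_X * c_flag p (i - 1))"
proof -
  have 1: "c_flag p i = c_flag p (i - 1) * lin_series (yy i)"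
    using c_flag_step_y[of p "i - 1"] by simp
  have 2: "series_map (sy i) (c_flag p i) = c_flag p (i - 1) * lin_series (yy (i + 1))"
    by (simp add: sy_c_flag)
  have "c_flag p i - series_map (sy i) (c_flag p i) = c_flag p (i - 1) * (lin_series (yy i) - lin_series (yy (i + 1)))"
    unfolding 2 by (subst 1) (simp only: right_diff_distrib)
  also have "lin_series (yy i) - lin_series (yy (i + 1)) = fps_const (yy i - yy (i + 1)) * fps_X"
    by (simp add: fps_eq_iff lin_series_def fps_X_def)
  finally show ?thesis by (simp add: mult_ac)
qed

text \<open>The map f - s f is a twisted derivation: f g - s (f g) = (f - s f) g + s f (g - s g).
  Divisibility therefore passes from generators to the ring.\<close>

lemma dvd_diff_hom_induct:
  fixes s :: "lring \<Rightarrow> lring"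
  assumes "comm_ring_hom s" and gen: "\<And>v. \<delta> dvd indet v - s (indet v)"
  shows "\<delta> dvd f - s f"
proof -
  interpret s: comm_ring_hom s by fact
  show ?thesis
  proof (induction f rule: lring_induct)
    case (of_int a)
    then show ?case by (simp add: s.hom_of_int)
  next
    case (add f g)
    then have "\<delta> dvd (f - s f) + (g - s g)" by (rule dvd_add)
    then show ?case by (simp add: s.hom_add algebra_simps)
  next
    case (mult f g)
    then have "\<delta> dvd (f - s f) * g + s f * (g - s g)" by simp
    then show ?case by (simp add: s.hom_mult algebra_simps)
  qed (rule gen)
qed

section \<open>Coxeter relations among the reflections and among the operators\<close>

lemma adj_transp_braid:
  "adj_transp i (adj_transp (i + 1) (adj_transp i j)) = adj_transp (i + 1) (adj_transp i (adj_transp (i + 1) j))"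
  by (simp add: adj_transp_eq)

lemma adj_transp_commute:
  "\<bar>i - k\<bar> \<ge> 2 \<Longrightarrow> adj_transp i (adj_transp k j) = adj_transp k (adj_transp i j)"
  by (auto simp: adj_transp_eq)

lemma lring_hom_ext_fixing_c_flag:
  fixes h k :: "lring \<Rightarrow> lring"
  assumes "comm_ring_hom h" "comm_ring_hom k" "\<And>i. h (xx i) = k (xx i)" "\<And>i. h (yy i) = k (yy i)"
    and "series_map h (c_flag p q) = c_flag p q" "series_map k (c_flag p q) = c_flag p q"
  shows "h f = k f"
  by (rule lring_hom_ext[OF assms(1-4), of p q]) (simp_all add: assms(5,6))

lemma comm_ring_hom_id: "comm_ring_hom (\<lambda>x. x)"
  by unfold_locales simp_all

lemma series_map_id [simp]: "series_map (\<lambda>x. x) a = a"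
  by (simp add: fps_eq_iff)

lemma sx_sx: "sx i (sx i f) = f"
  \<comment> \<open>Any flag other than \<open>i\<close> gives a series fixed by
    \<open>sx i\<close>.\<close>
  by (rule lring_hom_ext_fixing_c_flag[of "\<lambda>f. sx i (sx i f)" "\<lambda>f. f" "i + 1" 0])
    (simp_all add: comm_ring_hom_compose sx.comm_ring_hom_axioms comm_ring_hom_id sx_c_flag flip: series_map_compose)

lemma sy_sy: "sy i (sy i f) = f"
  by (rule lring_hom_ext_fixing_c_flag[of "\<lambda>f. sy i (sy i f)" "\<lambda>f. f" 0 "i + 1"])
    (simp_all add: comm_ring_hom_compose sy.comm_ring_hom_axioms comm_ring_hom_id sy_c_flag flip: series_map_compose)

lemma divided_difference_sx: "divided_difference (sx i) (xx i - xx (i + 1))"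
proof unfold_locales
    show "xx i - xx (i + 1) dvd f - sx i f" for f
    proof (rule dvd_diff_hom_induct[OF sx.comm_ring_hom_axioms])
      fix v
      show "xx i - xx (i + 1) dvd indet v - sx i (indet v)"
      proof (cases v)
        case (CVar k)
        have "indet v - sx i (indet v) = fps_nth (c_flag 0 0 - series_map (sx i) (c_flag 0 0)) (Suc k)"
          by (simp add: CVar c_series_def cc_def)
        also have "xx i - xx (i + 1) dvd \<dots>"
          using c_flag_diff_x[of 0 0] sx_c_flag[of i 0 0] by (cases "i = 0") simp_all
        finally show ?thesis .
      next
        case (XVar j)
        then have "indet v - sx i (indet v) = xx j - xx (adj_transp i j)" by (simp flip: xx_def)
        moreover have "xx i - xx (i + 1) dvd xx (i + 1) - xx i"
          by (metis dvd_minus_iff dvd_refl minus_diff_eq)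
        ultimately show ?thesis by (auto simp: adj_transp_eq)
      qed (simp flip: yy_def)
    qed
  qed (simp_all add: sx_sx sx.hom_minus)

lemma partial_x_conv: "divided_difference.D (sx i) (xx i - xx (i + 1)) = partial_x i"
  by (simp add: fun_eq_iff divided_difference.D_def[OF divided_difference_sx] partial_x_def)

lemmas partial_x_eqI = divided_difference.D_eqI[OF divided_difference_sx, unfolded partial_x_conv]
lemmas partial_x_add = divided_difference.D_add[OF divided_difference_sx, unfolded partial_x_conv]
lemmas partial_x_diff = divided_difference.D_diff[OF divided_difference_sx, unfolded partial_x_conv]
lemmas partial_x_mult = divided_difference.D_mult[OF divided_difference_sx, unfolded partial_x_conv]
lemmas partial_x_eq_0_iff = divided_difference.D_eq_0_iff[OF divided_difference_sx, unfolded partial_x_conv]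
lemmas partial_x_partial_x = divided_difference.D_D[OF divided_difference_sx, unfolded partial_x_conv]

lemma divided_difference_sy: "divided_difference (sy i) (yy i - yy (i + 1))"
proof unfold_locales
    show "yy i - yy (i + 1) dvd f - sy i f" for f
    proof (rule dvd_diff_hom_induct[OF sy.comm_ring_hom_axioms])
      fix v
      show "yy i - yy (i + 1) dvd indet v - sy i (indet v)"
      proof (cases v)
        case (CVar k)
        have "indet v - sy i (indet v) = fps_nth (c_flag 0 0 - series_map (sy i) (c_flag 0 0)) (Suc k)"
          by (simp add: CVar c_series_def cc_def)
        also have "yy i - yy (i + 1) dvd \<dots>"
          using c_flag_diff_y[of 0 0] sy_c_flag[of i 0 0] by (cases "i = 0") simp_all
        finally show ?thesis .
      next
        case (YVar j)
        then have "indet v - sy i (indet v) = yy j - yy (adj_transp i j)" by (simp flip: yy_def)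
        moreover have "yy i - yy (i + 1) dvd yy (i + 1) - yy i"
          by (metis dvd_minus_iff dvd_refl minus_diff_eq)
        ultimately show ?thesis by (auto simp: adj_transp_eq)
      qed (simp flip: xx_def)
    qed
  qed (simp_all add: sy_sy sy.hom_minus)

lemma partial_y_conv: "divided_difference.D (sy i) (yy i - yy (i + 1)) = partial_y i"
  by (simp add: fun_eq_iff divided_difference.D_def[OF divided_difference_sy] partial_y_def)

lemmas partial_y_eqI = divided_difference.D_eqI[OF divided_difference_sy, unfolded partial_y_conv]
lemmas partial_y_diff = divided_difference.D_diff[OF divided_difference_sy, unfolded partial_y_conv]
lemmas partial_y_eq_0_iff = divided_difference.D_eq_0_iff[OF divided_difference_sy, unfolded partial_y_conv]

lemma sx_braid: "sx i (sx (i + 1) (sx i f)) = sx (i + 1) (sx i (sx (i + 1) f))"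
\<comment> \<open>\<open>c_flag (i + 2) 0\<close> contains all three permuted variables, so both
  reflections fix it.\<close>
proof (rule lring_hom_ext_fixing_c_flag[of "\<lambda>f. sx i (sx (i + 1) (sx i f))" "\<lambda>f. sx (i + 1) (sx i (sx (i + 1) f))" "i + 2" 0])
  have hom: "comm_ring_hom (\<lambda>f. sx i (sx j (sx k f)))" for i j k
    by (rule comm_ring_hom_compose[OF sx.comm_ring_hom_axioms
          comm_ring_hom_compose[OF sx.comm_ring_hom_axioms sx.comm_ring_hom_axioms]])
  have map: "series_map (\<lambda>f. sx i (sx j (sx k f))) a = series_map (sx i) (series_map (sx j) (series_map (sx k) a))"
    for i j k a by (simp add: series_map_compose)
  show "comm_ring_hom (\<lambda>f. sx i (sx (i + 1) (sx i f)))" "comm_ring_hom (\<lambda>f. sx (i + 1) (sx i (sx (i + 1) f)))"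
    by (rule hom)+
  show "series_map (\<lambda>f. sx i (sx (i + 1) (sx i f))) (c_flag (i + 2) 0) = c_flag (i + 2) 0"
    "series_map (\<lambda>f. sx (i + 1) (sx i (sx (i + 1) f))) (c_flag (i + 2) 0) = c_flag (i + 2) 0"
    by (simp_all add: map sx_c_flag)
qed (simp_all add: adj_transp_braid)

lemma sx_commute:
  assumes "\<bar>i - j\<bar> \<ge> 2"
  shows "sx i (sx j f) = sx j (sx i f)"
proof -
  obtain p where p: "p \<noteq> i" "p \<noteq> j"
    using that[of "\<bar>i\<bar> + \<bar>j\<bar> + 1"] by auto
  show ?thesis
  proof (rule lring_hom_ext_fixing_c_flag[of "\<lambda>f. sx i (sx j f)" "\<lambda>f. sx j (sx i f)" p 0])
    show "sx i (sx j (xx k)) = sx j (sx i (xx k))" for k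
      by (simp add: adj_transp_commute[OF assms])
    show "series_map (\<lambda>f. sx i (sx j f)) (c_flag p 0) = c_flag p 0"
      "series_map (\<lambda>f. sx j (sx i f)) (c_flag p 0) = c_flag p 0"
      by (simp_all add: p sx_c_flag flip: series_map_compose)
  qed (simp_all add: comm_ring_hom_compose sx.comm_ring_hom_axioms)
qed

lemma sx_sy_commute: "sx i (sy j f) = sy j (sx i f)"
  by (rule lring_hom_ext_fixing_c_flag[of "\<lambda>f. sx i (sy j f)" "\<lambda>f. sy j (sx i f)" "i + 1" "j + 1"])
    (simp_all add: comm_ring_hom_compose sx.comm_ring_hom_axioms sy.comm_ring_hom_axioms sx_c_flag sy_c_flag
      flip: series_map_compose)

lemma partial_x_braid:
  "partial_x i (partial_x (i + 1) (partial_x i f)) = partial_x (i + 1) (partial_x i (partial_x (i + 1) f))"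
proof -
  have "sx i (xx (i + 1) - xx (i + 1 + 1)) = (xx i - xx (i + 1)) + (xx (i + 1) - xx (i + 1 + 1))"
    "sx (i + 1) (xx i - xx (i + 1)) = (xx i - xx (i + 1)) + (xx (i + 1) - xx (i + 1 + 1))"
    "(xx i - xx (i + 1)) + (xx (i + 1) - xx (i + 1 + 1)) \<noteq> 0"
    by (simp_all add: sx.hom_minus adj_transp_other)
  from divided_difference_braid[OF divided_difference_sx[of i] divided_difference_sx[of "i + 1"] sx_braid this]
  show ?thesis by (simp only: partial_x_conv)
qed

lemma partial_x_commute:
  assumes "\<bar>i - j\<bar> \<ge> 2"
  shows "partial_x i (partial_x j f) = partial_x j (partial_x i f)"
proof -
  have "sx i (xx j - xx (j + 1)) = xx j - xx (j + 1)" "sx j (xx i - xx (i + 1)) = xx i - xx (i + 1)"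
    using assms by (auto simp add: sx.hom_minus adj_transp_eq)
  from divided_difference_commute[OF divided_difference_sx[of i] divided_difference_sx[of j] sx_commute[OF assms] this]
  show ?thesis by (simp only: partial_x_conv)
qed

lemma partial_x_partial_y_commute:
  "partial_x i (partial_y j f) = partial_y j (partial_x i f)"
proof -
  have "sx i (yy j - yy (j + 1)) = yy j - yy (j + 1)" "sy j (xx i - xx (i + 1)) = xx i - xx (i + 1)"
    by (simp_all add: sx.hom_minus sy.hom_minus)
  from divided_difference_commute[OF divided_difference_sx[of i] divided_difference_sy[of j] sx_sy_commute this]
  show ?thesis by (simp only: partial_x_conv partial_y_conv)
qed

text \<open>Integer degrees with value 0 below degree 0, because determinant entries below the
  diagonal may have negative degree.\<close>

definition flag_coeff :: "int \<Rightarrow> int \<Rightarrow> int \<Rightarrow> lring" where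
  "flag_coeff p q k = (if k < 0 then 0 else fps_nth (c_flag p q) (nat k))"

lemma partial_x_flag_coeff: "partial_x i (flag_coeff i q k) = flag_coeff (i + 1) q (k - 1)"
proof (rule partial_x_eqI)
  have "nat k - 1 = nat (k - 1)" by simp
  then show "(xx i - xx (i + 1)) * flag_coeff (i + 1) q (k - 1) = flag_coeff i q k - sx i (flag_coeff i q k)"
    using arg_cong[OF c_flag_diff_x[of i q], of "\<lambda>f. fps_nth f (nat k)"]
    by (auto simp: flag_coeff_def)
qed

lemma partial_y_flag_coeff: "partial_y i (flag_coeff p i k) = flag_coeff p (i - 1) (k - 1)"
proof (rule partial_y_eqI)
  have "nat k - 1 = nat (k - 1)" by simp
  then show "(yy i - yy (i + 1)) * flag_coeff p (i - 1) (k - 1) = flag_coeff p i k - sy i (flag_coeff p i k)"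
    using arg_cong[OF c_flag_diff_y[of p i], of "\<lambda>f. fps_nth f (nat k)"]
    by (auto simp: flag_coeff_def)
qed

lemma sx_flag_coeff: "p \<noteq> i \<Longrightarrow> sx i (flag_coeff p q k) = flag_coeff p q k"
  using arg_cong[OF sx_c_flag[of i p q], of "\<lambda>f. fps_nth f (nat k)"] by (simp add: flag_coeff_def)

lemma sy_flag_coeff: "q \<noteq> i \<Longrightarrow> sy i (flag_coeff p q k) = flag_coeff p q k"
  using arg_cong[OF sy_c_flag[of i p q], of "\<lambda>f. fps_nth f (nat k)"] by (simp add: flag_coeff_def)

lemma shift_ring_flag_coeff: "m \<ge> 0 \<Longrightarrow> shift_ring m (flag_coeff p q k) = flag_coeff (p + m) (q + m) k"
  using arg_cong[OF shift_ring_c_flag[of m p q], of "\<lambda>f. fps_nth f (nat k)"] by (simp add: flag_coeff_def)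

text \<open>Both series are \<open>c_flag (p + 1) (q - 1)\<close> times one linear factor, 1 + y_q t
  or 1 - x_{p+1} t. This is the discrepancy between raising an x-flag and lowering a y-flag in a row
  of the determinant.\<close>

lemma flag_coeff_diff:
  "flag_coeff (p + 1) q k - flag_coeff p (q - 1) k = (xx (p + 1) + yy q) * flag_coeff (p + 1) (q - 1) (k - 1)"
proof -
  have "c_flag (p + 1) q - c_flag p (q - 1) =
      c_flag (p + 1) (q - 1) * lin_series (yy q) - c_flag (p + 1) (q - 1) * lin_series (- xx (p + 1))"
    using c_flag_step_y[of "p + 1" "q - 1"] c_flag_step_x[of p "q - 1"] by simp
  also have "\<dots> = c_flag (p + 1) (q - 1) * (lin_series (yy q) - lin_series (- xx (p + 1)))"
    by (simp add: algebra_simps)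
  also have "lin_series (yy q) - lin_series (- xx (p + 1)) = fps_const (xx (p + 1) + yy q) * fps_X"
    by (simp add: fps_eq_iff lin_series_def fps_X_def)
  finally have *: "c_flag (p + 1) q - c_flag p (q - 1) = fps_const (xx (p + 1) + yy q) * (fps_X * c_flag (p + 1) (q - 1))"
    by (simp add: mult_ac)
  have "nat k - 1 = nat (k - 1)" by simp
  then show ?thesis
    using arg_cong[OF *, of "\<lambda>f. fps_nth f (nat k)"] by (auto simp: flag_coeff_def)
qed

section \<open>Permutations of an interval\<close>

definition perms_on :: "int \<Rightarrow> int \<Rightarrow> (int \<Rightarrow> int) set" where
  "perms_on a b = {w. bij w \<and> (\<forall>i. i < a \<or> b < i \<longrightarrow> w i = i)}"

definition reversal :: "int \<Rightarrow> int \<Rightarrow> int \<Rightarrow> int" where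
  "reversal a b i = (if a \<le> i \<and> i \<le> b then a + b - i else i)"

abbreviation perm_inv :: "(int \<Rightarrow> int) \<Rightarrow> int \<Rightarrow> int" where
  "perm_inv \<equiv> inv_into UNIV"

lemma perms_on_bij: "w \<in> perms_on a b \<Longrightarrow> bij w"
  and perms_on_fix: "w \<in> perms_on a b \<Longrightarrow> i < a \<or> b < i \<Longrightarrow> w i = i"
  by (auto simp: perms_on_def)

lemma perms_on_eq_iff: "w \<in> perms_on a b \<Longrightarrow> w i = w j \<longleftrightarrow> i = j"
  by (meson bij_betw_imp_inj_on injD perms_on_bij)

lemma perms_on_bounds:
  assumes w: "w \<in> perms_on a b" and "a \<le> i" "i \<le> b"
  shows "a \<le> w i" "w i \<le> b"
proof -
  have "w (w i) = w i" if "w i < a \<or> b < w i" using perms_on_fix[OF w that] .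
  then have "\<not> (w i < a \<or> b < w i)" using perms_on_eq_iff[OF w] assms(2,3) by force
  then show "a \<le> w i" "w i \<le> b" by auto
qed

lemma perms_on_mono: "a' \<le> a \<Longrightarrow> b \<le> b' \<Longrightarrow> perms_on a b \<subseteq> perms_on a' b'"
  by (auto simp: perms_on_def)

lemma S_Z_iff_perms_on: "w \<in> S_Z \<longleftrightarrow> (\<exists>a b. w \<in> perms_on a b)"
proof
  assume w: "w \<in> S_Z"
  define M where "M = Max (insert 0 (abs ` {i. w i \<noteq> i}))"
  have fin: "finite (insert 0 (abs ` {i. w i \<noteq> i}))" using w by (simp add: S_Z_def)
  have "\<bar>i\<bar> \<le> M" if "w i \<noteq> i" for i
    unfolding M_def using that by (intro Max_ge[OF fin]) auto
  then have "w \<in> perms_on (- M) M" using w by (force simp: perms_on_def S_Z_def)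
  then show "\<exists>a b. w \<in> perms_on a b" by blast
next
  assume "\<exists>a b. w \<in> perms_on a b"
  then obtain a b where w: "w \<in> perms_on a b" by blast
  have "{i. w i \<noteq> i} \<subseteq> {a..b}" using perms_on_fix[OF w] by force
  then show "w \<in> S_Z"
    using perms_on_bij[OF w] by (auto simp: S_Z_def intro: finite_subset)
qed

lemma S_Z_perms_on_large:
  assumes "w \<in> S_Z"
  obtains a b where "a \<le> A" "B \<le> b" "w \<in> perms_on a b"
proof -
  obtain a b where "w \<in> perms_on a b" using assms S_Z_iff_perms_on by blast
  then have "w \<in> perms_on (min a A) (max b B)"
    using perms_on_mono[of "min a A" a b "max b B"] by auto
  then show ?thesis by (intro that[of "min a A" "max b B"]) auto
qed

lemma bij_adj_transp: "bij (adj_transp i)"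
  by (rule involuntory_imp_bij) simp

lemma comp_adj_transp_twice [simp]: "w \<circ> adj_transp i \<circ> adj_transp i = w"
  "adj_transp i \<circ> (adj_transp i \<circ> w) = w"
  by (simp_all add: fun_eq_iff)

lemma perms_on_comp_adj:
  assumes "w \<in> perms_on a b" "a \<le> i" "i < b"
  shows "w \<circ> adj_transp i \<in> perms_on a b" "adj_transp i \<circ> w \<in> perms_on a b"
  using assms by (auto simp: perms_on_def bij_comp bij_adj_transp adj_transp_eq)

lemma inv_comp_adj: "bij w \<Longrightarrow> perm_inv (adj_transp i \<circ> w) = perm_inv w \<circ> adj_transp i"
  by (simp add: o_inv_distrib bij_adj_transp inv_equality[of "adj_transp i" "adj_transp i"])

lemma perms_on_inv: "w \<in> perms_on a b \<Longrightarrow> perm_inv w \<in> perms_on a b"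
  by (auto simp: perms_on_def bij_imp_bij_inv bij_is_inj inv_f_eq)

lemma reversal_in_perms_on: "reversal a b \<in> perms_on a b"
  by (auto simp: perms_on_def reversal_def intro!: involuntory_imp_bij)

lemma id_in_perms_on: "id \<in> perms_on a b"
  by (simp add: perms_on_def)

text \<open>Strict decrease starting from w a \<le> b bounds w i above, strict decrease ending at w
  b \<ge> a bounds it below, and the two bounds coincide.\<close>

lemma decreasing_perm_eq_reversal:
  assumes w: "w \<in> perms_on a b" and desc: "\<And>i. a \<le> i \<Longrightarrow> i < b \<Longrightarrow> w (i + 1) < w i"
  shows "w = reversal a b"
proof
  fix i
  show "w i = reversal a b i"
  proof (cases "a \<le> i \<and> i \<le> b")
    case True
    have up: "i \<le> b \<longrightarrow> w i \<le> a + b - i" if "a \<le> i" for i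
      using that
    proof (induction i rule: int_ge_induct)
      case base
      then show ?case using perms_on_bounds[OF w, of a] by auto
    next
      case (step i)
      then show ?case using desc[of i] by auto
    qed
    have lo: "a \<le> i \<longrightarrow> w i \<ge> a + b - i" if "i \<le> b" for i
      using that
    proof (induction i rule: int_le_induct)
      case base
      then show ?case using perms_on_bounds[OF w, of b] by auto
    next
      case (step i)
      then show ?case using desc[of "i - 1"] by auto
    qed
    from True up[of i] lo[of i] show ?thesis by (auto simp: reversal_def)
  next
    case False
    then have "i < a \<or> b < i" by auto
    then show ?thesis using perms_on_fix[OF w] by (auto simp: reversal_def)
  qed
qed

lemma obtain_ascent:
  assumes w: "w \<in> perms_on a b" and "w \<noteq> reversal a b"
  obtains i where "a \<le> i" "i < b" "w i < w (i + 1)"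
proof -
  have "\<not> (\<forall>i. a \<le> i \<and> i < b \<longrightarrow> w (i + 1) < w i)"
    using decreasing_perm_eq_reversal[OF w] assms(2) by blast
  then obtain i where "a \<le> i" "i < b" "w i \<le> w (i + 1)" by force
  then show ?thesis using that[of i] perms_on_eq_iff[OF w, of i "i + 1"] by force
qed

section \<open>Inversions and length\<close>

definition inversions :: "(int \<Rightarrow> int) \<Rightarrow> (int \<times> int) set" where
  "inversions w = {(i, j). i < j \<and> w i > w j}"

lemma perm_length_eq_card: "perm_length w = card (inversions w)"
  by (simp add: perm_length_def inversions_def)

lemma inversions_subset:
  assumes w: "w \<in> perms_on a b"
  shows "inversions w \<subseteq> {a..b} \<times> {a..b}"
proof clarify
  fix i j assume "(i, j) \<in> inversions w"
  then have ij: "i < j" "w j < w i" by (auto simp: inversions_def)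
  have "\<not> i < a"
  proof
    assume "i < a"
    then have "w i = i" using perms_on_fix[OF w] by auto
    then have "w (w j) = w j" using perms_on_fix[OF w, of "w j"] ij \<open>i < a\<close> by auto
    then show False using perms_on_eq_iff[OF w] ij \<open>w i = i\<close> by force
  qed
  moreover have "\<not> b < j"
  proof
    assume "b < j"
    then have "w j = j" using perms_on_fix[OF w] by auto
    then have "w (w i) = w i" using perms_on_fix[OF w, of "w i"] ij \<open>b < j\<close> by auto
    then show False using perms_on_eq_iff[OF w] ij \<open>w j = j\<close> by force
  qed
  ultimately show "i \<in> {a..b} \<and> j \<in> {a..b}" using ij by auto
qed

lemma finite_inversions: "w \<in> perms_on a b \<Longrightarrow> finite (inversions w)"
  by (rule finite_subset[OF inversions_subset]) simp_all

lemma perm_length_le: "w \<in> perms_on a b \<Longrightarrow> perm_length w \<le> card ({a..b} \<times> {a..b})"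
  unfolding perm_length_eq_card by (intro card_mono inversions_subset) auto

text \<open>The transposition of positions preserves the order of every pair p < q except (i, i +
  1), so it matches the old inversions with the new ones other than this pair.\<close>

lemma perm_length_ascent:
  assumes "w \<in> S_Z" and asc: "w i < w (i + 1)"
  shows "perm_length (w \<circ> adj_transp i) = Suc (perm_length w)"
proof -
  let ?s = "adj_transp i"
  let ?f = "\<lambda>(p, q). (?s p, ?s q)"
  have fin: "finite (inversions w)" using assms(1) S_Z_iff_perms_on finite_inversions by blast
  have lt: "?s p < ?s q" if "p < q" "(p, q) \<noteq> (i, i + 1)" for p q
    using that by (auto simp: adj_transp_eq)
  have inj: "inj_on ?f (inversions w)"
    by (rule inj_on_inverseI[where g = ?f]) auto
  have "inversions (w \<circ> ?s) = insert (i, i + 1) (?f ` inversions w)"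
  proof (intro subset_antisym subrelI)
    fix p q assume pq: "(p, q) \<in> inversions (w \<circ> ?s)"
    show "(p, q) \<in> insert (i, i + 1) (?f ` inversions w)"
    proof (cases "(p, q) = (i, i + 1)")
      case False
      then have "(?s p, ?s q) \<in> inversions w"
        using pq lt by (auto simp: inversions_def)
      then have "?f (?s p, ?s q) \<in> ?f ` inversions w" by (rule imageI)
      then show ?thesis by simp
    qed simp
  next
    fix p q assume pq: "(p, q) \<in> insert (i, i + 1) (?f ` inversions w)"
    show "(p, q) \<in> inversions (w \<circ> ?s)"
    proof (cases "(p, q) = (i, i + 1)")
      case True
      then show ?thesis using asc by (simp add: inversions_def)
    next
      case False
      then obtain p' q' where "p = ?s p'" "q = ?s q'" "p' < q'" "w q' < w p'"
        using pq by (auto simp: inversions_def)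
      moreover from this have "(p', q') \<noteq> (i, i + 1)" using asc by auto
      ultimately show ?thesis using lt[of p' q'] by (simp add: inversions_def)
    qed
  qed
  moreover have "(i, i + 1) \<notin> ?f ` inversions w"
    by (auto simp: inversions_def adj_transp_eq split: if_splits)
  ultimately show ?thesis
    using fin by (simp add: perm_length_eq_card card_image[OF inj])
qed

text \<open>Inverted positions of \<open>w\<close> correspond to inverted values of its inverse.
  This reduces left multiplication to right multiplication.\<close>

lemma perm_length_inv:
  assumes "w \<in> S_Z"
  shows "perm_length (perm_inv w) = perm_length w"
proof -
  have "bij w" using assms by (simp add: S_Z_def)
  then have [simp]: "perm_inv w (w i) = i" "w (perm_inv w i) = i" for i
    by (simp_all add: bij_is_inj bij_is_surj surj_f_inv_f)
  have "bij_betw (\<lambda>(i, j). (w j, w i)) (inversions w) (inversions (perm_inv w))"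
    by (rule bij_betw_byWitness[where f' = "\<lambda>(i, j). (perm_inv w j, perm_inv w i)"])
      (auto simp: inversions_def)
  then show ?thesis by (simp add: perm_length_eq_card bij_betw_same_card)
qed

lemma S_Z_comp_adj:
  assumes "w \<in> S_Z"
  shows "w \<circ> adj_transp i \<in> S_Z" "adj_transp i \<circ> w \<in> S_Z"
proof -
  obtain a b where "a \<le> i" "i + 1 \<le> b" "w \<in> perms_on a b"
    using S_Z_perms_on_large[OF assms] by blast
  then show "w \<circ> adj_transp i \<in> S_Z" "adj_transp i \<circ> w \<in> S_Z"
    using perms_on_comp_adj[of w a b i] S_Z_iff_perms_on by auto
qed

lemma S_Z_inv: "w \<in> S_Z \<Longrightarrow> perm_inv w \<in> S_Z"
  using perms_on_inv S_Z_iff_perms_on by blast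

lemma perm_length_descent:
  assumes "w \<in> S_Z" "w (i + 1) < w i"
  shows "Suc (perm_length (w \<circ> adj_transp i)) = perm_length w"
  using perm_length_ascent[OF S_Z_comp_adj(1)[OF assms(1)], of i i] assms(2) by simp

lemma perm_length_right_iff:
  assumes "w \<in> S_Z"
  shows "perm_length (w \<circ> adj_transp i) < perm_length w \<longleftrightarrow> w (i + 1) < w i"
    and "perm_length (w \<circ> adj_transp i) > perm_length w \<longleftrightarrow> w i < w (i + 1)"
proof -
  have "w i \<noteq> w (i + 1)"
    using assms S_Z_iff_perms_on perms_on_eq_iff[of w _ _ i "i + 1"] by auto
  then consider "w i < w (i + 1)" | "w (i + 1) < w i" by linarith
  then show "perm_length (w \<circ> adj_transp i) < perm_length w \<longleftrightarrow> w (i + 1) < w i"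
    "perm_length (w \<circ> adj_transp i) > perm_length w \<longleftrightarrow> w i < w (i + 1)"
    using perm_length_ascent[OF assms, of i] perm_length_descent[OF assms, of i] by (cases; simp)+
qed

lemma perm_length_left_iff:
  assumes "w \<in> S_Z"
  shows "perm_length (adj_transp i \<circ> w) < perm_length w \<longleftrightarrow> perm_inv w (i + 1) < perm_inv w i"
    and "perm_length (adj_transp i \<circ> w) > perm_length w \<longleftrightarrow> perm_inv w i < perm_inv w (i + 1)"
proof -
  have "perm_length (adj_transp i \<circ> w) = perm_length (perm_inv w \<circ> adj_transp i)"
    using perm_length_inv[OF S_Z_comp_adj(2)[OF assms], of i] inv_comp_adj[of w i] assms
    by (simp add: S_Z_def)
  then show "perm_length (adj_transp i \<circ> w) < perm_length w \<longleftrightarrow> perm_inv w (i + 1) < perm_inv w i"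
    "perm_length (adj_transp i \<circ> w) > perm_length w \<longleftrightarrow> perm_inv w i < perm_inv w (i + 1)"
    using perm_length_right_iff[OF S_Z_inv[OF assms], of i] perm_length_inv[OF assms] by simp_all
qed

text \<open>A permutation of the interval other than the reversal has an ascent, and passing up
  along it raises the length, which is bounded; so every chain of ascents ends at the
  reversal.\<close>

lemma perms_on_descend_induct [consumes 1, case_names reversal descent]:
  assumes "w \<in> perms_on a b" and top: "P (reversal a b)"
    and step: "\<And>w i. w \<in> perms_on a b \<Longrightarrow> a \<le> i \<Longrightarrow> i < b \<Longrightarrow> w (i + 1) < w i \<Longrightarrow> P w \<Longrightarrow>
      P (w \<circ> adj_transp i)"
  shows "P w"
  using assms(1)
proof (induction "card ({a..b} \<times> {a..b}) - perm_length w" arbitrary: w rule: less_induct)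
  case (less w)
  show ?case
  proof (cases "w = reversal a b")
    case False
    with less.prems obtain i where i: "a \<le> i" "i < b" "w i < w (i + 1)" by (rule obtain_ascent)
    let ?v = "w \<circ> adj_transp i"
    have v: "?v \<in> perms_on a b" using perms_on_comp_adj less.prems i by blast
    have "w \<in> S_Z" using less.prems S_Z_iff_perms_on by blast
    then have "perm_length ?v = Suc (perm_length w)" using perm_length_ascent i(3) by blast
    then have "P ?v" using perm_length_le[OF v] v by (intro less.hyps) auto
    then have "P (?v \<circ> adj_transp i)" using i(3) by (intro step[OF v i(1,2)]) auto
    then show ?thesis by simp
  qed (simp add: top)
qed

lemma reversal_single: "reversal a a = id"
  by (auto simp: reversal_def fun_eq_iff)

text \<open>Without descents, \<open>reversal a b \<circ> w\<close> decreases on the interval and is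
  the reversal itself.\<close>

lemma perm_length_0_imp_id:
  assumes "w \<in> S_Z" "perm_length w = 0"
  shows "w = id"
proof -
  obtain a b where w: "w \<in> perms_on a b" using assms(1) S_Z_iff_perms_on by blast
  have asc: "w i < w (i + 1)" for i
    using perm_length_right_iff(1)[OF assms(1), of i] assms(2) perms_on_eq_iff[OF w, of i "i + 1"] by force
  have "reversal a b \<circ> w = reversal a b"
  proof (rule decreasing_perm_eq_reversal)
    show "reversal a b \<circ> w \<in> perms_on a b"
      using w reversal_in_perms_on[of a b] by (auto simp: perms_on_def bij_comp)
    show "(reversal a b \<circ> w) (i + 1) < (reversal a b \<circ> w) i" if "a \<le> i" "i < b" for i
      using that asc[of i] perms_on_bounds[OF w, of i] perms_on_bounds[OF w, of "i + 1"]
      by (simp add: reversal_def)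
  qed
  then have "reversal a b \<circ> (reversal a b \<circ> w) = reversal a b \<circ> reversal a b" by simp
  moreover have "reversal a b (reversal a b i) = i" for i by (auto simp: reversal_def)
  ultimately show ?thesis by (simp add: fun_eq_iff)
qed

section \<open>Flagged determinants\<close>

lemma det_mat_row_expand:
  assumes "r < n"
  shows "det (mat n n (\<lambda>(i, j). if i = r then f j else g i j)) =
    (\<Sum>j<n. f j * cofactor (mat n n (\<lambda>(i, j). g i j)) r j)" (is "det ?A = _")
proof -
  have "cofactor ?A r j = cofactor (mat n n (\<lambda>(i, j). g i j)) r j" for j
    unfolding cofactor_def mat_delete_def
    by (intro arg_cong[where f = "\<lambda>M. _ * det M"] eq_matI) auto
  then show ?thesis
    using assms by (subst laplace_expansion_row[of _ n r]) auto
qed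

lemma cofactor_invariant:
  assumes "comm_ring_hom s" and "\<And>i j. i < n \<Longrightarrow> j < n \<Longrightarrow> i \<noteq> r \<Longrightarrow> s (g i j) = g i j" and "r < n"
  shows "s (cofactor (mat n n (\<lambda>(i, j). g i j)) r j) = cofactor (mat n n (\<lambda>(i, j). g i j)) r j"
proof -
  interpret s: comm_ring_hom s by fact
  let ?B = "mat_delete (mat n n (\<lambda>(i, j). g i j)) r j"
  have "map_mat s ?B = ?B"
    using assms(2,3) by (intro eq_matI) (auto simp: mat_delete_def)
  then show ?thesis
    by (simp add: cofactor_def s.hom_mult s.hom_power s.hom_uminus flip: s.hom_det)
qed

text \<open>The cofactors along row \<open>r\<close> involve only entries fixed by \<open>s\<close>;
  they are scalars for the operator, which therefore acts on that row entrywise.\<close>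

lemma divided_difference_det_row:
  assumes D: "divided_difference s \<delta>" and r: "r < n"
    and inv: "\<And>i j. i < n \<Longrightarrow> j < n \<Longrightarrow> i \<noteq> r \<Longrightarrow> s (g i j) = g i j"
  shows "divided_difference.D s \<delta> (det (mat n n (\<lambda>(i, j). g i j))) =
    det (mat n n (\<lambda>(i, j). if i = r then divided_difference.D s \<delta> (g r j) else g i j))"
proof -
  interpret d: divided_difference s \<delta> by fact
  have D_sum: "d.D (sum f A) = (\<Sum>x\<in>A. d.D (f x))" for f :: "nat \<Rightarrow> lring" and A
    by (induction A rule: infinite_finite_induct) (simp_all add: d.D_add d.D_eq_0_iff)
  let ?c = "\<lambda>j. cofactor (mat n n (\<lambda>(i, j). g i j)) r j"
  have c: "d.D (x * ?c j) = d.D x * ?c j" for x j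
  proof -
    have "s (?c j) = ?c j" by (rule cofactor_invariant[OF d.comm_ring_hom_axioms inv r])
    then have "d.D (?c j * x) = ?c j * d.D x" by (rule d.D_invariant_mult)
    then show ?thesis by (simp only: mult.commute)
  qed
  have "mat n n (\<lambda>(i, j). g i j) = mat n n (\<lambda>(i, j). if i = r then g r j else g i j)"
    by (intro eq_matI) auto
  then have "d.D (det (mat n n (\<lambda>(i, j). g i j))) = d.D (\<Sum>j<n. g r j * ?c j)"
    using det_mat_row_expand[OF r, of "g r" g] by simp
  also have "\<dots> = (\<Sum>j<n. d.D (g r j) * ?c j)"
    by (simp only: D_sum c)
  finally show ?thesis using det_mat_row_expand[OF r, of "\<lambda>j. d.D (g r j)" g] by simp
qed

definition flag_det :: "nat \<Rightarrow> (nat \<Rightarrow> int) \<Rightarrow> (nat \<Rightarrow> int) \<Rightarrow> (nat \<Rightarrow> int) \<Rightarrow> lring" where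
  "flag_det n p q l = det (mat n n (\<lambda>(r, s). flag_coeff (p r) (q r) (l r + int s)))"

lemma flag_det_cong:
  "(\<And>r. r < n \<Longrightarrow> p r = p' r) \<Longrightarrow> (\<And>r. r < n \<Longrightarrow> q r = q' r) \<Longrightarrow> (\<And>r. r < n \<Longrightarrow> l r = l' r) \<Longrightarrow>
    flag_det n p q l = flag_det n p' q' l'"
  unfolding flag_det_def by (intro arg_cong[where f = det] eq_matI) auto

lemma partial_x_flag_det:
  assumes "r < n" "p r = k" "\<And>i. i < n \<Longrightarrow> i \<noteq> r \<Longrightarrow> p i \<noteq> k"
  shows "partial_x k (flag_det n p q l) = flag_det n (p(r := k + 1)) q (l(r := l r - 1))"
proof -
  have *: "divided_difference.D (sx k) (xx k - xx (k + 1)) (det (mat n n (\<lambda>(i, j). flag_coeff (p i) (q i) (l i + int j)))) =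
    det (mat n n (\<lambda>(i, j). if i = r then divided_difference.D (sx k) (xx k - xx (k + 1)) (flag_coeff (p r) (q r) (l r + int j))
      else flag_coeff (p i) (q i) (l i + int j)))"
    by (rule divided_difference_det_row[OF divided_difference_sx assms(1)]) (simp add: sx_flag_coeff assms(3))
  show ?thesis
    unfolding flag_det_def *[unfolded partial_x_conv] assms(2) partial_x_flag_coeff
    by (intro arg_cong[where f = det] eq_matI) (auto simp: diff_add_eq)
qed

lemma partial_y_flag_det:
  assumes "r < n" "q r = k" "\<And>i. i < n \<Longrightarrow> i \<noteq> r \<Longrightarrow> q i \<noteq> k"
  shows "partial_y k (flag_det n p q l) = flag_det n p (q(r := k - 1)) (l(r := l r - 1))"
proof -
  have *: "divided_difference.D (sy k) (yy k - yy (k + 1)) (det (mat n n (\<lambda>(i, j). flag_coeff (p i) (q i) (l i + int j)))) =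
    det (mat n n (\<lambda>(i, j). if i = r then divided_difference.D (sy k) (yy k - yy (k + 1)) (flag_coeff (p r) (q r) (l r + int j))
      else flag_coeff (p i) (q i) (l i + int j)))"
    by (rule divided_difference_det_row[OF divided_difference_sy assms(1)]) (simp add: sy_flag_coeff assms(3))
  show ?thesis
    unfolding flag_det_def *[unfolded partial_y_conv] assms(2) partial_y_flag_coeff
    by (intro arg_cong[where f = det] eq_matI) (auto simp: diff_add_eq)
qed

lemma flag_coeff_0 [simp]: "flag_coeff p q 0 = 1" and flag_coeff_neg: "k < 0 \<Longrightarrow> flag_coeff p q k = 0"
  by (simp_all add: flag_coeff_def)

text \<open>The last row is (0, ..., 0, 1): negative degrees before the diagonal and degree 0 on
  it.\<close>

lemma flag_det_drop_last:
  assumes "l n = - int n"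
  shows "flag_det (Suc n) p q l = flag_det n p q l"
proof -
  let ?A = "mat (Suc n) (Suc n) (\<lambda>(r, s). flag_coeff (p r) (q r) (l r + int s))"
  have "det ?A = (\<Sum>j<Suc n. ?A $$ (n, j) * cofactor ?A n j)"
    by (rule laplace_expansion_row) auto
  also have "\<dots> = cofactor ?A n n"
    using assms by (simp add: flag_coeff_neg)
  also have "mat_delete ?A n n = mat n n (\<lambda>(r, s). flag_coeff (p r) (q r) (l r + int s))"
    by (intro eq_matI) (auto simp: mat_delete_def)
  then have "cofactor ?A n n = flag_det n p q l"
    by (simp add: cofactor_def flag_det_def flip: mult_2 power_add)
  finally show ?thesis by (simp add: flag_det_def)
qed

text \<open>The determinant for the reversal of \<open>[a, b]\<close>: the row of \<open>i \<in> {a..<b}\<close> uses the \<open>x\<close>-variables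
  up to \<open>i\<close> and the \<open>y\<close>-variables below the value \<open>a + b - i\<close> of the reversal.\<close>

definition top_det :: "int \<Rightarrow> int \<Rightarrow> lring" where
  "top_det a b = flag_det (nat (b - a)) (\<lambda>r. a + int r) (\<lambda>r. b - 1 - int r) (\<lambda>r. b - a - 2 * int r)"

lemma top_det_single [simp]: "top_det a a = 1"
  by (simp add: top_det_def flag_det_def)

text \<open>Both operators act on row r = i - a, one raising its x-flag, the other lowering its
  y-flag. By linearity in this row the difference is x_{i+1} + y_{a+b-1-i} times one determinant,
  which vanishes.\<close>

lemma partial_x_top_det:
  assumes "a \<le> i" "i < b"
  shows "partial_x i (top_det a b) = partial_y (a + b - 1 - i) (top_det a b)"
proof -
  define n where "n = nat (b - a)"
  define r where "r = nat (i - a)"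
  define p q l where "p = (\<lambda>r. a + int r)" and "q = (\<lambda>r. b - 1 - int r)" and "l = (\<lambda>r. b - a - 2 * int r)"
  define c where "c = cofactor (mat n n (\<lambda>(i, j). flag_coeff (p i) (q i) (l i + int j))) r"
  have r: "r < n" and i: "i = a + int r" and n: "int n = b - a"
    using assms by (auto simp: r_def n_def)
  have T: "top_det a b = flag_det n p q l" by (simp add: top_det_def n_def p_def q_def l_def)
  have row: "flag_det n p' q' l' = (\<Sum>j<n. flag_coeff (p' r) (q' r) (l' r + int j) * c j)"
    if "\<And>i. i \<noteq> r \<Longrightarrow> p' i = p i \<and> q' i = q i \<and> l' i = l i" for p' q' l'
  proof -
    have "flag_det n p' q' l' = det (mat n n (\<lambda>(i, j). if i = r then flag_coeff (p' r) (q' r) (l' r + int j)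
        else flag_coeff (p i) (q i) (l i + int j)))"
      unfolding flag_det_def using that by (intro arg_cong[where f = det] eq_matI) auto
    then show ?thesis using det_mat_row_expand[OF r] by (simp add: c_def)
  qed
  have "partial_x i (top_det a b) - partial_y (a + b - 1 - i) (top_det a b) =
      flag_det n (p(r := i + 1)) q (l(r := l r - 1)) - flag_det n p (q(r := q r - 1)) (l(r := l r - 1))"
    unfolding T using r
    by (subst partial_x_flag_det[of r], auto simp: p_def i, subst partial_y_flag_det[of r], auto simp: q_def)
  also have "\<dots> = (\<Sum>j<n. (flag_coeff (i + 1) (q r) (l r - 1 + int j) - flag_coeff i (q r - 1) (l r - 1 + int j)) * c j)"
    by (subst row, simp, subst row, simp) (simp add: p_def i sum_subtractf left_diff_distrib)
  also have "\<dots> = (xx (i + 1) + yy (q r)) * (\<Sum>j<n. flag_coeff (i + 1) (q r - 1) (l r - 2 + int j) * c j)"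
  proof -
    have "flag_coeff (i + 1) (q r) (l r - 1 + int j) - flag_coeff i (q r - 1) (l r - 1 + int j) =
        (xx (i + 1) + yy (q r)) * flag_coeff (i + 1) (q r - 1) (l r - 2 + int j)" for j
      using flag_coeff_diff[of i "q r" "l r - 1 + int j"] by (simp add: algebra_simps)
    then show ?thesis by (simp only: sum_distrib_left mult.assoc)
  qed
  also have "(\<Sum>j<n. flag_coeff (i + 1) (q r - 1) (l r - 2 + int j) * c j) = 0"
  proof (cases "Suc r < n")
    case True
    define A where "A = mat n n (\<lambda>(k, j). if k = r then flag_coeff (i + 1) (q r - 1) (l r - 2 + int j)
      else flag_coeff (p k) (q k) (l k + int j))"
    \<comment> \<open>The replaced row has exactly the flags and degrees of its successor; the steps
      1, -1, -2 of \<open>p\<close>, \<open>q\<close>, \<open>l\<close> match the changes made to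
      it.\<close>
    have "p (Suc r) = i + 1" "q (Suc r) = q r - 1" "l (Suc r) = l r - 2"
      by (simp_all add: p_def q_def l_def i)
    then have "row A r = row A (Suc r)"
      using True r by (intro eq_vecI) (auto simp: A_def)
    then have "det A = 0"
      using True r by (intro det_identical_rows[of A n r "Suc r"]) (auto simp: A_def)
    then show ?thesis
      using det_mat_row_expand[OF r, of "\<lambda>j. flag_coeff (i + 1) (q r - 1) (l r - 2 + int j)"
        "\<lambda>k j. flag_coeff (p k) (q k) (l k + int j)"] by (simp add: A_def c_def)
  next
    case False
    \<comment> \<open>The last row has no successor, but there l r = 2 - n, so the replaced row lies
      in negative degrees throughout.\<close>
    then have "l r - 2 + int j < 0" if "j < n" for j
      using that r n by (simp add: l_def)
    then show ?thesis by (simp add: flag_coeff_neg)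
  qed
  finally show ?thesis by simp
qed

text \<open>What \<open>partial_x (b - 1)\<close>, ..., \<open>partial_x k\<close>, applied in this
  order, make of \<open>top_det a b\<close>. In the opposite order a raised flag would meet that of
  the next row, and two rows would change at once.\<close>

definition top_det_left :: "int \<Rightarrow> int \<Rightarrow> int \<Rightarrow> lring" where
  "top_det_left a b k = flag_det (nat (b - a)) (\<lambda>r. if a + int r < k then a + int r else a + int r + 1)
     (\<lambda>r. b - 1 - int r) (\<lambda>r. if a + int r < k then b - a - 2 * int r else b - a - 1 - 2 * int r)"

lemma top_det_left_step:
  assumes "a \<le> k" "k < b"
  shows "partial_x k (top_det_left a b (k + 1)) = top_det_left a b k"
  unfolding top_det_left_def using assms
  by (subst partial_x_flag_det[of "nat (k - a)"]) (auto intro!: flag_det_cong)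

lemma top_det_left_top: "top_det_left a b b = top_det a b"
  unfolding top_det_left_def top_det_def by (rule flag_det_cong) auto

text \<open>With every x-flag raised and every degree lowered by one, the last row is a unit row;
  deleting it leaves the determinant of the shorter interval.\<close>

lemma top_det_left_bot:
  assumes "a < b"
  shows "top_det_left a b a = top_det (a + 1) b"
proof -
  have n: "nat (b - a) = Suc (nat (b - (a + 1)))" using assms by simp
  show ?thesis
    unfolding top_det_left_def top_det_def n using assms
    by (subst flag_det_drop_last) (auto intro!: flag_det_cong)
qed

text \<open>The mirror image, after the y-operators of index a, ..., k - 1: the x-flags still start
  at \<open>a\<close>, and lowering the y-flags moves the right end instead.\<close>

definition top_det_right :: "int \<Rightarrow> int \<Rightarrow> int \<Rightarrow> lring" where
  "top_det_right a b k = flag_det (nat (b - a)) (\<lambda>r. a + int r)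
     (\<lambda>r. if b - 1 - int r < k then b - 2 - int r else b - 1 - int r)
     (\<lambda>r. if b - 1 - int r < k then b - a - 1 - 2 * int r else b - a - 2 * int r)"

lemma top_det_right_step:
  assumes "a \<le> k" "k < b"
  shows "partial_y k (top_det_right a b k) = top_det_right a b (k + 1)"
  unfolding top_det_right_def using assms
  by (subst partial_y_flag_det[of "nat (b - 1 - k)"]) (auto intro!: flag_det_cong)

lemma top_det_right_top: "top_det_right a b a = top_det a b"
  unfolding top_det_right_def top_det_def by (rule flag_det_cong) auto

lemma top_det_right_bot:
  assumes "a < b"
  shows "top_det_right a b b = top_det a (b - 1)"
proof -
  have n: "nat (b - a) = Suc (nat (b - 1 - a))" using assms by simp
  show ?thesis
    unfolding top_det_right_def top_det_def n using assms
    by (subst flag_det_drop_last) (auto intro!: flag_det_cong)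
qed

lemma shift_ring_top_det:
  assumes "m \<ge> 0"
  shows "shift_ring m (top_det a b) = top_det (a + m) (b + m)"
proof -
  have "nat (b + m - (a + m)) = nat (b - a)" by simp
  then show ?thesis
    unfolding top_det_def flag_det_def shift_ring.hom_det[symmetric]
    by (intro arg_cong[where f = det] eq_matI) (auto simp: shift_ring_flag_coeff[OF assms] algebra_simps)
qed

subsection \<open>The product formula\<close>

text \<open>From degree n on, the expansion of P(t)/(1 - x t), with P the product of the n linear
  factors, is geometric with ratio x and starts with x^n P(1/x).\<close>

lemma nth_inv_lin_prod_lin:
  "fps_nth (inv_lin_series (- x) * (\<Prod>k<n. lin_series (Y k))) (n + s) = x ^ s * (\<Prod>k<n. x + Y k)"
proof (induction n arbitrary: s)
  case 0
  show ?case by (simp add: inv_lin_series_def)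
next
  case (Suc n)
  let ?F = "inv_lin_series (- x) * (\<Prod>k<n. lin_series (Y k))"
  have "inv_lin_series (- x) * (\<Prod>k<Suc n. lin_series (Y k)) = ?F + fps_const (Y n) * (fps_X * ?F)"
    by (simp add: lin_series_def algebra_simps)
  then have "fps_nth (inv_lin_series (- x) * (\<Prod>k<Suc n. lin_series (Y k))) (Suc n + s) =
      fps_nth ?F (n + Suc s) + Y n * fps_nth ?F (n + s)"
    by simp
  also have "\<dots> = x ^ Suc s * (\<Prod>k<n. x + Y k) + Y n * (x ^ s * (\<Prod>k<n. x + Y k))"
    by (simp only: Suc.IH)
  finally show ?case by (simp add: algebra_simps)
qed

definition int_coeff :: "lring fps \<Rightarrow> int \<Rightarrow> lring" where
  "int_coeff a k = (if k < 0 then 0 else fps_nth a (nat k))"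

lemma int_coeff_mult_lin: "int_coeff (a * lin_series y) k = int_coeff a k + y * int_coeff a (k - 1)"
proof -
  have "nat k - 1 = nat (k - 1)" by simp
  moreover have "a * lin_series y = a + fps_const y * (fps_X * a)"
    by (simp add: lin_series_def algebra_simps)
  ultimately show ?thesis by (auto simp: int_coeff_def)
qed

text \<open>Subtracting X 0 times the preceding column multiplies the series of each row by 1 - X 0
  t. Row 0 is geometric with ratio X 0, so only its first entry survives; in the other rows X 0
  cancels, and the minor is the same determinant in X 1, X 2, ....\<close>

lemma product_det:
  "det (mat n n (\<lambda>(r, s). int_coeff ((\<Prod>k<Suc r. inv_lin_series (- X k)) * (\<Prod>k<n - r. lin_series (Y k)))
      (int n - 2 * int r + int s))) = (\<Prod>r<n. \<Prod>k<n - r. X r + Y k)"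
proof (induction n arbitrary: X)
  case 0
  show ?case by simp
next
  case (Suc n)
  define G where "G r = (\<Prod>k<Suc r. inv_lin_series (- X k)) * (\<Prod>k<Suc n - r. lin_series (Y k))" for r
  define M where "M = mat (Suc n) (Suc n) (\<lambda>(r, s). int_coeff (G r) (int (Suc n) - 2 * int r + int s))"
  \<comment> \<open>Right multiplication by this unipotent matrix performs all the column operations
    at once.\<close>
  define U where "U = mat (Suc n) (Suc n) (\<lambda>(r, s). if r = s then 1 else if s = Suc r then - X 0 else (0 :: lring))"
  define P where "P = (\<Prod>k<Suc n. X 0 + Y k)"
  have [simp]: "M \<in> carrier_mat (Suc n) (Suc n)" "U \<in> carrier_mat (Suc n) (Suc n)"
    by (simp_all add: M_def U_def)
  have "det U = prod_list (diag_mat U)"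
    by (rule det_upper_triangular[where n = "Suc n"]) (auto simp: U_def)
  also have "diag_mat U = map (\<lambda>_. 1) [0..<Suc n]"
    unfolding diag_mat_def by (rule map_cong) (auto simp: U_def)
  finally have "det U = 1" by (simp add: map_replicate_const del: upt_Suc)
  then have det: "det M = det (M * U)" by (simp add: det_mult[where n = "Suc n"])
  have MU: "(M * U) $$ (r, s) = M $$ (r, s) - (if s = 0 then 0 else X 0 * M $$ (r, s - 1))"
    if "r < Suc n" "s < Suc n" for r s
  proof -
    have "(M * U) $$ (r, s) = (\<Sum>t<Suc n. M $$ (r, t) * U $$ (t, s))"
      using that by (simp add: M_def U_def scalar_prod_def atLeast0LessThan)
    also have "\<dots> = (\<Sum>t<Suc n. (if t = s then M $$ (r, s) else 0) + (if t = s - 1 \<and> s \<noteq> 0 then - X 0 * M $$ (r, s - 1) else 0))"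
      using that by (intro sum.cong) (auto simp: U_def)
    also have "\<dots> = M $$ (r, s) - (if s = 0 then 0 else X 0 * M $$ (r, s - 1))"
      using that by (cases s) (simp_all add: sum.distrib del: sum.lessThan_Suc)
    finally show ?thesis .
  qed
  have first: "M $$ (0, s) = X 0 ^ s * P" if "s < Suc n" for s
    using that nth_inv_lin_prod_lin[of "X 0" Y "Suc n" s]
    by (simp add: M_def G_def int_coeff_def P_def nat_add_distrib flip: of_nat_Suc of_nat_add)
  have "(M * U) $$ (0, s) = (if s = 0 then P else 0)" if "s < Suc n" for s
    using that by (cases s) (simp_all add: MU first)
  then have "(\<Sum>j<Suc n. (M * U) $$ (0, j) * cofactor (M * U) 0 j) = P * cofactor (M * U) 0 0"
    by (simp add: sum.lessThan_Suc_shift del: sum.lessThan_Suc)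
  then have "det (M * U) = P * cofactor (M * U) 0 0"
    using laplace_expansion_row[OF mult_carrier_mat[of M "Suc n" "Suc n" U "Suc n"], of 0] by simp
  also have "cofactor (M * U) 0 0 = det (mat_delete (M * U) 0 0)"
    by (simp add: cofactor_def)
  also have "mat_delete (M * U) 0 0 = mat n n (\<lambda>(r, s). int_coeff
      ((\<Prod>k<Suc r. inv_lin_series (- X (Suc k))) * (\<Prod>k<n - r. lin_series (Y k))) (int n - 2 * int r + int s))"
    (is "?L = ?R")
  proof (rule eq_matI)
    fix r s assume "r < dim_row ?R" "s < dim_col ?R"
    then have rs: "r < n" "s < n" by simp_all
    have G: "G (Suc r) * lin_series (- X 0) = (\<Prod>k<Suc r. inv_lin_series (- X (Suc k))) * (\<Prod>k<n - r. lin_series (Y k))"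
    proof -
      have "G (Suc r) * lin_series (- X 0) = (inv_lin_series (- X 0) * lin_series (- X 0)) *
          ((\<Prod>k<Suc r. inv_lin_series (- X (Suc k))) * (\<Prod>k<n - r. lin_series (Y k)))"
        unfolding G_def by (subst prod.lessThan_Suc_shift) (simp add: mult_ac del: prod.lessThan_Suc)
      then show ?thesis by (simp add: inv_lin_series')
    qed
    have "?L $$ (r, s) = M $$ (Suc r, Suc s) - X 0 * M $$ (Suc r, s)"
      using rs MU[of "Suc r" "Suc s"] by (simp add: mat_delete_def M_def U_def)
    also have "\<dots> = int_coeff (G (Suc r) * lin_series (- X 0)) (int n - 2 * int r + int s)"
      unfolding int_coeff_mult_lin using rs by (simp add: M_def algebra_simps)
    finally show "?L $$ (r, s) = ?R $$ (r, s)" using rs by (simp add: G)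
  qed (simp_all add: mat_delete_def M_def U_def)
  finally have "det M = P * (\<Prod>r<n. \<Prod>k<n - r. X (Suc r) + Y k)"
    unfolding det Suc.IH .
  then show ?case
    by (simp add: M_def G_def P_def prod.lessThan_Suc_shift del: prod.lessThan_Suc)
qed

lemma prod_int_interval_nat:
  fixes f :: "int \<Rightarrow> 'a :: comm_monoid_mult"
  shows "(\<Prod>i\<in>{1..int n}. f i) = (\<Prod>k<n. f (1 + int k))"
  by (rule prod.reindex_bij_witness[of _ "\<lambda>k. 1 + int k" "\<lambda>i. nat (i - 1)"]) auto

lemma set_c_zero_top_det:
  "set_c_zero (top_det 1 (int n)) = (\<Prod>(i, j) \<in> {(i, j). 1 \<le> i \<and> 1 \<le> j \<and> i + j \<le> int n}. xx i + yy j)"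
proof -
  \<comment> \<open>The truncated difference also gives the empty determinant at n = 0.\<close>
  define N where "N = n - 1"
  have N: "nat (int n - 1) = N" by (simp add: N_def)
  have "set_c_zero (top_det 1 (int n)) = det (mat N N (\<lambda>(r, s).
      set_c_zero (flag_coeff (1 + int r) (int n - 1 - int r) (int n - 1 - 2 * int r + int s))))"
    unfolding top_det_def flag_det_def set_c_zero.hom_det[symmetric] N
    by (intro arg_cong[where f = det] eq_matI) auto
  also have "\<dots> = det (mat N N (\<lambda>(r, s). int_coeff ((\<Prod>k<Suc r. inv_lin_series (- xx (1 + int k))) *
      (\<Prod>k<N - r. lin_series (yy (1 + int k)))) (int N - 2 * int r + int s)))"
  proof (rule arg_cong[where f = det], rule cong_mat)
    fix r s assume rs: "r < N" "s < N"
    then have n: "int n = int N + 1" by (simp add: N_def)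
    have "x_series (1 + int r) = (\<Prod>k<Suc r. inv_lin_series (- xx (1 + int k)))"
      using prod_int_interval_nat[of "\<lambda>i. inv_lin_series (- xx i)" "Suc r"] by (simp add: x_series_def)
    moreover have "y_series (int n - 1 - int r) = (\<Prod>k<N - r. lin_series (yy (1 + int k)))"
      using prod_int_interval_nat[of "\<lambda>i. lin_series (yy i)" "N - r"] rs by (simp add: y_series_def n of_nat_diff)
    ultimately show "(case (r, s) of (r, s) \<Rightarrow>
        set_c_zero (flag_coeff (1 + int r) (int n - 1 - int r) (int n - 1 - 2 * int r + int s))) =
      (case (r, s) of (r, s) \<Rightarrow> int_coeff ((\<Prod>k<Suc r. inv_lin_series (- xx (1 + int k))) *
          (\<Prod>k<N - r. lin_series (yy (1 + int k)))) (int N - 2 * int r + int s))"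
      using arg_cong[OF set_c_zero_c_flag[of "1 + int r" "int n - 1 - int r"],
          of "\<lambda>f. fps_nth f (nat (int N - 2 * int r + int s))"]
      by (simp add: flag_coeff_def int_coeff_def n)
  qed simp_all
  also have "\<dots> = (\<Prod>r<N. \<Prod>k<N - r. xx (1 + int r) + yy (1 + int k))"
    by (rule product_det)
  also have "\<dots> = (\<Prod>(r, k) \<in> (SIGMA r:{..<N}. {..<N - r}). xx (1 + int r) + yy (1 + int k))"
    by (subst prod.Sigma) auto
  also have "\<dots> = (\<Prod>(i, j) \<in> {(i, j). 1 \<le> i \<and> 1 \<le> j \<and> i + j \<le> int n}. xx i + yy j)"
    by (rule prod.reindex_bij_witness[of _ "\<lambda>(i, j). (nat (i - 1), nat (j - 1))" "\<lambda>(r, k). (1 + int r, 1 + int k)"])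
      (auto simp: N_def)
  finally show ?thesis .
qed

section \<open>The family of polynomials\<close>

text \<open>A relation, since a value might depend on the chain of ascents leading up to the
  reversal until the contrary is proved.\<close>

inductive schub :: "int \<Rightarrow> int \<Rightarrow> (int \<Rightarrow> int) \<Rightarrow> lring \<Rightarrow> bool" for a b where
  top: "schub a b (reversal a b) (top_det a b)"
| ascent: "schub a b (w \<circ> adj_transp i) g \<Longrightarrow> a \<le> i \<Longrightarrow> i < b \<Longrightarrow> w i < w (i + 1) \<Longrightarrow>
    schub a b w (partial_x i g)"

lemma schub_perms_on: "schub a b w f \<Longrightarrow> w \<in> perms_on a b"
proof (induction rule: schub.induct)
  case (ascent w i g)
  then have "w \<circ> adj_transp i \<in> perms_on a b" by (simp add: comp_def)
  then show ?case using perms_on_comp_adj(1)[of "w \<circ> adj_transp i" a b i] ascent by simp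
qed (rule reversal_in_perms_on)

lemma schub_ex: "w \<in> perms_on a b \<Longrightarrow> \<exists>f. schub a b w f"
proof (induction rule: perms_on_descend_induct)
  case (descent w i)
  then obtain f where "schub a b w f" by blast
  then have "schub a b (w \<circ> adj_transp i) (partial_x i f)"
    using descent by (intro schub.ascent) simp_all
  then show ?case by blast
qed (use schub.top in blast)

text \<open>Diamond argument, by induction on the distance from the top. Two ascents of
  \<open>w\<close> have a common permutation above them, two steps up if they are far apart and
  three if adjacent. The induction hypothesis computes both predecessors from a value there, and
  commutation or the braid relation closes the diagram.\<close>

lemma schub_unique: "schub a b w f \<Longrightarrow> schub a b w f' \<Longrightarrow> f = f'"
proof (induction "card ({a..b} \<times> {a..b}) - perm_length w" arbitrary: w f f' rule: less_induct)
  case (less w f f')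
  have w: "w \<in> perms_on a b" using less.prems(1) by (rule schub_perms_on)
  have IH: "h = h'" if "schub a b (w \<circ> adj_transp k) h" "schub a b (w \<circ> adj_transp k) h'"
    "a \<le> k" "k < b" "w k < w (k + 1)" for k h h'
  proof (rule less.hyps[OF _ that(1,2)])
    have "perm_length (w \<circ> adj_transp k) = Suc (perm_length w)"
      using w S_Z_iff_perms_on that(5) by (intro perm_length_ascent) auto
    moreover have "perm_length (w \<circ> adj_transp k) \<le> card ({a..b} \<times> {a..b})"
      using perms_on_comp_adj(1)[OF w that(3,4)] by (rule perm_length_le)
    ultimately show "card ({a..b} \<times> {a..b}) - perm_length (w \<circ> adj_transp k)
      < card ({a..b} \<times> {a..b}) - perm_length w" by simp
  qed
  have far: "partial_x i g = partial_x j g'"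
    if i: "a \<le> i" "i < b" "w i < w (i + 1)" "schub a b (w \<circ> adj_transp i) g"
      and j: "a \<le> j" "j < b" "w j < w (j + 1)" "schub a b (w \<circ> adj_transp j) g'"
      and "\<bar>i - j\<bar> \<ge> 2" for i j g g'
  proof -
    have eq: "w \<circ> adj_transp i \<circ> adj_transp j = w \<circ> adj_transp j \<circ> adj_transp i"
      using adj_transp_commute[OF that(9)] by (simp add: fun_eq_iff)
    obtain h where h: "schub a b (w \<circ> adj_transp i \<circ> adj_transp j) h"
      using schub_ex perms_on_comp_adj(1) w i j by meson
    have "schub a b (w \<circ> adj_transp i) (partial_x j h)"
      using h j that(9) by (intro schub.ascent) (auto simp: adj_transp_eq)
    then have "g = partial_x j h" using IH i by blast
    moreover have "schub a b (w \<circ> adj_transp j) (partial_x i h)"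
      using h i that(9) unfolding eq by (intro schub.ascent) (auto simp: adj_transp_eq)
    then have "g' = partial_x i h" using IH j by blast
    ultimately show ?thesis by (simp add: partial_x_commute[OF that(9)])
  qed
  have near: "partial_x i g = partial_x (i + 1) g'"
    if i: "a \<le> i" "i < b" "w i < w (i + 1)" "schub a b (w \<circ> adj_transp i) g"
      and j: "a \<le> i + 1" "i + 1 < b" "w (i + 1) < w (i + 1 + 1)" "schub a b (w \<circ> adj_transp (i + 1)) g'"
    for i g g'
  proof -
    let ?s = "adj_transp i" and ?t = "adj_transp (i + 1)"
    have eq: "w \<circ> ?s \<circ> ?t \<circ> ?s = w \<circ> ?t \<circ> ?s \<circ> ?t"
      using adj_transp_braid[of i] by (simp add: fun_eq_iff)
    \<comment> \<open>The top of the hexagon, where the three increasing values at i, i + 1, i + 2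
      stand in decreasing order.\<close>
    have "w \<circ> ?s \<circ> ?t \<circ> ?s \<in> perms_on a b" by (intro perms_on_comp_adj(1) w i j)
    then obtain h where h: "schub a b (w \<circ> ?s \<circ> ?t \<circ> ?s) h" using schub_ex by blast
    have "schub a b (w \<circ> ?s \<circ> ?t) (partial_x i h)"
      using h i j by (intro schub.ascent[of _ _ _ i]) (auto simp: adj_transp_eq)
    then have "schub a b (w \<circ> ?s) (partial_x (i + 1) (partial_x i h))"
      using i j by (intro schub.ascent[of _ _ _ "i + 1"]) (auto simp: adj_transp_eq)
    then have "g = partial_x (i + 1) (partial_x i h)" using IH i by blast
    moreover have "schub a b (w \<circ> ?t \<circ> ?s) (partial_x (i + 1) h)"
      using h i j unfolding eq by (intro schub.ascent) (auto simp: adj_transp_eq)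
    then have "schub a b (w \<circ> ?t) (partial_x i (partial_x (i + 1) h))"
      using i j by (intro schub.ascent[of _ _ _ i]) (auto simp: adj_transp_eq)
    then have "g' = partial_x i (partial_x (i + 1) h)" using IH j by blast
    ultimately show ?thesis by (simp only: partial_x_braid)
  qed
  have no_ascent: "\<not> (a \<le> i \<and> i < b \<and> reversal a b i < reversal a b (i + 1))" for i
    by (auto simp: reversal_def)
  from less.prems(1) show ?case
  proof cases
    case top
    from less.prems(2) show ?thesis
      by cases (use top no_ascent in auto)
  next
    case (ascent i g)
    note i = ascent
    from less.prems(2) show ?thesis
    proof cases
      case top
      then show ?thesis using i no_ascent by auto
    next
      case (ascent j g')
      consider "i = j" | "\<bar>i - j\<bar> \<ge> 2" | "j = i + 1" | "i = j + 1" by linarith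
      then show ?thesis
      proof cases
        case 1
        then show ?thesis using IH i ascent by blast
      next
        case 2
        then show ?thesis using far i ascent by blast
      next
        case 3
        then show ?thesis using near i ascent by blast
      next
        case 4
        then show ?thesis using near[of j g' g] i ascent by simp
      qed
    qed
  qed
qed

definition schubert_on :: "int \<Rightarrow> int \<Rightarrow> (int \<Rightarrow> int) \<Rightarrow> lring" where
  "schubert_on a b w = (THE f. schub a b w f)"

lemma schubert_on_eqI: "schub a b w f \<Longrightarrow> schubert_on a b w = f"
  unfolding schubert_on_def using schub_unique by blast

lemma schub_schubert_on: "w \<in> perms_on a b \<Longrightarrow> schub a b w (schubert_on a b w)"
  using schub_ex schubert_on_eqI by metis

lemma schubert_on_reversal [simp]: "schubert_on a b (reversal a b) = top_det a b"
  by (rule schubert_on_eqI) (rule schub.top)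

lemma partial_x_schubert_on_descent:
  assumes "w \<in> perms_on a b" "a \<le> i" "i < b" "w (i + 1) < w i"
  shows "partial_x i (schubert_on a b w) = schubert_on a b (w \<circ> adj_transp i)"
  using assms schub_schubert_on[OF assms(1)]
  by (intro schubert_on_eqI[symmetric] schub.ascent) simp_all

text \<open>At an ascent the polynomial lies in the image of \<open>partial_x i\<close>, whose
  square is 0.\<close>

lemma partial_x_schubert_on_ascent:
  assumes "w \<in> perms_on a b" "a \<le> i" "i < b" "w i < w (i + 1)"
  shows "partial_x i (schubert_on a b w) = 0"
proof -
  have "schubert_on a b w = partial_x i (schubert_on a b (w \<circ> adj_transp i))"
    using partial_x_schubert_on_descent[OF perms_on_comp_adj(1)[OF assms(1-3)] assms(2,3)] assms(4) by simp
  then show ?thesis by (simp add: partial_x_partial_x)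
qed

text \<open>The positions \<open>p\<close>, \<open>q\<close> of the values k, k + 1 stand in for the
  inverse of \<open>w\<close>. At the reversal the claim is the equality of an x- and a y-operator;
  further down, \<open>partial_y k\<close> is moved past \<open>partial_x i\<close>.\<close>

lemma partial_y_schubert_on:
  assumes "w \<in> perms_on a b" "a \<le> k" "k < b" "w p = k" "w q = k + 1"
  shows "partial_y k (schubert_on a b w) = (if q < p then schubert_on a b (adj_transp k \<circ> w) else 0)"
  using assms(1,4,5)
proof (induction arbitrary: p q rule: perms_on_descend_induct)
  case reversal
  let ?i = "a + b - 1 - k"
  have "a \<le> p" "p \<le> b" "a \<le> q" "q \<le> b" using reversal assms(2,3) by (auto simp: reversal_def split: if_splits)
  then have "q < p" using reversal by (auto simp: reversal_def)
  have i: "a \<le> ?i" "?i < b" using assms(2,3) by auto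
  have "partial_y k (top_det a b) = partial_x ?i (top_det a b)"
    using partial_x_top_det[OF i] by (simp add: algebra_simps)
  also have "\<dots> = schubert_on a b (reversal a b \<circ> adj_transp ?i)"
    using partial_x_schubert_on_descent[OF reversal_in_perms_on i] assms(2,3) by (simp add: reversal_def)
  also have "reversal a b \<circ> adj_transp ?i = adj_transp k \<circ> reversal a b"
    using assms(2,3) by (auto simp: fun_eq_iff reversal_def adj_transp_eq)
  finally show ?case using \<open>q < p\<close> by (simp add: comp_def)
next
  case (descent w i)
  let ?s = "adj_transp i" and ?k = "adj_transp k"
  have pq: "w (?s p) = k" "w (?s q) = k + 1" using descent.prems by simp_all
  have "partial_y k (schubert_on a b (w \<circ> ?s)) = partial_y k (partial_x i (schubert_on a b w))"
    using partial_x_schubert_on_descent descent.hyps by simp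
  also have "\<dots> = partial_x i (partial_y k (schubert_on a b w))"
    by (simp only: partial_x_partial_y_commute)
  also have "\<dots> = partial_x i (if ?s q < ?s p then schubert_on a b (?k \<circ> w) else 0)"
    by (simp only: descent.IH[OF pq])
  also have "\<dots> = (if q < p then schubert_on a b (?k \<circ> (w \<circ> ?s)) else 0)"
  proof -
    have kw: "?k \<circ> w \<in> perms_on a b" using descent.hyps assms(2,3) by (intro perms_on_comp_adj(2))
    consider (eq) "w i = k + 1" "w (i + 1) = k" | (neq) "\<not> (w i = k + 1 \<and> w (i + 1) = k)" by blast
    then show ?thesis
    proof cases
      \<comment> \<open>Exchanging the values k, k + 1 is here the same as exchanging the positions
        i, i + 1, so the left descent is used up by the right one and both sides are 0.\<close>
      case eq
      then have "?s p = i + 1" "?s q = i"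
        using pq perms_on_eq_iff[OF descent.hyps(1)] by metis+
      then have "p = i" "q = i + 1" by (metis adj_transp_involutive adj_transp_right adj_transp_left)+
      moreover have "?k \<circ> w = w \<circ> ?s"
      proof
        fix j
        show "(?k \<circ> w) j = (w \<circ> ?s) j"
          using eq perms_on_eq_iff[OF descent.hyps(1), of j i] perms_on_eq_iff[OF descent.hyps(1), of j "i + 1"]
          by (auto simp: adj_transp_eq)
      qed
      moreover have "partial_x i (schubert_on a b (w \<circ> ?s)) = 0"
        using descent.hyps by (intro partial_x_schubert_on_ascent perms_on_comp_adj(1)) auto
      ultimately show ?thesis by simp
    next
      case neq
      \<comment> \<open>In all other cases the descent of \<open>w\<close> at \<open>i\<close>
        survives the exchange of values, and the order of the two positions survives the exchange of
        positions.\<close>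
      have "(?k \<circ> w) (i + 1) < (?k \<circ> w) i"
        using neq descent.hyps(4) by (auto simp: adj_transp_eq)
      then have *: "partial_x i (schubert_on a b (?k \<circ> w)) = schubert_on a b (?k \<circ> (w \<circ> ?s))"
        using partial_x_schubert_on_descent[OF kw] descent.hyps by (simp add: comp_assoc)
      have ne: "?s p \<noteq> i + 1 \<or> ?s q \<noteq> i" using neq pq by auto
      have ne': "?s p \<noteq> i \<or> ?s q \<noteq> i + 1" using pq descent.hyps(4) by auto
      have "?s q < ?s p \<longleftrightarrow> q < p"
        using ne ne' by (auto simp: adj_transp_eq split: if_splits)
      with * show ?thesis by (auto simp: partial_x_eq_0_iff sx.hom_zero)
    qed
  qed
  finally show ?case .
qed

subsection \<open>Independence of the interval\<close>

text \<open>The decreasing word of [a, b] with its smallest value moved to position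
  \<open>k\<close>: the reversal of [a, b] at k = b, that of [a + 1, b] at k = a.\<close>

definition left_perm :: "int \<Rightarrow> int \<Rightarrow> int \<Rightarrow> int \<Rightarrow> int" where
  "left_perm a b k i = (if i < a \<or> b < i then i else if i < k then a + b - i
     else if i = k then a else a + b + 1 - i)"

lemma left_perm_step: "a \<le> k \<Longrightarrow> k < b \<Longrightarrow> left_perm a b (k + 1) \<circ> adj_transp k = left_perm a b k"
  by (auto simp: fun_eq_iff left_perm_def adj_transp_eq)

lemma schubert_on_left_perm:
  assumes "k \<le> b" "a \<le> k"
  shows "left_perm a b k \<in> perms_on a b \<and> schubert_on a b (left_perm a b k) = top_det_left a b k"
  using assms
proof (induction k rule: int_le_induct)
  case base
  have "left_perm a b b = reversal a b"
    by (auto simp: fun_eq_iff left_perm_def reversal_def)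
  then show ?case by (simp add: reversal_in_perms_on top_det_left_top)
next
  case (step k)
  define j where "j = k - 1"
  have j: "a \<le> j" "j < b" "k = j + 1" using step by (auto simp: j_def)
  have IH: "left_perm a b (j + 1) \<in> perms_on a b"
    "schubert_on a b (left_perm a b (j + 1)) = top_det_left a b (j + 1)"
    using step j by auto
  have "left_perm a b (j + 1) (j + 1) < left_perm a b (j + 1) j"
    using j by (auto simp: left_perm_def)
  then have "schubert_on a b (left_perm a b (j + 1) \<circ> adj_transp j) = top_det_left a b j"
    using partial_x_schubert_on_descent[OF IH(1) j(1,2)] top_det_left_step[OF j(1,2)] IH(2) by simp
  then show ?case
    using perms_on_comp_adj(1)[OF IH(1) j(1,2)] left_perm_step[OF j(1,2)] j(3) by simp
qed

text \<open>At the reversal of the smaller interval both sides are the same determinant, and below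
  it both follow the same operators.\<close>

lemma schubert_on_shrink_left:
  assumes "a < b" "w \<in> perms_on (a + 1) b"
  shows "schubert_on a b w = schubert_on (a + 1) b w"
  using assms(2)
proof (induction rule: perms_on_descend_induct)
  case reversal
  have "left_perm a b a = reversal (a + 1) b"
    by (auto simp: fun_eq_iff left_perm_def reversal_def)
  then show ?case
    using schubert_on_left_perm[of a b a] top_det_left_bot[OF assms(1)] assms(1) by simp
next
  case (descent w i)
  then have "w \<in> perms_on a b" using perms_on_mono[of a "a + 1" b b] by auto
  then show ?case
    using partial_x_schubert_on_descent[of w a b i] partial_x_schubert_on_descent[of w "a + 1" b i] descent
    by (simp add: comp_def)
qed

text \<open>The decreasing word with the value \<open>k\<close> moved to the last position: the
  reversal of [a, b] at k = a, that of [a, b - 1] at k = b. Steps exchange values instead of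
  positions, so the y-operators apply.\<close>

definition right_perm :: "int \<Rightarrow> int \<Rightarrow> int \<Rightarrow> int \<Rightarrow> int" where
  "right_perm a b k i = (if i < a \<or> b < i then i else if i = b then k
     else if a + b - i \<le> k then a + b - i - 1 else a + b - i)"

lemma right_perm_step: "a \<le> k \<Longrightarrow> k < b \<Longrightarrow> adj_transp k \<circ> right_perm a b k = right_perm a b (k + 1)"
  by (auto simp: fun_eq_iff right_perm_def adj_transp_eq)

lemma schubert_on_right_perm:
  assumes "a \<le> k" "k \<le> b"
  shows "right_perm a b k \<in> perms_on a b \<and> schubert_on a b (right_perm a b k) = top_det_right a b k"
  using assms
proof (induction k rule: int_ge_induct)
  case base
  have "right_perm a b a = reversal a b"
    by (auto simp: fun_eq_iff right_perm_def reversal_def)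
  then show ?case by (simp add: reversal_in_perms_on top_det_right_top)
next
  case (step k)
  then have k: "a \<le> k" "k < b" and IH: "right_perm a b k \<in> perms_on a b"
    "schubert_on a b (right_perm a b k) = top_det_right a b k"
    by auto
  have "right_perm a b k b = k" "right_perm a b k (a + b - k - 1) = k + 1"
    using k by (auto simp: right_perm_def)
  then have "partial_y k (schubert_on a b (right_perm a b k)) = schubert_on a b (adj_transp k \<circ> right_perm a b k)"
    using partial_y_schubert_on[OF IH(1) k, of b "a + b - k - 1"] k by simp
  then show ?case
    using perms_on_comp_adj(2)[OF IH(1) k] right_perm_step[OF k] top_det_right_step[OF k] IH(2) by simp
qed

lemma schubert_on_shrink_right:
  assumes "a < b" "w \<in> perms_on a (b - 1)"
  shows "schubert_on a b w = schubert_on a (b - 1) w"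
  using assms(2)
proof (induction rule: perms_on_descend_induct)
  case reversal
  have "right_perm a b b = reversal a (b - 1)"
    by (auto simp: fun_eq_iff right_perm_def reversal_def)
  then show ?case
    using schubert_on_right_perm[of a b b] top_det_right_bot[OF assms(1)] assms(1) by simp
next
  case (descent w i)
  then have "w \<in> perms_on a b" using perms_on_mono[of a a "b - 1" b] by auto
  then show ?case
    using partial_x_schubert_on_descent[of w a b i] partial_x_schubert_on_descent[of w a "b - 1" i] descent
    by (simp add: comp_def)
qed

lemma schubert_on_extend:
  assumes "a' \<le> a" "a \<le> b" "b \<le> b'" "w \<in> perms_on a b"
  shows "schubert_on a' b' w = schubert_on a b w"
proof -
  have 1: "schubert_on a' b w = schubert_on a b w"
    using assms(1)
  proof (induction a' rule: int_le_induct)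
    case (step i)
    have "w \<in> perms_on i b" using perms_on_mono[of i a b b] assms(4) step.hyps by auto
    then show ?case using schubert_on_shrink_left[of "i - 1" b w] step assms(2) by simp
  qed simp
  have "schubert_on a' b' w = schubert_on a' b w"
    using assms(3)
  proof (induction b' rule: int_ge_induct)
    case (step i)
    have "w \<in> perms_on a' i" using perms_on_mono[of a' a b i] assms step.hyps by auto
    then show ?case using schubert_on_shrink_right[of a' "i + 1" w] step assms by simp
  qed simp
  with 1 show ?thesis by simp
qed

definition schubert_Z :: "(int \<Rightarrow> int) \<Rightarrow> lring" where
  "schubert_Z w = (SOME f. \<exists>a b. a \<le> b \<and> w \<in> perms_on a b \<and> f = schubert_on a b w)"

text \<open>Two intervals are compared inside their common hull.\<close>

lemma schubert_Z_eq:
  assumes "a \<le> b" "w \<in> perms_on a b"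
  shows "schubert_Z w = schubert_on a b w"
proof -
  have "\<exists>f a b. a \<le> b \<and> w \<in> perms_on a b \<and> f = schubert_on a b w" using assms by blast
  then obtain a' b' where ab: "a' \<le> b'" "w \<in> perms_on a' b'" "schubert_Z w = schubert_on a' b' w"
    using someI_ex[of "\<lambda>f. \<exists>a b. a \<le> b \<and> w \<in> perms_on a b \<and> f = schubert_on a b w", folded schubert_Z_def]
    by blast
  then show ?thesis
    using schubert_on_extend[OF _ ab(1) _ ab(2), of "min a a'" "max b b'"]
      schubert_on_extend[OF _ assms(1) _ assms(2), of "min a a'" "max b b'"] by simp
qed

lemma schubert_Z_id: "schubert_Z id = 1"
  using schubert_Z_eq[OF order.refl id_in_perms_on[of 0 0]] schubert_on_reversal[of 0 0]
  by (simp add: reversal_single)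

lemma schubert_Z_reversal: "a \<le> b \<Longrightarrow> schubert_Z (reversal a b) = top_det a b"
  using schubert_Z_eq[OF _ reversal_in_perms_on] by simp

lemma partial_x_schubert_Z:
  assumes "w \<in> S_Z"
  shows "w (i + 1) < w i \<Longrightarrow> partial_x i (schubert_Z w) = schubert_Z (w \<circ> adj_transp i)"
    and "w i < w (i + 1) \<Longrightarrow> partial_x i (schubert_Z w) = 0"
proof -
  obtain a b where ab: "a \<le> i" "i + 1 \<le> b" "w \<in> perms_on a b"
    using S_Z_perms_on_large[OF assms] by blast
  then have "schubert_Z w = schubert_on a b w"
    "schubert_Z (w \<circ> adj_transp i) = schubert_on a b (w \<circ> adj_transp i)"
    using schubert_Z_eq[of a b] perms_on_comp_adj(1)[of w a b i] by simp_all
  then show "w (i + 1) < w i \<Longrightarrow> partial_x i (schubert_Z w) = schubert_Z (w \<circ> adj_transp i)"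
    "w i < w (i + 1) \<Longrightarrow> partial_x i (schubert_Z w) = 0"
    using partial_x_schubert_on_descent[OF ab(3), of i] partial_x_schubert_on_ascent[OF ab(3), of i] ab by simp_all
qed

lemma partial_y_schubert_Z:
  assumes "w \<in> S_Z"
  shows "perm_inv w (i + 1) < perm_inv w i \<Longrightarrow> partial_y i (schubert_Z w) = schubert_Z (adj_transp i \<circ> w)"
    and "perm_inv w i < perm_inv w (i + 1) \<Longrightarrow> partial_y i (schubert_Z w) = 0"
proof -
  obtain a b where ab: "a \<le> i" "i + 1 \<le> b" "w \<in> perms_on a b"
    using S_Z_perms_on_large[OF assms] by blast
  then have "schubert_Z w = schubert_on a b w"
    "schubert_Z (adj_transp i \<circ> w) = schubert_on a b (adj_transp i \<circ> w)"
    using schubert_Z_eq[of a b] perms_on_comp_adj(2)[of w a b i] by simp_all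
  moreover have "w (perm_inv w j) = j" for j
    using perms_on_bij[OF ab(3)] by (simp add: bij_is_surj surj_f_inv_f)
  ultimately show "perm_inv w (i + 1) < perm_inv w i \<Longrightarrow> partial_y i (schubert_Z w) = schubert_Z (adj_transp i \<circ> w)"
    "perm_inv w i < perm_inv w (i + 1) \<Longrightarrow> partial_y i (schubert_Z w) = 0"
    using partial_y_schubert_on[OF ab(3), of i "perm_inv w i" "perm_inv w (i + 1)"] ab by simp_all
qed

section \<open>Homogeneity\<close>

definition monom_degree :: "(lvar \<Rightarrow>\<^sub>0 nat) \<Rightarrow> nat" where
  "monom_degree m = (\<Sum>v \<in> Poly_Mapping.keys m. Poly_Mapping.lookup m v * var_degree v)"

lemma homogeneous_iff: "homogeneous d f \<longleftrightarrow> (\<forall>m \<in> Poly_Mapping.keys f. monom_degree m = d)"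
  by (simp add: homogeneous_def monom_degree_def)

lemma monom_degree_add: "monom_degree (m + n) = monom_degree m + monom_degree n"
proof -
  let ?S = "Poly_Mapping.keys m \<union> Poly_Mapping.keys n"
  have *: "monom_degree k = (\<Sum>v \<in> ?S. Poly_Mapping.lookup k v * var_degree v)" if "Poly_Mapping.keys k \<subseteq> ?S" for k
    unfolding monom_degree_def using that by (intro sum.mono_neutral_left) (auto simp: in_keys_iff)
  show ?thesis
    using *[of m] *[of n] *[OF Poly_Mapping.keys_add] by (simp add: lookup_add distrib_right sum.distrib)
qed

lemma homogeneous_0 [simp]: "homogeneous d 0"
  by (simp add: homogeneous_def)

lemma homogeneous_add: "homogeneous d f \<Longrightarrow> homogeneous d g \<Longrightarrow> homogeneous d (f + g)"
  using Poly_Mapping.keys_add[of f g] by (auto simp: homogeneous_iff)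

lemma homogeneous_minus: "homogeneous d f \<Longrightarrow> homogeneous d (- f)"
  by (auto simp: homogeneous_iff in_keys_iff)

lemma homogeneous_diff: "homogeneous d f \<Longrightarrow> homogeneous d g \<Longrightarrow> homogeneous d (f - g)"
  using homogeneous_add[of d f "- g"] homogeneous_minus[of d g] by simp

lemma homogeneous_mult: "homogeneous d f \<Longrightarrow> homogeneous e g \<Longrightarrow> homogeneous (d + e) (f * g)"
  using keys_mult[of f g] by (fastforce simp: homogeneous_iff monom_degree_add)

lemma homogeneous_single: "monom_degree m = d \<Longrightarrow> homogeneous d (Poly_Mapping.single m a)"
  by (auto simp: homogeneous_iff)

lemma homogeneous_of_int [simp]: "homogeneous 0 (of_int a)"
  using homogeneous_single[of 0 0 a] by (simp add: single_eq_prod_indet monom_degree_def)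

lemma homogeneous_1 [simp]: "homogeneous 0 1"
  using homogeneous_of_int[of 1] by simp

lemma homogeneous_indet [simp]: "homogeneous (var_degree v) (indet v)"
  unfolding indet_def by (rule homogeneous_single) (simp add: monom_degree_def)

lemma homogeneous_xx [simp]: "homogeneous (Suc 0) (xx i)" and homogeneous_yy [simp]: "homogeneous (Suc 0) (yy i)"
  using homogeneous_indet[of "XVar i"] homogeneous_indet[of "YVar i"] by (simp_all add: xx_def yy_def)

lemma homogeneous_sum: "(\<And>x. x \<in> A \<Longrightarrow> homogeneous d (f x)) \<Longrightarrow> homogeneous d (sum f A)"
  by (induction A rule: infinite_finite_induct) (auto intro: homogeneous_add)

lemma homogeneous_prod: "(\<And>x. x \<in> A \<Longrightarrow> homogeneous (d x) (f x)) \<Longrightarrow> homogeneous (sum d A) (prod f A)"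
  by (induction A rule: infinite_finite_induct) (auto intro: homogeneous_mult)

lemma homogeneous_power: "homogeneous d f \<Longrightarrow> homogeneous (k * d) (f ^ k)"
  by (induction k) (auto intro: homogeneous_mult)

text \<open>The degree is an argument of \<open>P\<close> and grows by one indeterminate at a time,
  which suits claims about how an operator changes degrees.\<close>

lemma homogeneous_induct [consumes 1, case_names zero of_int add mult]:
  assumes "homogeneous d f"
    and "\<And>d. P d 0" "\<And>a. P 0 (of_int a)"
    and add: "\<And>d f g. homogeneous d f \<Longrightarrow> homogeneous d g \<Longrightarrow> P d f \<Longrightarrow> P d g \<Longrightarrow> P d (f + g)"
    and mult: "\<And>d f v. homogeneous d f \<Longrightarrow> P d f \<Longrightarrow> P (d + var_degree v) (f * indet v)"
  shows "P d f"
proof -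
  define Q where "Q d f \<longleftrightarrow> homogeneous d f \<and> P d f" for d f
  have Q_mult: "Q (d + var_degree v) (f * indet v)" if "Q d f" for d f v
    using that mult by (auto simp: Q_def intro: homogeneous_mult)
  have Q_power: "Q (d + k * var_degree v) (f * indet v ^ k)" if "Q d f" for d f v k
  proof (induction k)
    case (Suc k)
    from Q_mult[OF this, of v] show ?case by (simp add: algebra_simps)
  qed (use that in simp)
  have Q_prod: "Q (\<Sum>v \<in> S. Poly_Mapping.lookup m v * var_degree v) (of_int a * (\<Prod>v \<in> S. indet v ^ Poly_Mapping.lookup m v))"
    if "finite S" for S m a
    using that
  proof (induction S rule: finite_induct)
    case empty
    show ?case using assms(3) by (simp add: Q_def)
  next
    case (insert v S)
    from Q_power[OF insert.IH, of "Poly_Mapping.lookup m v" v] insert.hyps show ?case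
      by (simp add: mult_ac add_ac)
  qed
  have single: "Q (monom_degree m) (Poly_Mapping.single m a)" for m a
    using Q_prod[OF finite_keys, of m] by (simp add: single_eq_prod_indet monom_degree_def)
  have sum: "Q d (\<Sum>m \<in> S. Poly_Mapping.single m (Poly_Mapping.lookup f m))"
    if "finite S" "S \<subseteq> Poly_Mapping.keys f" for S
    using that
  proof (induction S rule: finite_induct)
    case empty
    show ?case using assms(2) by (simp add: Q_def)
  next
    case (insert m S)
    then have "monom_degree m = d" using assms(1) by (auto simp: homogeneous_iff)
    with insert single[of m] show ?case
      by (auto simp: Q_def intro: add homogeneous_add)
  qed
  have "f = (\<Sum>m \<in> Poly_Mapping.keys f. Poly_Mapping.single m (Poly_Mapping.lookup f m))"
    by (rule poly_mapping_eqI) (simp add: lookup_sum lookup_single when_def in_keys_iff)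
  then show ?thesis using sum[OF finite_keys order.refl] by (simp add: Q_def)
qed

lemma homogeneous_lring_eval:
  assumes "homogeneous d f" and "\<And>v. homogeneous (var_degree v) (\<sigma> v)"
  shows "homogeneous d (lring_eval \<sigma> f)"
  using assms(1)
  by (induction rule: homogeneous_induct)
    (auto simp: lring_eval_zero lring_eval_add lring_eval_mult lring_eval.hom_of_int assms(2)
      intro: homogeneous_add homogeneous_mult)

definition homogeneous_series :: "lring fps \<Rightarrow> bool" where
  "homogeneous_series a \<longleftrightarrow> (\<forall>n. homogeneous n (fps_nth a n))"

lemma homogeneous_series_mult:
  assumes "homogeneous_series a" "homogeneous_series b"
  shows "homogeneous_series (a * b)"
  unfolding homogeneous_series_def fps_mult_nth
proof (intro allI homogeneous_sum)
  fix n i :: nat assume "i \<in> {0..n}"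
  then show "homogeneous n (fps_nth a i * fps_nth b (n - i))"
    using homogeneous_mult[of i "fps_nth a i" "n - i" "fps_nth b (n - i)"] assms
    by (simp add: homogeneous_series_def)
qed

lemma homogeneous_series_1: "homogeneous_series 1"
  by (simp add: homogeneous_series_def)

lemma homogeneous_series_lin:
  assumes "homogeneous (Suc 0) y"
  shows "homogeneous_series (lin_series y)" "homogeneous_series (inv_lin_series y)"
  using assms homogeneous_power[OF homogeneous_minus[OF assms]]
  by (auto simp: homogeneous_series_def lin_series_def inv_lin_series_def fps_X_def)

lemma homogeneous_series_prod:
  "(\<And>x. x \<in> A \<Longrightarrow> homogeneous_series (f x)) \<Longrightarrow> homogeneous_series (prod f A)"
  by (induction A rule: infinite_finite_induct) (auto intro: homogeneous_series_mult homogeneous_series_1)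

lemma homogeneous_series_c: "homogeneous_series c_series"
  unfolding homogeneous_series_def
proof
  fix n
  show "homogeneous n (fps_nth c_series n)"
    using homogeneous_indet[of "CVar (n - 1)"] by (cases n) (simp_all add: c_series_def cc_def)
qed

lemmas homogeneous_series_intros = homogeneous_series_mult homogeneous_series_lin homogeneous_series_prod
  homogeneous_series_c homogeneous_series_1 homogeneous_xx homogeneous_yy homogeneous_minus

lemma homogeneous_series_c_flag: "homogeneous_series (c_flag p q)"
  unfolding c_flag_def x_series_def y_series_def
  by (auto intro!: homogeneous_series_intros)

lemma homogeneous_flag_coeff: "homogeneous (nat k) (flag_coeff p q k)"
  using homogeneous_series_c_flag by (auto simp: flag_coeff_def homogeneous_series_def)

lemma homogeneous_lring_map:
  assumes "homogeneous_series a" "\<And>i. homogeneous (Suc 0) (\<xi> i)" "\<And>i. homogeneous (Suc 0) (\<eta> i)" "homogeneous d f"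
  shows "homogeneous d (lring_map a \<xi> \<eta> f)"
  unfolding lring_map_eq_lring_eval
proof (rule homogeneous_lring_eval[OF assms(4)])
  fix v
  show "homogeneous (var_degree v) (case v of CVar k \<Rightarrow> fps_nth a (Suc k) | XVar i \<Rightarrow> \<xi> i | YVar i \<Rightarrow> \<eta> i)"
    using assms(1-3) by (cases v) (auto simp: homogeneous_series_def)
qed

lemma homogeneous_sx: "homogeneous d f \<Longrightarrow> homogeneous d (sx i f)"
  unfolding sx_def by (erule homogeneous_lring_map[rotated 3]) (auto intro!: homogeneous_series_intros)

lemma homogeneous_shift_ring: "homogeneous d f \<Longrightarrow> homogeneous d (shift_ring m f)"
  unfolding shift_ring_def by (erule homogeneous_lring_map[rotated 3]) (auto intro!: homogeneous_series_intros)

lemma homogeneous_set_c_zero: "homogeneous d f \<Longrightarrow> homogeneous d (set_c_zero f)"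
  unfolding set_c_zero_def by (erule homogeneous_lring_map[rotated 3]) (auto intro!: homogeneous_series_intros)

section \<open>Degrees of divided differences and of the determinants\<close>

lemma homogeneous_partial_x_indet: "homogeneous (var_degree v - 1) (partial_x i (indet v))"
proof (cases v)
  case (CVar k)
  then have v: "indet v = flag_coeff 0 0 (int (Suc k))"
    by (simp add: flag_coeff_def c_series_def cc_def nat_add_distrib)
  show ?thesis
  proof (cases "i = 0")
    case True
    then show ?thesis
      using homogeneous_flag_coeff[of "int k" 1 0] partial_x_flag_coeff[of 0 0 "int (Suc k)"] v CVar by simp
  next
    case False
    then have "sx i (indet v) = indet v" unfolding v by (intro sx_flag_coeff) simp
    then have "partial_x i (indet v) = 0" by (simp add: partial_x_eq_0_iff)
    then show ?thesis by simp
  qed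
next
  case (XVar j)
  consider "j = i" | "j = i + 1" | "j \<noteq> i" "j \<noteq> i + 1" by blast
  then have "partial_x i (xx j) \<in> {1, - 1, 0}"
  proof cases
    case 1
    then have "partial_x i (xx j) = 1" by (intro partial_x_eqI) simp
    then show ?thesis by simp
  next
    case 2
    then have "partial_x i (xx j) = - 1" by (intro partial_x_eqI) simp
    then show ?thesis by simp
  next
    case 3
    then have "partial_x i (xx j) = 0" by (simp add: partial_x_eq_0_iff adj_transp_other)
    then show ?thesis by simp
  qed
  then show ?thesis using XVar homogeneous_of_int[of "-1"] by (auto simp flip: xx_def)
next
  case (YVar j)
  then have "partial_x i (indet v) = 0" by (simp add: partial_x_eq_0_iff flip: yy_def)
  then show ?thesis by simp
qed

lemma homogeneous_partial_x:
  assumes "homogeneous d f"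
  shows "homogeneous (d - 1) (partial_x i f)"
proof -
  \<comment> \<open>Strengthened at d = 0, where d - 1 is truncated: unless
    \<open>partial_x i f\<close> vanishes there, the first term of the product rule would have the
    wrong degree.\<close>
  have "homogeneous (d - 1) (partial_x i f) \<and> (d = 0 \<longrightarrow> partial_x i f = 0)"
    using assms
  proof (induction rule: homogeneous_induct)
    case (zero d)
    have "partial_x i 0 = 0" by (simp add: partial_x_eq_0_iff)
    then show ?case by simp
  next
    case (of_int a)
    have "partial_x i (of_int a) = 0" by (simp add: partial_x_eq_0_iff sx.hom_of_int)
    then show ?case by simp
  next
    case (add d f g)
    then show ?case by (auto simp: partial_x_add intro: homogeneous_add)
  next
    case (mult d f v)
    have v: "var_degree v \<ge> 1" by (cases v) auto
    have "homogeneous (d + var_degree v - 1) (partial_x i f * indet v)"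
      using mult.IH homogeneous_mult[of "d - 1" "partial_x i f" "var_degree v" "indet v"] by (cases d) auto
    moreover have "homogeneous (d + var_degree v - 1) (sx i f * partial_x i (indet v))"
      using homogeneous_mult[OF homogeneous_sx[OF mult.hyps, of i] homogeneous_partial_x_indet[of v i]] v by simp
    ultimately show ?case using v by (auto simp: partial_x_mult intro: homogeneous_add)
  qed
  then show ?thesis by simp
qed

text \<open>All Leibniz terms have the same total degree because column indices are only permuted.
  Terms with a negative degree are split off first: they are 0, whereas \<open>nat\<close> would
  falsify the sum.\<close>

lemma homogeneous_flag_det:
  assumes "int d = (\<Sum>r<n. l r + int r)"
  shows "homogeneous d (flag_det n p q l)"
proof -
  have "homogeneous d (signof \<pi> * (\<Prod>i<n. flag_coeff (p i) (q i) (l i + int (\<pi> i))))"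
    if \<pi>: "\<pi> permutes {..<n}" for \<pi>
  proof (cases "\<exists>i<n. l i + int (\<pi> i) < 0")
    case True
    then have "(\<Prod>i<n. flag_coeff (p i) (q i) (l i + int (\<pi> i))) = 0"
      by (intro prod_zero) (auto intro!: bexI simp: flag_coeff_neg)
    then show ?thesis by (simp only: mult_zero_right homogeneous_0)
  next
    case False
    have "(\<Sum>i<n. int (\<pi> i)) = (\<Sum>i<n. int i)"
      using sum.permute[OF \<pi>, of int] by (simp add: comp_def)
    then have "int d = (\<Sum>i<n. l i + int (\<pi> i))"
      using assms by (simp add: sum.distrib)
    also have "\<dots> = int (\<Sum>i<n. nat (l i + int (\<pi> i)))"
      unfolding of_nat_sum using False by (intro sum.cong) auto
    finally have "d = (\<Sum>i<n. nat (l i + int (\<pi> i)))" by (simp only: of_nat_eq_iff)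
    then have "homogeneous d (\<Prod>i<n. flag_coeff (p i) (q i) (l i + int (\<pi> i)))"
      by (simp add: homogeneous_prod homogeneous_flag_coeff)
    then show ?thesis
      using homogeneous_minus by (auto simp: sign_def)
  qed
  then show ?thesis
    unfolding flag_det_def
    by (subst det_def') (auto intro!: homogeneous_sum simp: atLeast0LessThan permutes_in_image)
qed

text \<open>All pairs of the interval are counted by their left end, so that the summands match the
  diagonal degrees of the determinant.\<close>

lemma perm_length_reversal: "perm_length (reversal a b) = (\<Sum>r<nat (b - a). nat (b - a) - r)"
proof -
  let ?n = "nat (b - a)"
  have "inversions (reversal a b) \<subseteq> {a..b} \<times> {a..b}"
    by (rule inversions_subset) (rule reversal_in_perms_on)
  then have "inversions (reversal a b) = {(i, j). a \<le> i \<and> i < j \<and> j \<le> b}"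
    by (auto simp: inversions_def reversal_def)
  moreover have "bij_betw (\<lambda>(r, k). (a + int r, a + int r + 1 + int k)) (SIGMA r:{..<?n}. {..<?n - r})
      {(i, j). a \<le> i \<and> i < j \<and> j \<le> b}"
    by (rule bij_betw_byWitness[where f' = "\<lambda>(i, j). (nat (i - a), nat (j - i - 1))"]) auto
  ultimately show ?thesis
    by (simp add: perm_length_eq_card flip: bij_betw_same_card)
qed

lemma homogeneous_schubert_on:
  assumes "w \<in> perms_on a b"
  shows "homogeneous (perm_length w) (schubert_on a b w)"
  using assms
proof (induction rule: perms_on_descend_induct)
  case reversal
  have "int (perm_length (reversal a b)) = (\<Sum>r<nat (b - a). b - a - 2 * int r + int r)"
    unfolding perm_length_reversal of_nat_sum by (rule sum.cong) auto
  then show ?case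
    unfolding schubert_on_reversal top_det_def by (rule homogeneous_flag_det)
next
  case (descent w i)
  have "w \<in> S_Z" using descent.hyps(1) S_Z_iff_perms_on by blast
  then have "perm_length (w \<circ> adj_transp i) = perm_length w - 1"
    using perm_length_descent[of w i] descent.hyps by simp
  then show ?case
    using homogeneous_partial_x[OF descent.IH, of i] partial_x_schubert_on_descent[OF descent.hyps]
    by (simp add: comp_def)
qed

lemma homogeneous_schubert_Z:
  assumes "w \<in> S_Z"
  shows "homogeneous (perm_length w) (schubert_Z w)"
proof -
  obtain a b where "a \<le> 0" "0 \<le> b" "w \<in> perms_on a b"
    using S_Z_perms_on_large[OF assms] by blast
  then show ?thesis using schubert_Z_eq[of a b w] homogeneous_schubert_on by simp
qed

section \<open>Injectivity of the specialisations\<close>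

text \<open>The monomials sharing one exponent of \<open>v\<close> have a nonvanishing sum at some
  choice of the other variables; the whole sum is then a nonzero polynomial in \<open>v\<close>,
  with finitely many roots.\<close>

lemma separated_monomials_nonvanishing:
  fixes c :: "'m \<Rightarrow> complex" and e :: "'m \<Rightarrow> 'v \<Rightarrow> nat"
  assumes "finite V" "finite M" "M \<noteq> {}"
    and "\<And>m m'. m \<in> M \<Longrightarrow> m' \<in> M \<Longrightarrow> m \<noteq> m' \<Longrightarrow> \<exists>v\<in>V. e m v \<noteq> e m' v"
    and "\<And>m. m \<in> M \<Longrightarrow> c m \<noteq> 0"
  shows "\<exists>p. (\<Sum>m\<in>M. c m * (\<Prod>v\<in>V. p v ^ e m v)) \<noteq> 0"
  using assms
proof (induction V arbitrary: M rule: finite_induct)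
  case empty
  then obtain m where "m \<in> M" by blast
  with empty.prems(3) have "M = {m}" by blast
  then show ?case using empty.prems(4) by simp
next
  case (insert v V)
  then obtain m0 where m0: "m0 \<in> M" by blast
  define k where "k = e m0 v"
  define N where "N = {m \<in> M. e m v = k}"
  have "finite N" "N \<noteq> {}" using insert.prems(1) m0 by (auto simp: N_def k_def)
  moreover have "\<exists>u\<in>V. e m u \<noteq> e m' u" if "m \<in> N" "m' \<in> N" "m \<noteq> m'" for m m'
    using insert.prems(3)[of m m'] that by (auto simp: N_def)
  moreover have "c m \<noteq> 0" if "m \<in> N" for m using insert.prems(4) that by (auto simp: N_def)
  ultimately obtain p where p: "(\<Sum>m\<in>N. c m * (\<Prod>u\<in>V. p u ^ e m u)) \<noteq> 0"
    using insert.IH by blast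
  define Q where "Q = (\<Sum>m\<in>M. monom (c m * (\<Prod>u\<in>V. p u ^ e m u)) (e m v))"
  have "coeff Q k = (\<Sum>m\<in>M. if e m v = k then c m * (\<Prod>u\<in>V. p u ^ e m u) else 0)"
    by (simp add: Q_def coeff_sum)
  also have "\<dots> = (\<Sum>m\<in>N. c m * (\<Prod>u\<in>V. p u ^ e m u))"
    unfolding N_def using insert.prems(1) by (simp add: sum.inter_filter)
  finally have "Q \<noteq> 0" using p by auto
  then have "finite {z. poly Q z = 0}" by (rule poly_roots_finite)
  then obtain z where z: "poly Q z \<noteq> 0"
    using ex_new_if_finite[OF infinite_UNIV_char_0[where 'a = complex]] by blast
  have "(\<Prod>u\<in>V. (p(v := z)) u ^ e m u) = (\<Prod>u\<in>V. p u ^ e m u)" for m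
    using insert.hyps(2) by (intro prod.cong) auto
  then have "poly Q z = (\<Sum>m\<in>M. c m * (\<Prod>u\<in>insert v V. (p(v := z)) u ^ e m u))"
    using insert.hyps by (simp add: Q_def poly_sum poly_monom mult_ac)
  with z show ?case by metis
qed

definition variables :: "lring \<Rightarrow> lvar set" where
  "variables f = (\<Union>m \<in> Poly_Mapping.keys f. Poly_Mapping.keys m)"

lemma finite_variables: "finite (variables f)"
  by (simp add: variables_def)

lemma lring_eval_cong:
  assumes "\<And>v. v \<in> variables f \<Longrightarrow> p v = q v"
  shows "lring_eval p f = lring_eval q f"
  unfolding lring_eval_def using assms
  by (intro sum.cong prod.cong arg_cong2[where f = times] refl arg_cong2[where f = power])
    (auto simp: variables_def)

lemma ex_nonzero_complex_eval:
  assumes "f \<noteq> 0"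
  shows "\<exists>p :: lvar \<Rightarrow> complex. lring_eval p f \<noteq> 0"
proof -
  have "\<exists>p. (\<Sum>m\<in>Poly_Mapping.keys f. complex_of_int (Poly_Mapping.lookup f m) *
      (\<Prod>v\<in>variables f. p v ^ Poly_Mapping.lookup m v)) \<noteq> 0"
  proof (rule separated_monomials_nonvanishing[OF finite_variables finite_keys])
    show "Poly_Mapping.keys f \<noteq> {}" using assms by simp
    fix m m' assume m: "m \<in> Poly_Mapping.keys f" "m' \<in> Poly_Mapping.keys f" "m \<noteq> m'"
    then obtain v where v: "Poly_Mapping.lookup m v \<noteq> Poly_Mapping.lookup m' v"
      by (meson poly_mapping_eqI)
    then have "v \<in> Poly_Mapping.keys m \<or> v \<in> Poly_Mapping.keys m'" by (auto simp: in_keys_iff)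
    then have "v \<in> variables f" using m by (auto simp: variables_def)
    with v show "\<exists>v\<in>variables f. Poly_Mapping.lookup m v \<noteq> Poly_Mapping.lookup m' v" by blast
  qed (simp add: in_keys_iff)
  then obtain p :: "lvar \<Rightarrow> complex" where "(\<Sum>m\<in>Poly_Mapping.keys f. complex_of_int (Poly_Mapping.lookup f m) *
      (\<Prod>v\<in>variables f. p v ^ Poly_Mapping.lookup m v)) \<noteq> 0" by blast
  moreover have "(\<Prod>v\<in>Poly_Mapping.keys m. p v ^ Poly_Mapping.lookup m v) = (\<Prod>v\<in>variables f. p v ^ Poly_Mapping.lookup m v)"
    if "m \<in> Poly_Mapping.keys f" for m
    using that by (intro monom_prod_superset finite_variables) (auto simp: variables_def)
  ultimately have "lring_eval p f \<noteq> 0" by (simp add: lring_eval_def)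
  then show ?thesis by blast
qed

text \<open>The constant term 1 excludes the root 0, so a root z gives a factor 1 - t/z; trivial
  factors pad the product to length \<open>n\<close>.\<close>

lemma complex_poly_linear_factors:
  fixes P :: "complex poly"
  assumes "poly P 0 = 1" "degree P \<le> n"
  shows "\<exists>r. P = (\<Prod>i<n. [:1, r i:])"
  using assms
proof (induction n arbitrary: P)
  case 0
  then have "P = 1" by (auto elim!: degree_eq_zeroE)
  then show ?case by simp
next
  case (Suc n)
  show ?case
  proof (cases "degree P = 0")
    case True
    then obtain r where "P = (\<Prod>i<n. [:1, r i:])" using Suc by force
    then have "P = (\<Prod>i<Suc n. [:1, (r(n := 0)) i:])"
      by (simp add: pCons_one)
    then show ?thesis by blast
  next
    case False
    then obtain z where z: "poly P z = 0"
      using fundamental_theorem_of_algebra[of P] by (auto simp: constant_degree)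
    then have "z \<noteq> 0" using Suc.prems(1) by auto
    obtain Q where Q: "P = [:- z, 1:] * Q" using z by (auto simp: poly_eq_0_iff_dvd)
    have PQ: "P = [:1, - inverse z:] * smult (- z) Q"
      using \<open>z \<noteq> 0\<close> by (simp add: Q algebra_simps)
    have "P \<noteq> 0" using Suc.prems(1) by auto
    then have "degree P = Suc (degree Q)" unfolding Q by (subst degree_mult_eq) auto
    then have "degree (smult (- z) Q) \<le> n" using Suc.prems(2) by simp
    moreover have "poly (smult (- z) Q) 0 = 1" using Suc.prems(1) Q by simp
    ultimately obtain r where "smult (- z) Q = (\<Prod>i<n. [:1, r i:])" using Suc.IH by blast
    then have "P = (\<Prod>i<Suc n. [:1, (r(n := - inverse z)) i:])"
      unfolding PQ by (simp add: mult.commute)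
    then show ?thesis by blast
  qed
qed

lemma fps_linear_factors_upto:
  fixes d :: "complex fps"
  assumes "fps_nth d 0 = 1"
  shows "\<exists>r. \<forall>k\<le>n. fps_nth (\<Prod>i<n. 1 + fps_const (r i) * fps_X) k = fps_nth d k"
proof -
  define P where "P = (\<Sum>k\<le>n. monom (fps_nth d k) k)"
  have coeff: "coeff P k = (if k \<le> n then fps_nth d k else 0)" for k
    by (simp add: P_def coeff_sum)
  have "degree P \<le> n" by (rule degree_le) (simp add: coeff)
  moreover have "poly P 0 = 1" using assms by (simp add: poly_0_coeff_0 coeff)
  ultimately obtain r where r: "P = (\<Prod>i<n. [:1, r i:])" using complex_poly_linear_factors by blast
  have lin: "fps_of_poly [:1, a:] = 1 + fps_const a * fps_X" for a :: complex
    by (simp add: fps_eq_iff fps_X_def fps_of_poly_nth coeff_pCons split: nat.split)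
  then have "fps_of_poly P = (\<Prod>i<n. 1 + fps_const (r i) * fps_X)"
    by (simp add: r fps_of_poly_prod lin)
  then have "\<forall>k\<le>n. fps_nth (\<Prod>i<n. 1 + fps_const (r i) * fps_X) k = fps_nth d k"
    by (metis coeff fps_of_poly_nth)
  then show ?thesis by blast
qed

lemma fps_mult_nth_cong:
  assumes "\<And>k. k \<le> n \<Longrightarrow> fps_nth a k = fps_nth b k" "k \<le> n"
  shows "fps_nth (a * c) k = fps_nth (b * c) k"
  using assms by (simp add: fps_mult_nth)

lemma series_map_linear:
  assumes "comm_ring_hom (h :: lring \<Rightarrow> complex)"
  shows "series_map h (lin_series a) = 1 + fps_const (h a) * fps_X"
    and "series_map h (inv_lin_series a) = Abs_fps (\<lambda>n. (- h a) ^ n)"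
proof -
  interpret h: comm_ring_hom h by fact
  show "series_map h (lin_series a) = 1 + fps_const (h a) * fps_X"
    by (simp add: fps_eq_iff lin_series_def fps_X_def h.hom_add h.hom_mult)
  show "series_map h (inv_lin_series a) = Abs_fps (\<lambda>n. (- h a) ^ n)"
    by (simp add: fps_eq_iff inv_lin_series_def h.hom_power h.hom_uminus)
qed

text \<open>The point \<open>p\<close> at which \<open>f\<close> does not vanish is realised by a specialisation at level \<open>m\<close>: the
  variables of index at least \<open>m - K\<close> carry the coordinates of \<open>p\<close>, and the remaining \<open>y\<^sub>i\<close> are free
  to produce any prescribed values of finitely many \<open>c\<^sub>k\<close>, since complex polynomials split.\<close>

lemma shift_set_c_zero_injective:
  assumes zero: "\<And>m. m \<ge> M \<Longrightarrow> set_c_zero (shift_ring m f) = 0"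
  shows "f = 0"
proof (rule ccontr)
  assume "f \<noteq> 0"
  then obtain p :: "lvar \<Rightarrow> complex" where p: "lring_eval p f \<noteq> 0"
    using ex_nonzero_complex_eval by blast
  define size where "size v = (case v of CVar k \<Rightarrow> Suc k | XVar i \<Rightarrow> nat \<bar>i\<bar> | YVar i \<Rightarrow> nat \<bar>i\<bar>)" for v
  define K where "K = Max (insert 0 (size ` variables f))"
  have K: "size v \<le> K" if "v \<in> variables f" for v
    unfolding K_def using that finite_variables by (intro Max_ge) auto
  \<comment> \<open>Matching c_1, ..., c_K takes at least K free y-variables, and the summand
    \<open>nat M\<close> forces m \<ge> M. The choice of \<open>m\<close> below puts every shifted
    index i + m with \<bar>i\<bar> \<le> K above the R free ones.\<close>
  define R where "R = K + nat M"
  define m where "m = int R + int K + 1"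
  define qx where "qx i = (if i \<ge> int R + 1 then p (XVar (i - m)) else 0)" for i
  \<comment> \<open>\<open>G\<close> is the share of the prescribed variables in the image of
    \<open>c\<close>, the low x_i being set to 0; the free y_j have to supply
    \<open>cp * inverse G\<close> up to degree \<open>R\<close>.\<close>
  define G where "G = (\<Prod>i\<in>{1..m}. Abs_fps (\<lambda>n. qx i ^ n)) *
    (\<Prod>i\<in>{int R + 1..m}. 1 + fps_const (p (YVar (i - m))) * fps_X)"
  define cp where "cp = Abs_fps (\<lambda>n. case n of 0 \<Rightarrow> 1 | Suc k \<Rightarrow> p (CVar k))"
  have nth0: "fps_nth (prod g A) 0 = 1" if "\<And>i. i \<in> A \<Longrightarrow> fps_nth (g i) 0 = 1" for g :: "int \<Rightarrow> complex fps" and A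
    using that by (induction A rule: infinite_finite_induct) simp_all
  have G0: "fps_nth G 0 = 1" by (simp add: G_def nth0)
  then have "fps_nth (cp * inverse G) 0 = 1" by (simp add: cp_def)
  then obtain r where r: "\<And>k. k \<le> R \<Longrightarrow>
      fps_nth (\<Prod>i<R. 1 + fps_const (r i) * fps_X) k = fps_nth (cp * inverse G) k"
    using fps_linear_factors_upto by blast
  define q where "q v = (case v of CVar k \<Rightarrow> 0 | XVar i \<Rightarrow> qx i | YVar i \<Rightarrow>
    if i \<ge> int R + 1 then p (YVar (i - m)) else r (nat (i - 1)))" for v
  define h where "h g = lring_eval q (set_c_zero (shift_ring m g))" for g
  have hom_h: "comm_ring_hom h" unfolding h_def
    by (rule comm_ring_hom_compose[OF lring_eval.comm_ring_hom_axioms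
          comm_ring_hom_compose[OF set_c_zero.comm_ring_hom_axioms shift_ring.comm_ring_hom_axioms]])
  have qxy: "lring_eval q (xx i) = qx i" "lring_eval q (yy i) = (if i \<ge> int R + 1 then p (YVar (i - m)) else r (nat (i - 1)))" for i
    by (simp_all add: xx_def yy_def q_def)
  have "series_map h c_series = series_map (lring_eval q) (x_series m * y_series m)"
  proof -
    have "series_map h c_series = series_map (lring_eval q) (series_map set_c_zero (series_map (shift_ring m) c_series))"
      unfolding h_def by (simp only: series_map_compose)
    moreover have "series_map (shift_ring m) c_series = c_flag m m"
      using shift_ring_c_flag[of m 0 0] by (simp add: m_def)
    ultimately show ?thesis by (simp only: set_c_zero_c_flag)
  qed
  also have "\<dots> = series_map (lring_eval q) (x_series m) * series_map (lring_eval q) (y_series m)"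
    by (rule lring_eval.series_map_mult)
  also have "series_map (lring_eval q) (x_series m) = (\<Prod>i\<in>{1..m}. Abs_fps (\<lambda>n. qx i ^ n))"
    (is "_ = ?x")
  proof -
    interpret E: comm_ring_hom "series_map (lring_eval q)" by (rule lring_eval.series_map_hom)
    have "x_series m = (\<Prod>i\<in>{1..m}. inv_lin_series (- xx i))" by (simp add: x_series_def m_def)
    then show ?thesis
      by (simp add: E.hom_prod series_map_linear(2)[OF lring_eval.comm_ring_hom_axioms] lring_eval.hom_uminus qxy)
  qed
  also have "series_map (lring_eval q) (y_series m) = (\<Prod>i<R. 1 + fps_const (r i) * fps_X) *
      (\<Prod>i\<in>{int R + 1..m}. 1 + fps_const (p (YVar (i - m))) * fps_X)" (is "_ = ?r * ?y")
  proof -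
    interpret E: comm_ring_hom "series_map (lring_eval q)" by (rule lring_eval.series_map_hom)
    have "y_series m = (\<Prod>i\<in>{1..m}. lin_series (yy i))" by (simp add: y_series_def m_def)
    also have "{1..m} = {1..int R} \<union> {int R + 1..m}" by (auto simp: m_def)
    also have "(\<Prod>i\<in>{1..int R} \<union> {int R + 1..m}. lin_series (yy i)) =
        (\<Prod>i\<in>{1..int R}. lin_series (yy i)) * (\<Prod>i\<in>{int R + 1..m}. lin_series (yy i))"
      by (rule prod.union_disjoint) auto
    finally have "series_map (lring_eval q) (y_series m) =
        (\<Prod>i\<in>{1..int R}. 1 + fps_const (lring_eval q (yy i)) * fps_X) *
        (\<Prod>i\<in>{int R + 1..m}. 1 + fps_const (lring_eval q (yy i)) * fps_X)"
      by (simp only: E.hom_prod E.hom_mult series_map_linear(1)[OF lring_eval.comm_ring_hom_axioms])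
    moreover have "(\<Prod>i\<in>{1..int R}. 1 + fps_const (lring_eval q (yy i)) * fps_X) = ?r"
      unfolding prod_int_interval_nat by (intro prod.cong) (simp_all add: qxy)
    moreover have "(\<Prod>i\<in>{int R + 1..m}. 1 + fps_const (lring_eval q (yy i)) * fps_X) = ?y"
      by (intro prod.cong) (simp_all add: qxy)
    ultimately show ?thesis by simp
  qed
  finally have hc: "series_map h c_series = ?r * G" by (simp add: G_def mult_ac)
  have "fps_nth (?r * G) k = fps_nth cp k" if "k \<le> R" for k
  proof -
    have "fps_nth (?r * G) k = fps_nth (cp * inverse G * G) k"
      by (rule fps_mult_nth_cong[OF r that])
    then show ?thesis using G0 by (simp add: mult.assoc inverse_mult_eq_1)
  qed
  then have hcoeff: "h (cc k) = fps_nth cp k" if "k \<le> R" for k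
    using arg_cong[OF hc, of "\<lambda>a. fps_nth a k"] that by (simp add: c_series_def)
  have "h (indet v) = p v" if v: "v \<in> variables f" for v
  proof (cases v)
    case (CVar k)
    then have "Suc k \<le> R" using K[OF v] by (simp add: size_def R_def)
    then show ?thesis using hcoeff[of "Suc k"] CVar by (simp add: cc_def cp_def)
  next
    case (XVar i)
    then have "nat \<bar>i\<bar> \<le> K" using K[OF v] by (simp add: size_def)
    then have "i + m \<ge> int R + 1" by (simp add: m_def)
    then show ?thesis using XVar by (simp add: h_def qxy qx_def flip: xx_def)
  next
    case (YVar i)
    then have "nat \<bar>i\<bar> \<le> K" using K[OF v] by (simp add: size_def)
    then have "i + m \<ge> int R + 1" by (simp add: m_def)
    then show ?thesis using YVar by (simp add: h_def qxy flip: yy_def)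
  qed
  then have "lring_eval (\<lambda>v. h (indet v)) f = lring_eval p f" by (rule lring_eval_cong)
  moreover have "h f = lring_eval (\<lambda>v. h (indet v)) f"
    by (rule lring_hom_ext_indet[OF hom_h lring_eval.comm_ring_hom_axioms]) simp
  moreover have "m \<ge> M" by (simp add: m_def R_def)
  then have "h f = 0" using zero[of m] by (simp add: h_def lring_eval_zero)
  ultimately show False using p by simp
qed

section \<open>Invariants\<close>

definition kill :: "lvar \<Rightarrow> lring \<Rightarrow> lring" where
  "kill v = lring_eval (\<lambda>u. if u = v then 0 else indet u)"

lemma comm_ring_hom_kill: "comm_ring_hom (kill v)"
  unfolding kill_def by (rule lring_eval.comm_ring_hom_axioms)

lemma kill_indet [simp]: "kill v (indet u) = (if u = v then 0 else indet u)"
  by (simp add: kill_def)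

lemma lring_eval_indet_id: "lring_eval indet f = f"
  by (rule lring_hom_ext_indet[OF lring_eval.comm_ring_hom_axioms comm_ring_hom_id]) simp

lemma kill_eq_self_if_not_variable:
  assumes "v \<notin> variables f"
  shows "kill v f = f"
proof -
  have "kill v f = lring_eval indet f"
    unfolding kill_def using assms by (intro lring_eval_cong) auto
  then show ?thesis by (simp add: lring_eval_indet_id)
qed

text \<open>Finitely many variables occur in \<open>f\<close>, and killing them one after another is
  evaluation at 0.\<close>

lemma lring_eval_0_eq_self:
  assumes "\<And>v. kill v f = f"
  shows "lring_eval (\<lambda>_. 0) f = f"
proof -
  have "lring_eval (\<lambda>u. if u \<in> V then 0 else indet u) f = f" if "finite V" for V
    using that
  proof (induction V rule: finite_induct)
    case empty
    show ?case by (simp add: lring_eval_indet_id)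
  next
    case (insert v V)
    have "lring_eval (\<lambda>u. if u \<in> insert v V then 0 else indet u) f =
        kill v (lring_eval (\<lambda>u. if u \<in> V then 0 else indet u) f)"
      by (rule lring_hom_ext_indet[OF lring_eval.comm_ring_hom_axioms
            comm_ring_hom_compose[OF comm_ring_hom_kill lring_eval.comm_ring_hom_axioms]])
        (simp add: kill_def lring_eval_zero)
    then show ?case by (simp add: insert.IH assms)
  qed
  from this[OF finite_variables[of f]] show ?thesis
    using lring_eval_cong[of f "\<lambda>_. 0" "\<lambda>u. if u \<in> variables f then 0 else indet u"] by simp
qed

lemma lring_eval_0_homogeneous:
  assumes "homogeneous d f" "d > 0"
  shows "lring_eval (\<lambda>_. 0 :: lring) f = 0"
proof -
  have "d > 0 \<longrightarrow> lring_eval (\<lambda>_. 0 :: lring) f = 0"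
    using assms(1) by (induction rule: homogeneous_induct)
      (auto simp: lring_eval_zero lring_eval_add lring_eval_mult)
  then show ?thesis using assms(2) by simp
qed

text \<open>The symmetry trades \<open>T k\<close> for a variable \<open>T j\<close> with \<open>\<bar>j\<bar>\<close> so large that it does not occur in \<open>f\<close>.\<close>

lemma kill_of_symmetric:
  fixes T :: "int \<Rightarrow> lvar"
  assumes "inj T"
    and s: "\<And>k. k \<noteq> 0 \<Longrightarrow> s k f = f"
    and left: "\<And>k. k \<noteq> 0 \<Longrightarrow> kill (T k) (s k f) = s k (kill (T (k + 1)) f)"
    and right: "\<And>k. k \<noteq> 0 \<Longrightarrow> kill (T (k + 1)) (s k f) = s k (kill (T k) f)"
  shows "kill (T k) f = f"
proof -
  have "finite (T -` variables f)" using assms(1) finite_variables by (intro finite_vimageI) auto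
  then obtain J where J: "\<And>j. T j \<in> variables f \<Longrightarrow> \<bar>j\<bar> \<le> J"
    using finite_nat_set_iff_bounded_le[of "(\<lambda>j. nat \<bar>j\<bar>) ` (T -` variables f)"]
    by (force simp: nat_le_iff)
  have out: "kill (T j) f = f" if "\<bar>j\<bar> > J" for j
    using J[of j] that by (intro kill_eq_self_if_not_variable) auto
  show ?thesis
  proof (cases "k \<ge> 1")
    case True
    have "k \<le> \<bar>k\<bar> + \<bar>J\<bar> + 1" by simp
    then show ?thesis
      using True
    proof (induction k rule: int_le_induct)
      case base
      show ?case by (rule out) simp
    next
      case (step i)
      then have "kill (T i) f = f" "i - 1 \<noteq> 0" by auto
      with left[of "i - 1"] s[of "i - 1"] show ?case by simp
    qed
  next
    case False
    have "- \<bar>k\<bar> - \<bar>J\<bar> - 1 \<le> k" by simp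
    then have "k \<le> 0 \<longrightarrow> kill (T k) f = f"
    proof (induction k rule: int_ge_induct)
      case base
      show ?case by (intro impI out) simp
    next
      case (step i)
      show ?case
      proof
        assume "i + 1 \<le> 0"
        then have "kill (T i) f = f" "i \<noteq> 0" using step by auto
        with right[of i] s[of i] show "kill (T (i + 1)) f = f" by simp
      qed
    qed
    with False show ?thesis by simp
  qed
qed

section \<open>Reflections on indeterminates, at c = 1 and under shifts\<close>

lemma indet_CVar: "indet (CVar j) = flag_coeff 0 0 (int (Suc j))"
  by (simp add: flag_coeff_def c_series_def cc_def nat_add_distrib)

lemma sx_indet: "i \<noteq> 0 \<Longrightarrow> sx i (indet v) =
    indet (case v of XVar j \<Rightarrow> XVar (adj_transp i j) | _ \<Rightarrow> v)"
  by (cases v) (simp_all add: indet_CVar sx_flag_coeff flip: xx_def yy_def)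

lemma sy_indet: "i \<noteq> 0 \<Longrightarrow> sy i (indet v) =
    indet (case v of YVar j \<Rightarrow> YVar (adj_transp i j) | _ \<Rightarrow> v)"
  by (cases v) (simp_all add: indet_CVar sy_flag_coeff flip: xx_def yy_def)

lemma kill_sx:
  assumes "k \<noteq> 0"
  shows "kill (XVar k) (sx k f) = sx k (kill (XVar (k + 1)) f)"
    and "kill (XVar (k + 1)) (sx k f) = sx k (kill (XVar k) f)"
proof -
  show "kill (XVar k) (sx k f) = sx k (kill (XVar (k + 1)) f)"
    by (rule lring_hom_ext_indet[OF comm_ring_hom_compose[OF comm_ring_hom_kill sx.comm_ring_hom_axioms]
          comm_ring_hom_compose[OF sx.comm_ring_hom_axioms comm_ring_hom_kill]])
      (auto simp: sx_indet[OF assms] adj_transp_eq split: lvar.splits)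
  show "kill (XVar (k + 1)) (sx k f) = sx k (kill (XVar k) f)"
    by (rule lring_hom_ext_indet[OF comm_ring_hom_compose[OF comm_ring_hom_kill sx.comm_ring_hom_axioms]
          comm_ring_hom_compose[OF sx.comm_ring_hom_axioms comm_ring_hom_kill]])
      (auto simp: sx_indet[OF assms] adj_transp_eq split: lvar.splits)
qed

lemma kill_sy:
  assumes "k \<noteq> 0"
  shows "kill (YVar k) (sy k f) = sy k (kill (YVar (k + 1)) f)"
    and "kill (YVar (k + 1)) (sy k f) = sy k (kill (YVar k) f)"
proof -
  show "kill (YVar k) (sy k f) = sy k (kill (YVar (k + 1)) f)"
    by (rule lring_hom_ext_indet[OF comm_ring_hom_compose[OF comm_ring_hom_kill sy.comm_ring_hom_axioms]
          comm_ring_hom_compose[OF sy.comm_ring_hom_axioms comm_ring_hom_kill]])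
      (auto simp: sy_indet[OF assms] adj_transp_eq split: lvar.splits)
  show "kill (YVar (k + 1)) (sy k f) = sy k (kill (YVar k) f)"
    by (rule lring_hom_ext_indet[OF comm_ring_hom_compose[OF comm_ring_hom_kill sy.comm_ring_hom_axioms]
          comm_ring_hom_compose[OF sy.comm_ring_hom_axioms comm_ring_hom_kill]])
      (auto simp: sy_indet[OF assms] adj_transp_eq split: lvar.splits)
qed

lemma set_c_zero_c_series: "series_map set_c_zero c_series = 1"
  using set_c_zero_c_flag[of 0 0] by (simp add: x_series_def y_series_def)

lemma set_c_zero_CVar: "set_c_zero (indet (CVar k)) = 0"
  using arg_cong[OF set_c_zero_c_series, of "\<lambda>a. fps_nth a (Suc k)"] by (simp add: c_series_def cc_def)

lemma kill_CVar_set_c_zero: "kill (CVar k) (set_c_zero f) = set_c_zero f"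
proof (rule lring_hom_ext_indet[OF comm_ring_hom_compose[OF comm_ring_hom_kill set_c_zero.comm_ring_hom_axioms]
      set_c_zero.comm_ring_hom_axioms])
  interpret kill: comm_ring_hom "kill (CVar k)" by (rule comm_ring_hom_kill)
  fix v
  show "kill (CVar k) (set_c_zero (indet v)) = set_c_zero (indet v)"
    using set_c_zero_xx set_c_zero_yy by (cases v) (simp_all add: set_c_zero_CVar xx_def yy_def)
qed

lemma series_map_one:
  assumes "comm_ring_hom h"
  shows "series_map h 1 = 1"
proof -
  interpret h: comm_ring_hom h by fact
  show ?thesis by (simp add: fps_eq_iff)
qed

lemma set_c_zero_sx:
  assumes "i \<noteq> 0"
  shows "set_c_zero (sx i f) = sx i (set_c_zero f)"
  by (rule lring_hom_ext[of "\<lambda>f. set_c_zero (sx i f)" "\<lambda>f. sx i (set_c_zero f)" 0 0])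
    (use assms in \<open>simp_all add: comm_ring_hom_compose set_c_zero.comm_ring_hom_axioms sx.comm_ring_hom_axioms
      set_c_zero_c_series sx_c_flag[of i 0 0, simplified] series_map_one flip: series_map_compose\<close>)

lemma set_c_zero_sy:
  assumes "i \<noteq> 0"
  shows "set_c_zero (sy i f) = sy i (set_c_zero f)"
  by (rule lring_hom_ext[of "\<lambda>f. set_c_zero (sy i f)" "\<lambda>f. sy i (set_c_zero f)" 0 0])
    (use assms in \<open>simp_all add: comm_ring_hom_compose set_c_zero.comm_ring_hom_axioms sy.comm_ring_hom_axioms
      set_c_zero_c_series sy_c_flag[of i 0 0, simplified] series_map_one flip: series_map_compose\<close>)

lemma adj_transp_shift: "adj_transp (i + m) (j + m) = adj_transp i j + m"
  by (auto simp: adj_transp_eq)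

text \<open>Index 0 is no exception: for m > 0 the reflection \<open>sx 0\<close>, which moves
  \<open>c\<close>, becomes \<open>sx m\<close>, which does not. The flag i + 1 makes the test
  series invariant.\<close>

lemma shift_ring_sx:
  assumes "m \<ge> 0"
  shows "shift_ring m (sx i f) = sx (i + m) (shift_ring m f)"
  by (rule lring_hom_ext[of "\<lambda>f. shift_ring m (sx i f)" "\<lambda>f. sx (i + m) (shift_ring m f)" "i + 1" 0])
    (use assms in \<open>simp_all add: comm_ring_hom_compose shift_ring.comm_ring_hom_axioms sx.comm_ring_hom_axioms
      shift_ring_c_flag sx_c_flag adj_transp_shift flip: series_map_compose\<close>)

lemma shift_ring_sy:
  assumes "m \<ge> 0"
  shows "shift_ring m (sy i f) = sy (i + m) (shift_ring m f)"
  by (rule lring_hom_ext[of "\<lambda>f. shift_ring m (sy i f)" "\<lambda>f. sy (i + m) (shift_ring m f)" 0 "i + 1"])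
    (use assms in \<open>simp_all add: comm_ring_hom_compose shift_ring.comm_ring_hom_axioms sy.comm_ring_hom_axioms
      shift_ring_c_flag sy_c_flag adj_transp_shift flip: series_map_compose\<close>)

text \<open>Each specialisation inherits the symmetries at all nonzero indices. Index 0 is lost
  since \<open>sx 0\<close> and \<open>sy 0\<close> move \<open>c\<close>, but two infinite
  half-lines of symmetric variables remain.\<close>

lemma invariant_homogeneous_eq_0:
  assumes "homogeneous d f" "d > 0" "\<And>i. sx i f = f" "\<And>i. sy i f = f"
  shows "f = 0"
proof (rule shift_set_c_zero_injective[of 0])
  fix m :: int assume m: "m \<ge> 0"
  define E where "E = set_c_zero (shift_ring m f)"
  have x: "sx i E = E" and y: "sy i E = E" if "i \<noteq> 0" for i
    using set_c_zero_sx[OF that, of "shift_ring m f"] set_c_zero_sy[OF that, of "shift_ring m f"]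
      shift_ring_sx[OF m, of "i - m" f] shift_ring_sy[OF m, of "i - m" f] assms(3,4) by (simp_all add: E_def)
  have "kill (XVar k) E = E" for k
    by (rule kill_of_symmetric[where s = sx]) (erule x kill_sx | simp add: inj_def)+
  moreover have "kill (YVar k) E = E" for k
    by (rule kill_of_symmetric[where s = sy]) (erule y kill_sy | simp add: inj_def)+
  moreover have "kill (CVar k) E = E" for k
    unfolding E_def by (rule kill_CVar_set_c_zero)
  ultimately have "kill v E = E" for v by (cases v) auto
  then have "lring_eval (\<lambda>_. 0) E = E" by (rule lring_eval_0_eq_self)
  moreover have "homogeneous d E"
    unfolding E_def by (intro homogeneous_set_c_zero homogeneous_shift_ring assms(1))
  ultimately show "set_c_zero (shift_ring m f) = 0"
    using lring_eval_0_homogeneous assms(2) by (simp flip: E_def)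
qed

section \<open>Comparison with double Schubert polynomials\<close>

lemma set_c_zero_partial_x:
  assumes "i \<noteq> 0"
  shows "set_c_zero (partial_x i f) = partial_x i (set_c_zero f)"
proof -
  have "set_c_zero (xx i - xx (i + 1)) = xx (i) - xx (i + 1)"
    by (simp add: set_c_zero.hom_minus add_ac)
  from divided_difference_transport[OF divided_difference_sx divided_difference_sx
      set_c_zero.comm_ring_hom_axioms set_c_zero_sx[OF assms] this]
  show ?thesis by (simp only: partial_x_conv)
qed

lemma negate_y_c_series: "series_map negate_y c_series = c_series"
  unfolding negate_y_def by (rule series_map_lring_map) simp

lemma negate_y_sx:
  assumes "i \<noteq> 0"
  shows "negate_y (sx i f) = sx i (negate_y f)"
  by (rule lring_hom_ext[of "\<lambda>f. negate_y (sx i f)" "\<lambda>f. sx i (negate_y f)" 0 0])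
    (use assms in \<open>simp_all add: comm_ring_hom_compose negate_y.comm_ring_hom_axioms sx.comm_ring_hom_axioms
      negate_y_c_series sx_c_flag[of i 0 0, simplified] sx.hom_uminus flip: series_map_compose\<close>)

lemma negate_y_partial_x:
  assumes "i \<noteq> 0"
  shows "negate_y (partial_x i f) = partial_x i (negate_y f)"
proof -
  have "negate_y (xx i - xx (i + 1)) = xx (i) - xx (i + 1)"
    by (simp add: negate_y.hom_minus add_ac)
  from divided_difference_transport[OF divided_difference_sx divided_difference_sx
      negate_y.comm_ring_hom_axioms negate_y_sx[OF assms] this]
  show ?thesis by (simp only: partial_x_conv)
qed

lemma negate_y_negate_y: "negate_y (negate_y f) = f"
  by (rule lring_hom_ext[of "\<lambda>f. negate_y (negate_y f)" "\<lambda>f. f" 0 0])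
    (simp_all add: comm_ring_hom_compose negate_y.comm_ring_hom_axioms comm_ring_hom_id
      negate_y_c_series negate_y.hom_uminus flip: series_map_compose)

lemma shift_ring_partial_x:
  assumes "m \<ge> 0"
  shows "shift_ring m (partial_x i f) = partial_x (i + m) (shift_ring m f)"
proof -
  have "shift_ring m (xx i - xx (i + 1)) = xx (i + m) - xx (i + m + 1)"
    by (simp add: shift_ring.hom_minus add_ac)
  from divided_difference_transport[OF divided_difference_sx divided_difference_sx
      shift_ring.comm_ring_hom_axioms shift_ring_sx[OF assms] this]
  show ?thesis by (simp only: partial_x_conv)
qed

section \<open>Shifting the family\<close>

lemma shift_perm_perms_on:
  assumes "w \<in> perms_on a b"
  shows "shift_perm m w \<in> perms_on (a + m) (b + m)"
proof -
  have "shift_perm m w = (\<lambda>i. i + m) \<circ> w \<circ> (\<lambda>i. i - m)"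
    by (simp add: shift_perm_def fun_eq_iff)
  moreover have "bij (\<lambda>i :: int. i + m)" by (rule bij_betw_byWitness[where f' = "\<lambda>i. i - m"]) auto
  moreover have "bij (\<lambda>i :: int. i - m)" by (rule bij_betw_byWitness[where f' = "\<lambda>i. i + m"]) auto
  ultimately have "bij (shift_perm m w)"
    using perms_on_bij[OF assms] by (simp add: bij_comp)
  then show ?thesis using perms_on_fix[OF assms] by (auto simp: perms_on_def shift_perm_def)
qed

lemma shift_perm_comp_adj: "shift_perm m (w \<circ> adj_transp i) = shift_perm m w \<circ> adj_transp (i + m)"
  by (auto simp: shift_perm_def fun_eq_iff adj_transp_eq)

lemma shift_ring_schubert_on:
  assumes "m \<ge> 0" "w \<in> perms_on a b"
  shows "shift_ring m (schubert_on a b w) = schubert_on (a + m) (b + m) (shift_perm m w)"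
  using assms(2)
proof (induction rule: perms_on_descend_induct)
  case reversal
  have "shift_perm m (reversal a b) = reversal (a + m) (b + m)"
    by (auto simp: shift_perm_def reversal_def fun_eq_iff)
  then show ?case by (simp add: shift_ring_top_det[OF assms(1)])
next
  case (descent w i)
  let ?S = "schubert_on (a + m) (b + m)"
  have desc: "shift_perm m w (i + m + 1) < shift_perm m w (i + m)"
    using descent.hyps(4) by (simp add: shift_perm_def algebra_simps)
  have "shift_ring m (schubert_on a b (w \<circ> adj_transp i)) = partial_x (i + m) (?S (shift_perm m w))"
    using partial_x_schubert_on_descent[OF descent.hyps] shift_ring_partial_x[OF assms(1)] descent.IH by metis
  also have "\<dots> = ?S (shift_perm m w \<circ> adj_transp (i + m))"
    using descent.hyps desc by (intro partial_x_schubert_on_descent shift_perm_perms_on) auto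
  finally show ?case by (simp only: shift_perm_comp_adj)
qed

lemma shift_ring_schubert_Z:
  assumes "m \<ge> 0" "w \<in> S_Z"
  shows "shift_ring m (schubert_Z w) = schubert_Z (shift_perm m w)"
proof -
  obtain a b where ab: "a \<le> 0" "0 \<le> b" "w \<in> perms_on a b"
    using S_Z_perms_on_large[OF assms(2)] by blast
  then show ?thesis
    using schubert_Z_eq[of a b w] schubert_Z_eq[OF _ shift_perm_perms_on[OF ab(3)], of m]
      shift_ring_schubert_on[OF assms(1) ab(3)] by simp
qed

lemma longest_perm_eq_reversal: "longest_perm n = reversal 1 (int n)"
  by (auto simp: longest_perm_def reversal_def fun_eq_iff)

lemma schubert_Z_longest_perm: "schubert_Z (longest_perm n) = top_det 1 (int n)"
proof (cases "n = 0")
  case True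
  then have "longest_perm n = id" by (auto simp: longest_perm_def fun_eq_iff)
  then show ?thesis using True by (simp add: schubert_Z_id top_det_def flag_det_def)
next
  case False
  then show ?thesis by (simp add: longest_perm_eq_reversal schubert_Z_reversal)
qed

lemma S_plus_iff_perms_on: "w \<in> S_plus \<longleftrightarrow> (\<exists>n. w \<in> perms_on 1 (int n))"
proof
  assume w: "w \<in> S_plus"
  then obtain a b where "a \<le> 1" "0 \<le> b" "w \<in> perms_on a b"
    using S_Z_perms_on_large[of w 1 0] by (auto simp: S_plus_def)
  then have "w \<in> perms_on 1 (int (nat b))"
    using w by (auto simp: perms_on_def S_plus_def)
  then show "\<exists>n. w \<in> perms_on 1 (int n)" by blast
next
  assume "\<exists>n. w \<in> perms_on 1 (int n)"
  then show "w \<in> S_plus"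
    using S_Z_iff_perms_on by (auto simp: S_plus_def perms_on_def)
qed

text \<open>The right-hand side depends on \<open>w\<close> alone and \<open>negate_y\<close> is
  injective, so this also shows that the classical relation is single-valued.\<close>

lemma negate_y_is_double_schubert:
  "is_double_schubert w f \<Longrightarrow> w \<in> S_plus \<and> negate_y f = set_c_zero (schubert_Z w)"
proof (induction rule: is_double_schubert.induct)
  case (longest n)
  have "longest_perm n \<in> S_plus"
    using S_plus_iff_perms_on reversal_in_perms_on longest_perm_eq_reversal by metis
  then show ?case
    by (simp add: schubert_Z_longest_perm set_c_zero_top_det negate_y.hom_prod negate_y.hom_minus case_prod_beta)
next
  case (descent w f i)
  then have w: "w \<in> S_Z" by (simp add: S_plus_def)
  have "w \<circ> adj_transp i \<in> S_plus"
    using descent S_Z_comp_adj(1)[OF w] by (auto simp: S_plus_def adj_transp_eq)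
  \<comment> \<open>Descents are taken at i \<ge> 1 only, where the operator commutes with c = 1 and
    with the sign change.\<close>
  moreover have "negate_y (partial_x i f) = set_c_zero (schubert_Z (w \<circ> adj_transp i))"
    using descent partial_x_schubert_Z(1)[OF w, of i] set_c_zero_partial_x[of i "schubert_Z w"] negate_y_partial_x[of i f]
    by simp
  ultimately show ?case by (simp add: comp_def)
qed

lemma is_double_schubert_ex:
  assumes "w \<in> S_plus"
  shows "\<exists>f. is_double_schubert w f"
proof -
  obtain n where "w \<in> perms_on 1 (int n)" using assms S_plus_iff_perms_on by blast
  then show ?thesis
  proof (induction rule: perms_on_descend_induct)
    case reversal
    then show ?case using is_double_schubert.longest[of n] by (auto simp: longest_perm_eq_reversal)
  next
    case (descent w i)
    then show ?case using is_double_schubert.descent by blast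
  qed
qed

lemma negate_y_double_schubert:
  assumes "w \<in> S_plus"
  shows "negate_y (double_schubert w) = set_c_zero (schubert_Z w)"
proof -
  obtain f where f: "is_double_schubert w f" using is_double_schubert_ex[OF assms] by blast
  have "double_schubert w = f"
    unfolding double_schubert_def
  proof (rule the_equality[where P = "is_double_schubert w", OF f])
    fix g assume "is_double_schubert w g"
    then have "negate_y g = negate_y f" using negate_y_is_double_schubert f by metis
    then show "g = f" by (metis negate_y_negate_y)
  qed
  then show ?thesis using negate_y_is_double_schubert[OF f] by simp
qed

lemma enriched_schubert_eq:
  assumes w: "w \<in> S_Z"
  shows "enriched_schubert w = schubert_Z w"
  unfolding enriched_schubert_def
proof (rule the_equality)
  show spec: "\<forall>m>0. shift_perm m w \<in> S_plus \<longrightarrow>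
      set_c_zero (shift_ring m (schubert_Z w)) = negate_y (double_schubert (shift_perm m w))"
    using shift_ring_schubert_Z[OF _ w] negate_y_double_schubert by simp
  fix f assume f: "\<forall>m>0. shift_perm m w \<in> S_plus \<longrightarrow>
      set_c_zero (shift_ring m f) = negate_y (double_schubert (shift_perm m w))"
  obtain a b where ab: "a \<le> 0" "0 \<le> b" "w \<in> perms_on a b"
    using S_Z_perms_on_large[OF w] by blast
  have "f - schubert_Z w = 0"
  \<comment> \<open>From m = 1 - a on, the shifted permutation moves positive integers only.\<close>
  proof (rule shift_set_c_zero_injective[of "1 - a"])
    fix m :: int assume m: "m \<ge> 1 - a"
    have "perms_on (a + m) (b + m) \<subseteq> perms_on 1 (int (nat (b + m)))"
      using m ab by (intro perms_on_mono) auto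
    then have "shift_perm m w \<in> S_plus"
      using shift_perm_perms_on[OF ab(3), of m] S_plus_iff_perms_on by blast
    moreover have "m > 0" using m ab(1) by simp
    ultimately have "set_c_zero (shift_ring m f) = set_c_zero (shift_ring m (schubert_Z w))"
      using f spec by simp
    then show "set_c_zero (shift_ring m (f - schubert_Z w)) = 0"
      by (simp add: shift_ring.hom_minus set_c_zero.hom_minus)
  qed
  then show "f = schubert_Z w" by simp
qed

text \<open>Induction on length: an operator that lowers the length has equal values on both
  families by hypothesis, any other gives 0 on both. One of the two cases always applies, because
  neighbouring values of a permutation differ.\<close>

lemma schubert_properties_unique:
  assumes F: "schubert_properties F" and G: "schubert_properties G" and "w \<in> S_Z"
  shows "F w = G w"
  using assms(3)
proof (induction "perm_length w" arbitrary: w rule: less_induct)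
  case less
  show ?case
  proof (cases "perm_length w = 0")
    case True
    then show ?thesis
      using perm_length_0_imp_id[OF less.prems] F G by (simp add: schubert_properties_def)
  next
    case False
    have "sx i (F w - G w) = F w - G w" for i
    proof -
      have "partial_x i (F w) = partial_x i (G w)"
      proof (cases "perm_length (w \<circ> adj_transp i) < perm_length w")
        case True
        then have "F (w \<circ> adj_transp i) = G (w \<circ> adj_transp i)"
          using less.hyps S_Z_comp_adj(1)[OF less.prems] by blast
        then show ?thesis using True F G less.prems by (simp add: schubert_properties_def)
      next
        case False
        obtain a b where "w \<in> perms_on a b" using less.prems S_Z_iff_perms_on by blast
        then have "w i \<noteq> w (i + 1)" using perms_on_eq_iff[of w a b i "i + 1"] by simp
        then have "perm_length (w \<circ> adj_transp i) > perm_length w"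
          using False perm_length_right_iff[OF less.prems, of i] by linarith
        then show ?thesis using F G less.prems by (simp add: schubert_properties_def)
      qed
      then show ?thesis
        unfolding partial_x_eq_0_iff[symmetric] by (simp add: partial_x_diff)
    qed
    moreover have "sy i (F w - G w) = F w - G w" for i
    proof -
      have "partial_y i (F w) = partial_y i (G w)"
      proof (cases "perm_length (adj_transp i \<circ> w) < perm_length w")
        case True
        then have "F (adj_transp i \<circ> w) = G (adj_transp i \<circ> w)"
          using less.hyps S_Z_comp_adj(2)[OF less.prems] by blast
        then show ?thesis using True F G less.prems by (simp add: schubert_properties_def)
      next
        case False
        obtain a b where "perm_inv w \<in> perms_on a b"
          using S_Z_inv[OF less.prems] S_Z_iff_perms_on by blast
        then have "perm_inv w i \<noteq> perm_inv w (i + 1)" using perms_on_eq_iff[of "perm_inv w" a b i "i + 1"] by simp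
        then have "perm_length (adj_transp i \<circ> w) > perm_length w"
          using False perm_length_left_iff[OF less.prems, of i] by linarith
        then show ?thesis using F G less.prems by (simp add: schubert_properties_def)
      qed
      then show ?thesis
        unfolding partial_y_eq_0_iff[symmetric] by (simp add: partial_y_diff)
    qed
    moreover have "homogeneous (perm_length w) (F w - G w)"
      using F G less.prems by (auto simp: schubert_properties_def intro: homogeneous_diff)
    ultimately have "F w - G w = 0"
      using False by (intro invariant_homogeneous_eq_0) auto
    then show ?thesis by simp
  qed
qed

lemma schubert_properties_enriched_schubert: "schubert_properties enriched_schubert"
  unfolding schubert_properties_def
proof (intro conjI ballI allI impI)
  have "id \<in> S_Z" using id_in_perms_on S_Z_iff_perms_on by blast
  then show "enriched_schubert id = 1" by (simp add: enriched_schubert_eq schubert_Z_id)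
next
  fix w assume w: "w \<in> S_Z"
  then show "homogeneous (perm_length w) (enriched_schubert w)"
    by (simp add: enriched_schubert_eq homogeneous_schubert_Z)
  fix i
  note eqs = enriched_schubert_eq[OF w] enriched_schubert_eq[OF S_Z_comp_adj(1)[OF w, of i]]
    enriched_schubert_eq[OF S_Z_comp_adj(2)[OF w, of i]]
  show "partial_x i (enriched_schubert w) = enriched_schubert (w \<circ> adj_transp i)"
    if "perm_length (w \<circ> adj_transp i) < perm_length w"
    using that partial_x_schubert_Z(1)[OF w] perm_length_right_iff(1)[OF w] eqs by simp
  show "partial_x i (enriched_schubert w) = 0" if "perm_length (w \<circ> adj_transp i) > perm_length w"
    using that partial_x_schubert_Z(2)[OF w] perm_length_right_iff(2)[OF w] eqs by simp
  show "partial_y i (enriched_schubert w) = enriched_schubert (adj_transp i \<circ> w)"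
    if "perm_length (adj_transp i \<circ> w) < perm_length w"
    using that partial_y_schubert_Z(1)[OF w] perm_length_left_iff(1)[OF w] eqs by simp
  show "partial_y i (enriched_schubert w) = 0" if "perm_length (adj_transp i \<circ> w) > perm_length w"
    using that partial_y_schubert_Z(2)[OF w] perm_length_left_iff(2)[OF w] eqs by simp
qed

theorem theorem3p2:
  shows "schubert_properties enriched_schubert \<and>
    (\<forall>F. schubert_properties F \<longrightarrow> (\<forall>w \<in> S_Z. F w = enriched_schubert w))"
  using schubert_properties_enriched_schubert schubert_properties_unique by blast

end
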